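(* Fix an integer $p\ge2$. If $(\beta_1,\beta_2)$ is off the phase transition curve, then $$\lim_{n\to\infty}\frac{\partial^2}{\partial\beta_1\partial\beta_2}\psi_n(\beta_1,\beta_2)=\frac{\partial^2}{\partial\beta_1\partial\beta_2}\lim_{n\to\infty}\psi_n(\beta_1,\beta_2)=\frac{p(x^* )^{p-1}}{|\ell''(x^* )|}.$$ If $(\beta_1,\beta_2)$ is on the phase transition curve but is not the critical point, then $$\lim_{n\to\infty}\frac1n\frac{\partial^2}{\partial\beta_1\partial\beta_2}\psi_n(\beta_1,\beta_2)=\frac{((x_1^* )^p-(x_2^* )^p)(x_1^*-x_2^* )\sqrt{x_1^*(1-x_1^* )|\ell''(x_1^* )|}\sqrt{x_2^*(1-x_2^* )|\ell''(x_2^* )|}}{\left(\sqrt{x_1^*(1-x_1^* )|\ell''(x_1^* )|}+\sqrt{x_2^*(1-x_2^* )|\ell''(x_2^* )|}\right)^2}.$$ At the critical point $(\beta_1,\beta_2)=(\beta_1^c,\beta_2^c)$, $$\lim_{n\to\infty}\frac{1}{n^{1/2}}\frac{\partial^2}{\partial\beta_1\partial\beta_2}\psi_n(\beta_1,\beta_2)=\frac{2\sqrt6\,\Gamma(\frac34)}{\Gamma(\frac14)}\frac{(p-1)^{p}}{p^{p+\frac12}}.$$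
   Context: For $n\ge 1$, a directed graph (loops allowed, no duplicate edges) on $n$ nodes is identified with its adjacency matrix $X=(X_{ij})_{1\le i,j\le n}\in\{0,1\}^{n\times n}$. Set $$e(X)=n^{-2}\sum_{1\le i,j\le n}X_{ij},\qquad s(X)=n^{-p-1}\sum_{1\le i,j_1,\dots,j_p\le n}X_{ij_1}X_{ij_2}\cdots X_{ij_p}.$$ For real $\beta_1,\beta_2$, $Z_n(\beta_1,\beta_2)=\sum_{X\in\{0,1\}^{n\times n}}\exp[n^2(\beta_1e(X)+\beta_2s(X))]$ and $\psi_n(\beta_1,\beta_2)=n^{-2}\log Z_n(\beta_1,\beta_2)$. The function $\ell:[0,1]\to\mathbb{R}$ is $\ell(x)=\beta_1x+\beta_2x^p-x\log x-(1-x)\log(1-x)$ (with $0\log0=0$); $\ell''$ is its second derivative in $x$. Phase transition curve: by a known result of Radin and Yin there is a curve in the $(\beta_1,\beta_2)$-plane, of the form $\beta_2=q(\beta_1)$ for $\beta_1\le\beta_1^c$, with endpoint (the critical point) $$(\beta_1^c,\beta_2^c)=\left(\log(p-1)-\frac{p}{p-1},\ \frac{p^{p-1}}{(p-1)^p}\right),$$ such that off the curve and at the endpoint $\ell$ has a unique global maximizer $x^*\in(0,1)$, while on the curve away from the endpoint $\ell$ has exactly two global maximizers $x_1^*,x_2^*$, with $0<x_1^*<\frac{p-1}{p}<x_2^*<1$. The critical point belongs to the curve, so "off the curve" excludes it. *)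

theory Defs
  imports "HOL-Analysis.Analysis"
begin

definition adjacency_matrices :: "nat \<Rightarrow> (nat \<Rightarrow> nat \<Rightarrow> real) set" where
  "adjacency_matrices n = {1..n} \<rightarrow>\<^sub>E ({1..n} \<rightarrow>\<^sub>E {0, 1})"

definition edge_density :: "nat \<Rightarrow> (nat \<Rightarrow> nat \<Rightarrow> real) \<Rightarrow> real" where
  "edge_density n X = (\<Sum>i\<in>{1..n}. \<Sum>j\<in>{1..n}. X i j) / real n ^ 2"

(* The tuple (j_1, ..., j_p) is a function j on {1..p} with values in {1..n}. *)
definition star_density :: "nat \<Rightarrow> nat \<Rightarrow> (nat \<Rightarrow> nat \<Rightarrow> real) \<Rightarrow> real" where
  "star_density p n X =
     (\<Sum>i\<in>{1..n}. \<Sum>j\<in>{1..p} \<rightarrow>\<^sub>E {1..n}. \<Prod>k\<in>{1..p}. X i (j k)) / real n ^ (p + 1)"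

definition partition_function :: "nat \<Rightarrow> nat \<Rightarrow> real \<Rightarrow> real \<Rightarrow> real" where
  "partition_function p n \<beta>1 \<beta>2 =
     (\<Sum>X\<in>adjacency_matrices n.
        exp (real n ^ 2 * (\<beta>1 * edge_density n X + \<beta>2 * star_density p n X)))"

definition psi :: "nat \<Rightarrow> nat \<Rightarrow> real \<Rightarrow> real \<Rightarrow> real" where
  "psi p n \<beta>1 \<beta>2 = ln (partition_function p n \<beta>1 \<beta>2) / real n ^ 2"

(* At the endpoints 0 and 1, ln 0 is multiplied by 0, which gives 0 log 0 = 0. *)
definition ell :: "nat \<Rightarrow> real \<Rightarrow> real \<Rightarrow> real \<Rightarrow> real" where
  "ell p \<beta>1 \<beta>2 x = \<beta>1 * x + \<beta>2 * x ^ p - x * ln x - (1 - x) * ln (1 - x)"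

definition ell'' :: "nat \<Rightarrow> real \<Rightarrow> real \<Rightarrow> real \<Rightarrow> real" where
  "ell'' p \<beta>1 \<beta>2 x = (deriv ^^ 2) (ell p \<beta>1 \<beta>2) x"

definition maximizers :: "nat \<Rightarrow> real \<Rightarrow> real \<Rightarrow> real set" where
  "maximizers p \<beta>1 \<beta>2 = {x \<in> {0..1}. \<forall>y\<in>{0..1}. ell p \<beta>1 \<beta>2 y \<le> ell p \<beta>1 \<beta>2 x}"

definition beta1_crit :: "nat \<Rightarrow> real" where
  "beta1_crit p = ln (real p - 1) - real p / (real p - 1)"

definition beta2_crit :: "nat \<Rightarrow> real" where
  "beta2_crit p = real p ^ (p - 1) / (real p - 1) ^ p"

definition phase_curve :: "nat \<Rightarrow> (real \<Rightarrow> real) \<Rightarrow> (real \<times> real) set" where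
  "phase_curve p q = {(\<beta>1, \<beta>2). \<beta>1 \<le> beta1_crit p \<and> \<beta>2 = q \<beta>1}"

(* The properties in the theorem of Radin and Yin that single out the phase transition curve.
   They determine q uniquely on {..beta1_crit p}; the values of q elsewhere are irrelevant. *)
definition is_phase_curve :: "nat \<Rightarrow> (real \<Rightarrow> real) \<Rightarrow> bool" where
  "is_phase_curve p q \<longleftrightarrow>
     q (beta1_crit p) = beta2_crit p \<and>
     (\<forall>\<beta>1 \<beta>2. (\<beta>1, \<beta>2) \<notin> phase_curve p q \<or> (\<beta>1, \<beta>2) = (beta1_crit p, beta2_crit p) \<longrightarrow>
        (\<exists>x\<in>{0<..<1}. maximizers p \<beta>1 \<beta>2 = {x})) \<and>
     (\<forall>\<beta>1 \<beta>2. (\<beta>1, \<beta>2) \<in> phase_curve p q \<and> (\<beta>1, \<beta>2) \<noteq> (beta1_crit p, beta2_crit p) \<longrightarrow>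
        (\<exists>x1 x2. 0 < x1 \<and> x1 < (real p - 1) / real p \<and> (real p - 1) / real p < x2 \<and> x2 < 1 \<and>
           maximizers p \<beta>1 \<beta>2 = {x1, x2}))"

(* First differentiate in the second argument, then in the first one. *)
definition mixed_partial :: "(real \<Rightarrow> real \<Rightarrow> real) \<Rightarrow> real \<Rightarrow> real \<Rightarrow> real" where
  "mixed_partial f \<beta>1 \<beta>2 = deriv (\<lambda>b1. deriv (\<lambda>b2. f b1 b2) \<beta>2) \<beta>1"

(* The derivative operator is total, so existence of the derivatives is a separate claim. *)
definition mixed_partial_exists :: "(real \<Rightarrow> real \<Rightarrow> real) \<Rightarrow> real \<Rightarrow> real \<Rightarrow> bool" where
  "mixed_partial_exists f \<beta>1 \<beta>2 \<longleftrightarrow>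
     (\<forall>\<^sub>F b1 in nhds \<beta>1. (\<lambda>b2. f b1 b2) field_differentiable (at \<beta>2)) \<and>
     (\<lambda>b1. deriv (\<lambda>b2. f b1 b2) \<beta>2) field_differentiable (at \<beta>1)"

definition psi_lim :: "nat \<Rightarrow> real \<Rightarrow> real \<Rightarrow> real" where
  "psi_lim p \<beta>1 \<beta>2 = lim (\<lambda>n. psi p n \<beta>1 \<beta>2)"

end

theory Submission
  imports Defs "HOL-Probability.Sinc_Integral" "HOL-Real_Asymp.Real_Asymp"
begin

text \<open>The rows of the adjacency matrix are independent, so the partition function is the \<open>n\<close>-th power of
  \<open>\<Sum>k\<le>n. (n choose k) * exp (n * (\<beta>1 * (k/n) + \<beta>2 * (k/n)^p))\<close>, and the mixed partial derivative of \<open>psi\<close> is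
  \<open>n\<close> times the covariance of \<open>k/n\<close> and \<open>(k/n)^p\<close> under the corresponding Gibbs weights. By Stirling's formula these
  weights are \<open>exp (n * ell (k/n))\<close> up to a smooth factor, and Laplace's method around the maximizers of \<open>ell\<close>
  gives the covariance: a Gaussian of variance \<open>1 / (n * \<bar>ell''\<bar>)\<close> for a nondegenerate maximizer, a two-point mixture on the
  curve, and the density \<open>exp (- a * y^4)\<close> on the scale \<open>n powr (-1/4)\<close> at the critical point. The limit of \<open>psi\<close> is the
  maximum of \<open>ell\<close>, which is differentiated by the envelope theorem and the inverse function theorem.\<close>

section \<open>Reduction to one row\<close>

text \<open>With a single maximizer x0 the covariance tends to 0, so the limits of the raw moments
  of x and x^p cancel and say nothing about its size. The factorization x^p - x0^p = (x - x0) g(x),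
  with g a polynomial, rewrites it exactly through moments of the rescaled deviation n^(1/(2m)) (x -
  x0), all of which have finite limits. The prefactor p x0^(p-1) in the result is g(x0), and the
  first moment vanishes by parity. With two maximizers the covariance has a nonzero limit and raw
  moments suffice. The smooth factor 1/sqrt(x(1-x)) from Stirling's formula cancels when there is
  one maximizer; with two it takes different values at them, which is why sqrt(x(1-x)|ell''(x)|)
  stands in the formula on the curve. The assumption on the curve only counts and locates
  maximizers. That \<open>ell''\<close> is nonzero at them away from the critical point has to be
  derived: a degenerate maximizer can only sit at (p-1)/p, and the vanishing of two derivatives
  there determines both parameters.\<close>

definition gibbs_sum :: "nat \<Rightarrow> nat \<Rightarrow> real \<Rightarrow> real \<Rightarrow> (real \<Rightarrow> real) \<Rightarrow> real" where
  "gibbs_sum p n \<beta>1 \<beta>2 f =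
     (\<Sum>k\<le>n. real (n choose k) * exp (real n * (\<beta>1 * (real k / real n) + \<beta>2 * (real k / real n) ^ p))
        * f (real k / real n))"

text \<open>A 0/1 row is the indicator of the set of its ones, so the rows with sum k correspond to
  the k-subsets of \<open>A\<close>. The \<open>restrict\<close> in the bijection restores the value
  \<open>undefined\<close> that members of the function space take outside \<open>A\<close>.\<close>

lemma sum_PiE_binary:
  fixes F :: "real \<Rightarrow> real"
  assumes "finite A"
  shows "(\<Sum>r\<in>A \<rightarrow>\<^sub>E {0, 1}. F (\<Sum>a\<in>A. r a)) = (\<Sum>k\<le>card A. real (card A choose k) * F (real k))"
proof -
  have "(\<Sum>r\<in>A \<rightarrow>\<^sub>E {0, 1}. F (\<Sum>a\<in>A. r a)) = (\<Sum>S\<in>Pow A. F (real (card S)))"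
  proof (rule sum.reindex_bij_witness[where i = "\<lambda>S. restrict (indicator S) A" and j = "\<lambda>r. {a \<in> A. r a = 1}"])
    fix r :: "'a \<Rightarrow> real" assume r: "r \<in> A \<rightarrow>\<^sub>E {0, 1}"
    show "restrict (indicator {a \<in> A. r a = 1}) A = r"
    proof
      fix a show "restrict (indicator {a \<in> A. r a = 1}) A a = r a"
        using PiE_mem[OF r, of a] PiE_arb[OF r, of a] by (auto simp: indicator_def)
    qed
    have "(\<Sum>a\<in>A. r a) = (\<Sum>a\<in>A. indicator {a \<in> A. r a = 1} a)"
      using PiE_mem[OF r] by (intro sum.cong) (auto simp: indicator_def)
    also have "\<dots> = real (card {a \<in> A. r a = 1})"
      using assms by (simp add: sum.If_cases indicator_def Int_def)
    finally show "F (real (card {a \<in> A. r a = 1})) = F (\<Sum>a\<in>A. r a)" by simp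
  qed (auto simp: indicator_def)
  also have "\<dots> = (\<Sum>k\<le>card A. \<Sum>S\<in>{S \<in> Pow A. card S = k}. F (real (card S)))"
    using assms by (intro sum.group[symmetric]) (auto intro: card_mono)
  also have "\<dots> = (\<Sum>k\<le>card A. real (card A choose k) * F (real k))"
  proof (rule sum.cong[OF refl])
    fix k
    have "(\<Sum>S\<in>{S \<in> Pow A. card S = k}. F (real (card S))) = real (card {S \<in> Pow A. card S = k}) * F (real k)"
      by simp
    also have "card {S \<in> Pow A. card S = k} = card A choose k"
      using n_subsets[OF assms, of k] by (simp add: Pow_def)
    finally show "(\<Sum>S\<in>{S \<in> Pow A. card S = k}. F (real (card S))) = real (card A choose k) * F (real k)" .
  qed
  finally show ?thesis .
qed

text \<open>Summing a p-fold product of entries of row i over all tuples gives the p-th power of its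
  row sum. The exponent is thus a sum over rows of one function of the row sum, and its exponential
  is a product over independent rows.\<close>

lemma partition_function_eq:
  assumes "n \<ge> 1"
  shows "partition_function p n \<beta>1 \<beta>2 = gibbs_sum p n \<beta>1 \<beta>2 (\<lambda>_. 1) ^ n"
proof -
  define F where "F = (\<lambda>r::real. exp (real n * (\<beta>1 * (r / real n) + \<beta>2 * (r / real n) ^ p)))"
  have star: "(\<Sum>j\<in>{1..p} \<rightarrow>\<^sub>E {1..n}. \<Prod>k\<in>{1..p}. X i (j k)) = (\<Sum>j\<in>{1..n}. X i j) ^ p"
    for X :: "nat \<Rightarrow> nat \<Rightarrow> real" and i
    using prod_sum_PiE[of "{1..p}" "\<lambda>_. {1..n}" "\<lambda>_. X i"] by simp
  have "exp (real n ^ 2 * (\<beta>1 * edge_density n X + \<beta>2 * star_density p n X))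
      = (\<Prod>i\<in>{1..n}. F (\<Sum>j\<in>{1..n}. X i j))" for X
  proof -
    have "real n ^ 2 * (\<beta>1 * edge_density n X + \<beta>2 * star_density p n X) =
        \<beta>1 * (\<Sum>i\<in>{1..n}. \<Sum>j\<in>{1..n}. X i j) + \<beta>2 * (\<Sum>i\<in>{1..n}. (\<Sum>j\<in>{1..n}. X i j) ^ p) * (real n / real n ^ p)"
      unfolding edge_density_def star_density_def star using assms
      by (simp add: field_simps power2_eq_square)
    also have "\<dots> = (\<Sum>i\<in>{1..n}. \<beta>1 * (\<Sum>j\<in>{1..n}. X i j) + \<beta>2 * (\<Sum>j\<in>{1..n}. X i j) ^ p * (real n / real n ^ p))"
      by (simp only: sum.distrib sum_distrib_left sum_distrib_right)
    also have "\<dots> = (\<Sum>i\<in>{1..n}. real n * (\<beta>1 * ((\<Sum>j\<in>{1..n}. X i j) / real n) + \<beta>2 * ((\<Sum>j\<in>{1..n}. X i j) / real n) ^ p))"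
      using assms by (intro sum.cong refl) (simp add: field_simps)
    finally show ?thesis by (simp add: F_def exp_sum)
  qed
  hence "partition_function p n \<beta>1 \<beta>2 = (\<Sum>X\<in>adjacency_matrices n. \<Prod>i\<in>{1..n}. F (\<Sum>j\<in>{1..n}. X i j))"
    by (simp add: partition_function_def)
  also have "\<dots> = (\<Prod>i\<in>{1..n}. \<Sum>r\<in>{1..n} \<rightarrow>\<^sub>E {0, 1}. F (\<Sum>j\<in>{1..n}. r j))"
    unfolding adjacency_matrices_def by (rule prod_sum_PiE[symmetric]) (auto intro: finite_PiE)
  also have "\<dots> = gibbs_sum p n \<beta>1 \<beta>2 (\<lambda>_. 1) ^ n"
    by (subst sum_PiE_binary) (simp_all add: gibbs_sum_def F_def)
  finally show ?thesis .
qed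

lemma gibbs_sum_pos: "gibbs_sum p n \<beta>1 \<beta>2 (\<lambda>_. 1) > 0"
  unfolding gibbs_sum_def by (intro sum_pos) auto

lemma psi_eq:
  assumes "n \<ge> 1"
  shows "psi p n \<beta>1 \<beta>2 = ln (gibbs_sum p n \<beta>1 \<beta>2 (\<lambda>_. 1)) / real n"
proof -
  have "ln (partition_function p n \<beta>1 \<beta>2) = real n * ln (gibbs_sum p n \<beta>1 \<beta>2 (\<lambda>_. 1))"
    using gibbs_sum_pos[of p n \<beta>1 \<beta>2] by (simp add: partition_function_eq[OF assms] ln_realpow)
  thus ?thesis using assms by (simp add: psi_def power2_eq_square)
qed

lemma DERIV_gibbs_sum_1:
  "((\<lambda>b. gibbs_sum p n b \<beta>2 f) has_field_derivative real n * gibbs_sum p n \<beta>1 \<beta>2 (\<lambda>x. x * f x)) (at \<beta>1)"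
  unfolding gibbs_sum_def sum_distrib_left
  by (cases "n = 0") (auto intro!: derivative_eq_intros sum.cong)

lemma DERIV_gibbs_sum_2:
  "((\<lambda>b. gibbs_sum p n \<beta>1 b f) has_field_derivative real n * gibbs_sum p n \<beta>1 \<beta>2 (\<lambda>x. x ^ p * f x)) (at \<beta>2)"
  unfolding gibbs_sum_def sum_distrib_left
  by (cases "n = 0") (auto intro!: derivative_eq_intros sum.cong)

text \<open>Differentiating a Gibbs sum in \<open>\<beta>1\<close> or \<open>\<beta>2\<close>
  multiplies each term by n x or n x^p. Hence the derivative of \<open>psi\<close> in
  \<open>\<beta>2\<close> is the Gibbs mean of x^p, and the quotient rule in \<open>\<beta>1\<close>
  produces a covariance.\<close>

lemma
  fixes p n :: nat and \<beta>1 \<beta>2 :: real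
  defines "G \<equiv> gibbs_sum p n \<beta>1 \<beta>2"
  assumes n: "n \<ge> 1"
  shows mixed_partial_exists_psi: "mixed_partial_exists (psi p n) \<beta>1 \<beta>2"
    and mixed_partial_psi: "mixed_partial (psi p n) \<beta>1 \<beta>2 =
       real n * ((G (\<lambda>x. x ^ (p + 1)) * G (\<lambda>_. 1) - G (\<lambda>x. x) * G (\<lambda>x. x ^ p)) / G (\<lambda>_. 1) ^ 2)"
proof -
  have psi: "psi p n = (\<lambda>b1 b2. ln (gibbs_sum p n b1 b2 (\<lambda>_. 1)) / real n)"
    using psi_eq[OF n] by blast
  have D2: "((\<lambda>b2. psi p n b1 b2) has_field_derivative
      gibbs_sum p n b1 \<beta>2 (\<lambda>x. x ^ p) / gibbs_sum p n b1 \<beta>2 (\<lambda>_. 1)) (at \<beta>2)" for b1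
    unfolding psi using n gibbs_sum_pos[of p n b1 \<beta>2]
    by (auto intro!: derivative_eq_intros DERIV_gibbs_sum_2)
  have "((\<lambda>b1. gibbs_sum p n b1 \<beta>2 (\<lambda>x. x ^ p) / gibbs_sum p n b1 \<beta>2 (\<lambda>_. 1)) has_field_derivative
      real n * ((G (\<lambda>x. x ^ (p + 1)) * G (\<lambda>_. 1) - G (\<lambda>x. x) * G (\<lambda>x. x ^ p)) / G (\<lambda>_. 1) ^ 2)) (at \<beta>1)"
    unfolding G_def using n gibbs_sum_pos[of p n \<beta>1 \<beta>2]
    by (auto intro!: derivative_eq_intros DERIV_gibbs_sum_1 simp: field_simps power2_eq_square)
  hence D12: "((\<lambda>b1. deriv (\<lambda>b2. psi p n b1 b2) \<beta>2) has_field_derivative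
      real n * ((G (\<lambda>x. x ^ (p + 1)) * G (\<lambda>_. 1) - G (\<lambda>x. x) * G (\<lambda>x. x ^ p)) / G (\<lambda>_. 1) ^ 2)) (at \<beta>1)"
    by (simp add: DERIV_imp_deriv[OF D2])
  show "mixed_partial_exists (psi p n) \<beta>1 \<beta>2"
    unfolding mixed_partial_exists_def field_differentiable_def using D2 D12 by (auto intro!: always_eventually)
  show "mixed_partial (psi p n) \<beta>1 \<beta>2 =
       real n * ((G (\<lambda>x. x ^ (p + 1)) * G (\<lambda>_. 1) - G (\<lambda>x. x) * G (\<lambda>x. x ^ p)) / G (\<lambda>_. 1) ^ 2)"
    unfolding mixed_partial_def by (rule DERIV_imp_deriv[OF D12])
qed

section \<open>Stirling's formula and binomial weights\<close>

text \<open>Only the convergence of this quotient is needed: its limit cancels from every covariance.\<close>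

definition stirling_quotient :: "nat \<Rightarrow> real" where
  "stirling_quotient n = fact n / (sqrt (real n) * (real n / exp 1) ^ n)"

lemma stirling_quotient_pos: "n \<ge> 1 \<Longrightarrow> stirling_quotient n > 0"
  by (simp add: stirling_quotient_def)

lemma ln_stirling_quotient:
  assumes "n \<ge> 1"
  shows "ln (stirling_quotient n) = ln (fact n) - (real n + 1/2) * ln (real n) + real n"
  using assms by (simp add: stirling_quotient_def ln_div ln_mult ln_realpow ln_sqrt algebra_simps)

lemma ln_stirling_quotient_diff:
  assumes "n \<ge> 1"
  shows "ln (stirling_quotient n) - ln (stirling_quotient (Suc n)) = (real n + 1/2) * ln (1 + 1 / real n) - 1"
proof -
  have n: "real n > 0" using assms by simp
  have "ln ((real n + 1) / real n) = ln (real n + 1) - ln (real n)"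
    using n by (simp add: ln_div)
  moreover have "(real n + 1) / real n = 1 + 1 / real n"
    using n by (simp add: field_simps)
  ultimately have L1: "ln (1 + 1 / real n) = ln (real n + 1) - ln (real n)" by simp
  have L2: "ln (fact (Suc n) :: real) = ln (real n + 1) + ln (fact n)"
    by (simp add: ln_mult add.commute)
  have "ln (stirling_quotient (Suc n)) = ln (fact (Suc n)) - (real n + 1 + 1/2) * ln (real n + 1) + (real n + 1)"
    using ln_stirling_quotient[of "Suc n"] by (simp add: add.commute)
  thus ?thesis
    unfolding ln_stirling_quotient[OF assms] L1 L2 by (simp add: algebra_simps)
qed

text \<open>These are the [1/1] and [2/1] Pade approximants of ln (1 + t) at 0. With t = 1/n,
  multiplication by n + 1/2 turns them into 1 and 1 + t^2 / (12 + 8 t), the bounds that the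
  difference of consecutive Stirling quotients calls for.\<close>

lemma ln_one_plus_bounds:
  fixes t :: real
  assumes "t > 0"
  shows "ln (1 + t) \<ge> 2 * t / (2 + t)" and "ln (1 + t) \<le> t * (6 + t) / (6 + 4 * t)"
proof -
  let ?f = "\<lambda>t::real. ln (1 + t) - 2 * t / (2 + t)"
  have "?f 0 \<le> ?f t"
  proof (rule DERIV_nonneg_imp_nondecreasing[of 0 t ?f])
    fix x :: real assume x: "0 \<le> x" "x \<le> t"
    let ?y = "x^2 / ((1 + x) * (2 + x)^2)"
    have ne: "1 + x > 0" "2 + x > 0" using x by auto
    have "1 / (1 + x) - (2 * (2 + x) - 2 * x) / ((2 + x) * (2 + x)) = x^2 / ((1 + x) * (2 + x)^2)"
      using ne by (simp add: divide_simps power2_eq_square less_imp_neq[symmetric]) (simp add: algebra_simps)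
    moreover have "(?f has_field_derivative (1 / (1 + x) - (2 * (2 + x) - 2 * x) / ((2 + x) * (2 + x)))) (at x)"
      using ne by (auto intro!: derivative_eq_intros)
    ultimately have "(?f has_field_derivative x^2 / ((1 + x) * (2 + x)^2)) (at x)" by metis
    thus "\<exists>y. (?f has_field_derivative y) (at x) \<and> y \<ge> 0" using x by (intro exI[of _ ?y] conjI) auto
  qed (use assms in auto)
  thus "ln (1 + t) \<ge> 2 * t / (2 + t)" by simp
  let ?g = "\<lambda>t::real. t * (6 + t) / (6 + 4 * t) - ln (1 + t)"
  have "?g 0 \<le> ?g t"
  proof (rule DERIV_nonneg_imp_nondecreasing[of 0 t ?g])
    fix x :: real assume x: "0 \<le> x" "x \<le> t"
    let ?y = "4 * x^3 / ((1 + x) * (6 + 4 * x)^2)"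
    have ne: "1 + x > 0" "6 + 4 * x > 0" using x by auto
    have "((6 + x + x) * (6 + 4 * x) - x * (6 + x) * 4) / ((6 + 4 * x) * (6 + 4 * x)) - 1 / (1 + x)
        = 4 * x^3 / ((1 + x) * (6 + 4 * x)^2)"
      using ne by (simp add: divide_simps power2_eq_square power3_eq_cube less_imp_neq[symmetric]) (simp add: algebra_simps)
    moreover have "(?g has_field_derivative
        ((6 + x + x) * (6 + 4 * x) - x * (6 + x) * 4) / ((6 + 4 * x) * (6 + 4 * x)) - 1 / (1 + x)) (at x)"
      using ne by (auto intro!: derivative_eq_intros)
    ultimately have "(?g has_field_derivative 4 * x^3 / ((1 + x) * (6 + 4 * x)^2)) (at x)" by metis
    thus "\<exists>y. (?g has_field_derivative y) (at x) \<and> y \<ge> 0" using x by (intro exI[of _ ?y] conjI) auto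
  qed (use assms in auto)
  thus "ln (1 + t) \<le> t * (6 + t) / (6 + 4 * t)" by simp
qed

text \<open>The second inequality bounds the decrease of the logarithm by 1 / (6 n (n + 1)), which
  telescopes, so the total decrease is finite and the limit of the quotient is positive.\<close>

lemma stirling_quotient_step:
  assumes "n \<ge> 1"
  shows "ln (stirling_quotient (Suc n)) \<le> ln (stirling_quotient n)"
    and "ln (stirling_quotient n) - 1 / (6 * real n) \<le> ln (stirling_quotient (Suc n)) - 1 / (6 * real (Suc n))"
proof -
  have n: "real n \<ge> 1" using assms by simp
  have "(real n + 1/2) * ln (1 + 1 / real n) \<ge> (real n + 1/2) * (2 * (1 / real n) / (2 + 1 / real n))"
    using n by (intro mult_left_mono ln_one_plus_bounds) auto
  also have "(real n + 1/2) * (2 * (1 / real n) / (2 + 1 / real n)) = 1"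
    using n by (simp add: field_simps)
  finally show "ln (stirling_quotient (Suc n)) \<le> ln (stirling_quotient n)"
    using ln_stirling_quotient_diff[OF assms] by simp
  define t where "t = 1 / real n"
  have t: "t > 0" "real n = 1 / t" "t \<le> 1" using n by (auto simp: t_def)
  have "(real n + 1/2) * ln (1 + t) \<le> (real n + 1/2) * (t * (6 + t) / (6 + 4 * t))"
    using n t by (intro mult_left_mono ln_one_plus_bounds) auto
  also have "\<dots> = 1 + t^2 / (12 + 8 * t)"
    unfolding t(2) using t(1) by (simp add: divide_simps power2_eq_square) (simp add: algebra_simps)
  also have "t^2 / (12 + 8 * t) \<le> t^2 / (6 * (1 + t))"
    using t by (intro divide_left_mono) auto
  also have "t^2 / (6 * (1 + t)) = 1 / (6 * real n) - 1 / (6 * real (Suc n))"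
    unfolding of_nat_Suc t(2) using t by (simp add: divide_simps power2_eq_square add_pos_pos) (simp add: algebra_simps)?
  finally show "ln (stirling_quotient n) - 1 / (6 * real n) \<le> ln (stirling_quotient (Suc n)) - 1 / (6 * real (Suc n))"
    using ln_stirling_quotient_diff[OF assms] by (simp add: t_def)
qed

text \<open>Besides the limit this records bounds uniform in n: they later dominate the Stirling
  factor for all n and k at once.\<close>

lemma stirling_quotient_tendsto:
  obtains d where "d > 0" "stirling_quotient \<longlonglongrightarrow> d" "\<And>n. n \<ge> 1 \<Longrightarrow> d \<le> stirling_quotient n"
    "\<And>n. n \<ge> 1 \<Longrightarrow> stirling_quotient n \<le> stirling_quotient 1"
proof -
  define s where "s = (\<lambda>n. ln (stirling_quotient (Suc n)))"
  have dec: "decseq s"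
    unfolding s_def by (intro decseq_SucI stirling_quotient_step) simp
  have inc: "incseq (\<lambda>n. s n - 1 / (6 * real (Suc n)))"
    unfolding s_def by (intro incseq_SucI stirling_quotient_step) simp
  have low: "s n \<ge> s 0 - 1/6" for n
  proof -
    have "s 0 - 1/6 \<le> s n - 1 / (6 * real (Suc n))"
      using incseqD[OF inc, of 0 n] by (simp del: of_nat_Suc add: of_nat_1)
    moreover have "1 / (6 * real (Suc n)) \<ge> 0" by (rule divide_nonneg_nonneg) auto
    ultimately show ?thesis by linarith
  qed
  obtain L where L: "s \<longlonglongrightarrow> L" "\<And>n. L \<le> s n"
    using decseq_convergent[OF dec, of "s 0 - 1/6"] low by blast
  have eq: "stirling_quotient (Suc n) = exp (s n)" for n
    unfolding s_def by (simp add: stirling_quotient_pos)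
  show thesis
  proof
    show "exp L > 0" by simp
    have "(\<lambda>n. stirling_quotient (Suc n)) \<longlonglongrightarrow> exp L"
      unfolding eq using L(1) by (intro tendsto_intros)
    thus "stirling_quotient \<longlonglongrightarrow> exp L" by (rule LIMSEQ_imp_Suc)
    fix n :: nat assume "n \<ge> 1"
    then obtain m where m: "n = Suc m" by (cases n) auto
    show "exp L \<le> stirling_quotient n" unfolding m eq using L(2) by simp
    show "stirling_quotient n \<le> stirling_quotient 1"
      unfolding m using decseqD[OF dec, of 0 m] eq[of 0] eq[of m] by simp
  qed
qed

section \<open>Binomial coefficients in entropy form\<close>

definition entropy :: "real \<Rightarrow> real" where
  "entropy x = - x * ln x - (1 - x) * ln (1 - x)"

lemma ell_eq_entropy: "ell p \<beta>1 \<beta>2 x = \<beta>1 * x + \<beta>2 * x ^ p + entropy x"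
  by (simp add: ell_def entropy_def)

text \<open>A single term of the expansion of (x + (1 - x))^n = 1 at x = k/n is at most 1. The bound
  is cruder than Stirling's form, but it includes k = 0 and k = n, so it serves far from the
  maximizers and for the upper bound on \<open>psi\<close>.\<close>

lemma binomial_le_exp_entropy:
  assumes "k \<le> n"
  shows "real (n choose k) \<le> exp (real n * entropy (real k / real n))"
proof (cases "k = 0 \<or> k = n")
  case True
  thus ?thesis by (cases "n = 0") (auto simp: entropy_def)
next
  case False
  define x where "x = real k / real n"
  have k: "0 < k" "k < n" using False assms by auto
  have x: "0 < x" "x < 1" using k by (auto simp: x_def)
  have nx: "real n * x = real k" "real n * (1 - x) = real (n - k)"
    using k by (auto simp: x_def field_simps of_nat_diff)
  have "real (n choose k) * x ^ k * (1 - x) ^ (n - k) \<le> (\<Sum>k\<le>n. real (n choose k) * x ^ k * (1 - x) ^ (n - k))"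
    using assms x by (intro member_le_sum[of k "{..n}" "\<lambda>k. real (n choose k) * x ^ k * (1 - x) ^ (n - k)"]) auto
  also have "\<dots> = 1" using binomial_ring[of x "1 - x" n] by simp
  finally have "real (n choose k) \<le> inverse (x ^ k * (1 - x) ^ (n - k))"
    using x by (simp add: field_simps)
  also have "\<dots> = exp (- (real k * ln x + real (n - k) * ln (1 - x)))"
    using x by (simp only: exp_minus exp_add exp_of_nat_mult exp_ln diff_gt_0_iff_gt)
  also have "- (real k * ln x + real (n - k) * ln (1 - x)) = real n * entropy x"
    unfolding nx[symmetric] entropy_def by (simp add: algebra_simps)
  finally show ?thesis by (simp add: x_def)
qed

text \<open>An identity without error term: the whole deviation from the entropy form is carried by
  the three Stirling quotients, which are bounded and converge to a common limit.\<close>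

lemma binomial_stirling:
  assumes "0 < k" "k < n"
  shows "sqrt (real n) * real (n choose k) = exp (real n * entropy (real k / real n)) *
     (stirling_quotient n / (stirling_quotient k * stirling_quotient (n - k)) / sqrt (real k / real n * (1 - real k / real n)))"
proof -
  define x where "x = real k / real n"
  have x: "0 < x" "x < 1" using assms by (auto simp: x_def)
  have nx: "real n * x = real k" "real n * (1 - x) = real (n - k)"
    using assms by (auto simp: x_def field_simps of_nat_diff)
  have pos: "stirling_quotient n > 0" "stirling_quotient k > 0" "stirling_quotient (n - k) > 0"
    using assms by (auto intro!: stirling_quotient_pos)
  have n: "real n > 0" using assms by auto
  have l: "ln (real k) = ln (real n) + ln x" "ln (real (n - k)) = ln (real n) + ln (1 - x)"
    using n x by (simp_all only: nx[symmetric]) (simp_all add: ln_mult)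
  have "ln (real (n choose k)) = ln (fact n) - ln (fact k) - ln (fact (n - k))"
    using assms by (simp add: binomial_fact ln_div ln_mult)
  also have "\<dots> = ln (stirling_quotient n) - ln (stirling_quotient k) - ln (stirling_quotient (n - k))
     + real n * entropy x - ln x / 2 - ln (1 - x) / 2 - ln (real n) / 2"
  proof -
    have "ln (fact m) = ln (stirling_quotient m) + (real m + 1/2) * ln (real m) - real m" if "m \<ge> 1" for m
      using ln_stirling_quotient[OF that] by simp
    hence "ln (fact n) - ln (fact k) - ln (fact (n - k)) =
       ln (stirling_quotient n) - ln (stirling_quotient k) - ln (stirling_quotient (n - k)) +
       (real n + 1/2) * ln (real n) - (real k + 1/2) * ln (real k) - (real (n - k) + 1/2) * ln (real (n - k))
       - real n + real k + real (n - k)"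
      using assms by simp
    also have "\<dots> = ln (stirling_quotient n) - ln (stirling_quotient k) - ln (stirling_quotient (n - k))
     + real n * entropy x - ln x / 2 - ln (1 - x) / 2 - ln (real n) / 2"
      unfolding l unfolding nx[symmetric] entropy_def by (simp add: algebra_simps)
    finally show ?thesis .
  qed
  finally have "ln (sqrt (real n) * real (n choose k)) = ln (exp (real n * entropy x) *
     (stirling_quotient n / (stirling_quotient k * stirling_quotient (n - k)) / sqrt (x * (1 - x))))"
    using pos n x assms by (simp add: ln_mult ln_div ln_sqrt add_divide_distrib)
  hence "sqrt (real n) * real (n choose k) = exp (real n * entropy x) *
     (stirling_quotient n / (stirling_quotient k * stirling_quotient (n - k)) / sqrt (x * (1 - x)))"
    using pos n x assms by (subst (asm) ln_inj_iff) auto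
  thus ?thesis by (simp add: x_def)
qed

section \<open>Sums as integrals\<close>

lemma integrable_inverse_1_plus_square_lborel: "integrable lborel (\<lambda>y::real. C / (1 + y\<^sup>2))"
  using integrable_mult_right[OF integrable_inverse_1_plus_square[unfolded set_integrable_def], of C]
  by (simp add: divide_inverse)

text \<open>The sum is the integral of a step function in the rescaled variable \<open>c n * (k - n * x0)\<close>, to which
  dominated convergence applies.\<close>

lemma sum_tendsto_integral:
  fixes G :: "nat \<Rightarrow> nat \<Rightarrow> real" and c :: "nat \<Rightarrow> real" and g :: "real \<Rightarrow> real"
  assumes x0: "0 < x0" "x0 < 1"
    and c: "\<And>n. n \<ge> 1 \<Longrightarrow> 0 < c n \<and> c n \<le> 1" "c \<longlonglongrightarrow> 0" "filterlim (\<lambda>n. c n * real n) at_top sequentially"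
    and bound: "\<And>n k. n \<ge> 1 \<Longrightarrow> k \<le> n \<Longrightarrow> \<bar>G n k\<bar> \<le> C / (1 + (c n * (real k - real n * x0))\<^sup>2)"
    and lim: "\<And>y k. (\<lambda>n. c n * (real (k n) - real n * x0)) \<longlonglongrightarrow> y \<Longrightarrow> (\<lambda>n. G n (k n)) \<longlonglongrightarrow> g y"
    and g: "g \<in> borel_measurable borel"
  shows "(\<lambda>n. c n * (\<Sum>k\<le>n. G n k)) \<longlonglongrightarrow> (\<integral>y. g y \<partial>lborel)"
proof -
  define f where "f = (\<lambda>n s. \<Sum>k\<le>n. G n k * indicator {real k..<real k + 1} s)"
  \<comment> \<open>Only for n >= 1 is \<open>c n\<close> known to be positive. The value 0 at n = 0
    keeps the domination valid for every index.\<close>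
  define F where "F = (\<lambda>n y. if n = 0 then 0 else f n (real n * x0 + y / c n))"
  have f_eq: "f n s = (if 0 \<le> s \<and> nat \<lfloor>s\<rfloor> \<le> n then G n (nat \<lfloor>s\<rfloor>) else 0)" for n s
  proof -
    have "f n s = (\<Sum>k\<le>n. if k = nat \<lfloor>s\<rfloor> \<and> 0 \<le> s then G n k else 0)"
      unfolding f_def
    proof (rule sum.cong[OF refl])
      fix k
      have "s \<in> {real k..<real k + 1} \<longleftrightarrow> k = nat \<lfloor>s\<rfloor> \<and> 0 \<le> s"
        by (auto simp: le_floor_iff) linarith+
      thus "G n k * indicator {real k..<real k + 1} s = (if k = nat \<lfloor>s\<rfloor> \<and> 0 \<le> s then G n k else 0)"
        by (simp add: indicator_def)
    qed
    thus ?thesis by (auto simp: sum.delta')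
  qed
  have int_f: "(\<integral>s. f n s \<partial>lborel) = (\<Sum>k\<le>n. G n k)" for n
    unfolding f_def by (subst Bochner_Integration.integral_sum) auto
  have int_F: "(\<integral>y. F n y \<partial>lborel) = c n * (\<Sum>k\<le>n. G n k)" if "n \<ge> 1" for n
    using c(1)[OF that] that lborel_integral_real_affine[of "1 / c n" "f n" "real n * x0"]
    by (simp add: int_f F_def field_simps)
  have "1 + (c 1 * (real 0 - real 1 * x0))\<^sup>2 > 0"
    by (intro add_pos_nonneg) auto
  hence "C \<ge> 0"
    using order_trans[OF abs_ge_zero bound[of 1 0]] by (simp add: zero_le_divide_iff)
  have "(\<lambda>n. \<integral>y. F n y \<partial>lborel) \<longlonglongrightarrow> (\<integral>y. g y \<partial>lborel)"
  proof (rule integral_dominated_convergence[where w = "\<lambda>y. (3 * C) / (1 + y\<^sup>2)"])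
    show "integrable lborel (\<lambda>y. (3 * C) / (1 + y\<^sup>2))" by (rule integrable_inverse_1_plus_square_lborel)
    show "F n \<in> borel_measurable lborel" for n unfolding F_def f_def by measurable
    show "AE y in lborel. norm (F n y) \<le> 3 * C / (1 + y\<^sup>2)" for n
    proof (rule AE_I2)
      fix y :: real
      show "norm (F n y) \<le> 3 * C / (1 + y\<^sup>2)"
      proof (cases "F n y = 0")
        case True thus ?thesis using \<open>C \<ge> 0\<close> by simp
      next
        case False
        define s where "s = real n * x0 + y / c n"
        define k where "k = nat \<lfloor>s\<rfloor>"
        have n: "n \<ge> 1" and s: "0 \<le> s" "k \<le> n" and F: "F n y = G n k"
          using False by (auto simp: F_def f_eq s_def k_def split: if_splits)
        have cn: "0 < c n" "c n \<le> 1" using c(1)[OF n] by auto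
        define Y where "Y = c n * (real k - real n * x0)"
        have "real k \<le> s" "s < real k + 1" using s(1) unfolding k_def by linarith+
        hence "\<bar>c n * (s - real k)\<bar> \<le> 1"
          using cn by (simp add: abs_mult mult_le_one)
        moreover have "c n * (s - real k) = y - Y"
          using cn by (simp add: s_def Y_def field_simps)
        ultimately have "(y - Y)\<^sup>2 \<le> 1" by (simp add: abs_square_le_1)
        moreover have "y\<^sup>2 \<le> 2 * Y\<^sup>2 + 2 * (y - Y)\<^sup>2"
          using zero_le_power2[of "y - 2 * Y"] by (simp add: power2_eq_square algebra_simps)
        \<comment> \<open>Rounding to an integer moves the rescaled variable by at most
          \<open>c n\<close> <= 1; this is the origin of the factor 3 in the dominating
          function.\<close>
        ultimately have "1 + y\<^sup>2 \<le> 3 * (1 + Y\<^sup>2)" by (smt (verit) zero_le_power2)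
        have "\<bar>G n k\<bar> \<le> C / (1 + Y\<^sup>2)" using bound[OF n s(2)] by (simp add: Y_def)
        also have "\<dots> = 3 * C / (3 * (1 + Y\<^sup>2))"
          by (rule mult_divide_mult_cancel_left[symmetric]) simp
        also have "\<dots> \<le> 3 * C / (1 + y\<^sup>2)"
          using \<open>1 + y\<^sup>2 \<le> 3 * (1 + Y\<^sup>2)\<close> \<open>C \<ge> 0\<close> by (intro divide_left_mono) (auto intro!: mult_pos_pos add_pos_nonneg)
        finally show ?thesis using F by simp
      qed
    qed
    show "AE y in lborel. (\<lambda>n. F n y) \<longlonglongrightarrow> g y"
    proof (rule AE_I2)
      fix y :: real
      define s where "s = (\<lambda>n. real n * x0 + y / c n)"
      define k where "k = (\<lambda>n. nat \<lfloor>s n\<rfloor>)"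
      \<comment> \<open>Since x0 is interior and c n * n tends to infinity, the point
        \<open>s n\<close> belonging to a fixed y eventually lies in [0, n], where the step function
        takes the value \<open>G n (k n)\<close>.\<close>
      have "filterlim (\<lambda>n. x0 * (c n * real n)) at_top sequentially"
        using x0 c(3) by (intro filterlim_tendsto_pos_mult_at_top[OF tendsto_const]) auto
      hence ev1: "eventually (\<lambda>n. x0 * (c n * real n) \<ge> -y) sequentially"
        by (auto simp: filterlim_at_top)
      have "filterlim (\<lambda>n. (1 - x0) * (c n * real n)) at_top sequentially"
        using x0 c(3) by (intro filterlim_tendsto_pos_mult_at_top[OF tendsto_const]) auto
      hence ev2: "eventually (\<lambda>n. (1 - x0) * (c n * real n) \<ge> y) sequentially"
        by (auto simp: filterlim_at_top)
      have ev: "eventually (\<lambda>n. n \<ge> 1 \<and> 0 \<le> s n \<and> s n \<le> real n) sequentially"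
        using ev1 ev2 eventually_ge_at_top[of 1]
      proof eventually_elim
        case (elim n)
        have cn: "c n > 0" using c(1) elim by auto
        have "c n * s n = x0 * (c n * real n) + y" using cn by (simp add: s_def field_simps)
        hence "c n * s n \<ge> 0" "c n * s n \<le> c n * real n" using elim by (auto simp: algebra_simps)
        thus ?case using cn elim by (simp add: zero_le_mult_iff)
      qed
      have evb: "eventually (\<lambda>n. y - c n \<le> c n * (real (k n) - real n * x0) \<and> c n * (real (k n) - real n * x0) \<le> y) sequentially"
        using ev
      proof eventually_elim
        case (elim n)
        have cn: "c n > 0" using c(1) elim by auto
        have "real (k n) \<le> s n" "s n \<le> real (k n) + 1" using elim unfolding k_def by linarith+
        hence "c n * (s n - 1) \<le> c n * real (k n)" "c n * real (k n) \<le> c n * s n"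
          using cn by (auto intro!: mult_left_mono)
        moreover have "c n * s n = x0 * (c n * real n) + y" using cn by (simp add: s_def field_simps)
        ultimately show ?case by (simp add: algebra_simps)
      qed
      have "(\<lambda>n. c n * (real (k n) - real n * x0)) \<longlonglongrightarrow> y"
      proof (rule tendsto_sandwich[of "\<lambda>n. y - c n" _ _ "\<lambda>_. y"])
        show "(\<lambda>n. y - c n) \<longlonglongrightarrow> y" using tendsto_diff[OF tendsto_const c(2), of y] by simp
      qed (use evb in \<open>auto elim: eventually_mono\<close>)
      hence "(\<lambda>n. G n (k n)) \<longlonglongrightarrow> g y" by (rule lim)
      moreover have "eventually (\<lambda>n. G n (k n) = F n y) sequentially"
        using ev
      proof eventually_elim
        case (elim n)
        have "k n \<le> n" using elim unfolding k_def by linarith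
        thus ?case using elim by (auto simp: F_def f_eq s_def k_def)
      qed
      ultimately show "(\<lambda>n. F n y) \<longlonglongrightarrow> g y" by (rule Lim_transform_eventually)
    qed
  qed (use g in auto)
  thus ?thesis
    by (rule Lim_transform_eventually) (use int_F in \<open>auto intro!: eventually_sequentiallyI[of 1]\<close>)
qed

section \<open>Moments of the density exp (- a y^(2m))\<close>

text \<open>The substitution t = a y^(2m) in Euler's integral for Gamma z; the choice of z makes the
  remaining power of y equal to j.\<close>

lemma has_bochner_integral_power_exp_power_half:
  fixes a :: real and m j :: nat
  assumes a: "a > 0" and m: "m \<ge> 1"
  defines "z \<equiv> (real j + 1) / (2 * real m)"
  shows "has_bochner_integral lborel (\<lambda>y. indicator {0..} y *\<^sub>R (y ^ j * exp (- a * y ^ (2 * m))))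
           (a powr - z * Gamma z / (2 * real m))"
proof -
  define f where "f = (\<lambda>t::real. t powr (z - 1) / exp t)"
  define h where "h = (\<lambda>y::real. a * y ^ (2 * m))"
  define h' where "h' = (\<lambda>y::real. a * (2 * real m * y ^ (2 * m - 1)))"
  have z: "z > 0" using m by (simp add: z_def)
  have "(f has_integral Gamma z) {0..}"
    unfolding f_def by (rule Gamma_integral_real[OF z])
  \<comment> \<open>The \<open>powr\<close> laws behind \<open>eq\<close> require y > 0, so the
    substitution runs over the open half-line; the endpoint is restored at the end as a null
    set.\<close>
  hence f_int: "(f has_integral Gamma z) {0<..}"
    by (subst (asm) has_integral_spike_set_eq[of _ "{0<..}"]) (auto intro: negligible_subset[of "{0}"])
  hence f_abs: "f absolutely_integrable_on {0<..}"
    by (intro nonnegative_absolutely_integrable_1) (auto simp: f_def integrable_on_def)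
  have img: "h ` {0<..} = {0<..}"
  proof (intro equalityI subsetI)
    fix t :: real assume t: "t \<in> {0<..}"
    have "root (2 * m) (t / a) > 0" using t a m by simp
    moreover have "h (root (2 * m) (t / a)) = t" using t a m by (simp add: h_def)
    ultimately show "t \<in> h ` {0<..}" by (metis greaterThan_iff image_eqI)
  qed (use a in \<open>auto simp: h_def\<close>)
  have inj: "inj_on h {0<..}"
    using a m by (intro inj_onI) (auto simp: h_def power_eq_iff_eq_base)
  have der: "(h has_field_derivative h' y) (at y within {0<..})" for y
    unfolding h_def h'_def by (auto intro!: derivative_eq_intros)
  have sub: "(\<lambda>y. \<bar>h' y\<bar> * f (h y)) absolutely_integrable_on {0<..} \<and>
        integral {0<..} (\<lambda>y. \<bar>h' y\<bar> * f (h y)) = Gamma z"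
    using has_absolute_integral_change_of_variables_1'[of "{0<..}" h h' f "Gamma z"] der inj img f_int f_abs
    by (auto simp: integral_unique)
  have eq: "\<bar>h' y\<bar> * f (h y) = 2 * real m * a powr z * (y ^ j * exp (- a * y ^ (2 * m)))" if "y \<in> {0<..}" for y
  proof -
    have y: "y > 0" using that by simp
    have pos: "y ^ (2 * m - 1) > 0" using y by simp
    have "(y ^ (2 * m)) powr (z - 1) = y powr (real (2 * m) * (z - 1))"
      using y by (simp add: powr_realpow[symmetric] powr_powr)
    also have "real (2 * m) * (z - 1) = real j - real (2 * m - 1)"
      using m by (simp add: z_def field_simps of_nat_diff)
    also have "y powr \<dots> = y ^ j / y ^ (2 * m - 1)"
      using y by (simp only: powr_diff powr_realpow)
    finally have ypow: "(y ^ (2 * m)) powr (z - 1) = y ^ j / y ^ (2 * m - 1)" .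
    have "(a * y ^ (2 * m)) powr (z - 1) = a powr (z - 1) * (y ^ (2 * m)) powr (z - 1)"
      using a y by (intro powr_mult)
    also have "a powr (z - 1) = a powr z / a"
      using a by (simp add: powr_diff)
    finally have "(a * y ^ (2 * m)) powr (z - 1) = a powr z / a * (y ^ j / y ^ (2 * m - 1))"
      by (simp only: ypow)
    hence "f (h y) = a powr z / a * (y ^ j / y ^ (2 * m - 1)) * exp (- a * y ^ (2 * m))"
      by (simp add: f_def h_def exp_minus divide_inverse)
    moreover have "\<bar>h' y\<bar> = 2 * real m * a * y ^ (2 * m - 1)"
      using a y by (simp add: h'_def)
    ultimately show ?thesis using a y pos by (simp add: field_simps)
  qed
  define w where "w = (\<lambda>y. 2 * real m * a powr z * (y ^ j * exp (- a * y ^ (2 * m))))"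
  have [measurable]: "w \<in> borel_measurable borel" unfolding w_def by measurable
  have w_abs: "w absolutely_integrable_on {0<..}"
    by (rule absolutely_integrable_spike[OF sub[THEN conjunct1] negligible_empty]) (use eq in \<open>auto simp: w_def\<close>)
  have "integral {0<..} w = integral {0<..} (\<lambda>y. \<bar>h' y\<bar> * f (h y))"
    by (rule Henstock_Kurzweil_Integration.integral_cong) (use eq in \<open>simp add: w_def\<close>)
  hence leb: "has_bochner_integral lebesgue (\<lambda>y. indicator {0<..} y *\<^sub>R w y) (Gamma z)"
    using set_lebesgue_integral_eq_integral(2)[OF w_abs] w_abs sub
    by (simp add: has_bochner_integral_iff set_integrable_def set_lebesgue_integral_def)
  \<comment> \<open>The change of variables yields an integral over \<open>lebesgue\<close>, the
    completion of \<open>lborel\<close>; as \<open>w\<close> is Borel measurable, both integrals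
    agree.\<close>
  have "integrable lborel (\<lambda>y. indicator {0<..} y *\<^sub>R w y)"
    using leb by (subst integrable_completion[symmetric]) (auto simp: has_bochner_integral_iff)
  moreover have "(\<integral>y. indicator {0<..} y *\<^sub>R w y \<partial>lborel) = Gamma z"
    using leb by (subst integral_completion[symmetric]) (auto simp: has_bochner_integral_iff)
  ultimately have "has_bochner_integral lborel (\<lambda>y. indicator {0<..} y *\<^sub>R w y) (Gamma z)"
    by (simp add: has_bochner_integral_iff)
  from has_bochner_integral_mult_left[OF this, of "a powr - z / (2 * real m)"]
  have "has_bochner_integral lborel (\<lambda>y. indicator {0<..} y *\<^sub>R (y ^ j * exp (- a * y ^ (2 * m))))
           (a powr - z * Gamma z / (2 * real m))"
    using a m by (simp add: w_def powr_minus field_simps)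
  thus ?thesis
    by (rule has_bochner_integral_discrete_difference[where X="{0}", THEN iffD1, rotated 4])
       (auto split: split_indicator)
qed

lemma has_bochner_integral_even_power_exp_power:
  fixes a :: real and m j :: nat
  assumes "a > 0" "m \<ge> 1" "even j"
  shows "has_bochner_integral lborel (\<lambda>y. y ^ j * exp (- a * y ^ (2 * m)))
           (a powr - ((real j + 1) / (2 * real m)) * Gamma ((real j + 1) / (2 * real m)) / real m)"
  using has_bochner_integral_even_function[OF has_bochner_integral_power_exp_power_half[OF assms(1,2), of j]] assms(3)
  by (simp add: power_mult)

lemma has_bochner_integral_odd_power_exp_power:
  fixes a :: real and m j :: nat
  assumes "a > 0" "m \<ge> 1" "odd j"
  shows "has_bochner_integral lborel (\<lambda>y. y ^ j * exp (- a * y ^ (2 * m))) 0"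
  using has_bochner_integral_odd_function[OF has_bochner_integral_power_exp_power_half[OF assms(1,2), of j]] assms(3)
  by (simp add: power_mult)

section \<open>The variational function\<close>

text \<open>One use of L'Hopital's rule. Iterated, it reads the leading Taylor coefficient of
  \<open>ell\<close> off that of \<open>ell2\<close>, so that no third or fourth derivative has to
  be computed.\<close>

lemma quotient_power_tendsto_of_deriv:
  fixes f f' :: "real \<Rightarrow> real"
  assumes der: "eventually (\<lambda>x. (f has_field_derivative f' x) (at x)) (at x0)"
    and cont: "isCont f x0"
    and lim: "((\<lambda>x. f' x / (x - x0) ^ k) \<longlongrightarrow> c) (at x0)"
  shows "((\<lambda>x. (f x - f x0) / (x - x0) ^ Suc k) \<longlongrightarrow> c / real (Suc k)) (at x0)"
proof (rule lhopital[where f' = f' and g' = "\<lambda>x. real (Suc k) * (x - x0) ^ k"])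
  show "((\<lambda>x. f x - f x0) \<longlongrightarrow> 0) (at x0)"
    using cont by (simp add: isCont_def LIM_zero)
  have "((\<lambda>x. (x - x0) ^ Suc k) \<longlongrightarrow> (x0 - x0) ^ Suc k) (at x0)"
    by (intro tendsto_intros)
  thus "((\<lambda>x. (x - x0) ^ Suc k) \<longlongrightarrow> 0) (at x0)" by simp
  show "eventually (\<lambda>x. (x - x0) ^ Suc k \<noteq> 0) (at x0)"
    "eventually (\<lambda>x. real (Suc k) * (x - x0) ^ k \<noteq> 0) (at x0)"
    by (rule eventually_mono[OF eventually_neq_at_within[of x0]]; simp)+
  show "eventually (\<lambda>x. ((\<lambda>x. f x - f x0) has_field_derivative f' x) (at x)) (at x0)"
    using der by eventually_elim (auto intro!: derivative_eq_intros)
  have "((\<lambda>x. (x - x0) ^ Suc k) has_field_derivative real (Suc k) * (x - x0) ^ k) (at x)" for x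
  proof -
    have "((\<lambda>x. x - x0) has_field_derivative 1) (at x)" by (auto intro!: derivative_eq_intros)
    from DERIV_power[OF this, of "Suc k"] show ?thesis by simp
  qed
  thus "eventually (\<lambda>x. ((\<lambda>x. (x - x0) ^ Suc k) has_field_derivative real (Suc k) * (x - x0) ^ k) (at x)) (at x0)"
    by (intro always_eventually allI)
  have "((\<lambda>x. f' x / (x - x0) ^ k / real (Suc k)) \<longlongrightarrow> c / real (Suc k)) (at x0)"
    by (intro tendsto_divide lim tendsto_const) simp
  thus "((\<lambda>x. f' x / (real (Suc k) * (x - x0) ^ k)) \<longlongrightarrow> c / real (Suc k)) (at x0)"
    by (simp add: mult.commute)
qed

text \<open>\<open>ell1\<close> and \<open>ell2\<close> are the first two derivatives of \<open>ell\<close> on the open unit interval. The form of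
  \<open>ell2\<close> isolates \<open>x ^ (p - 1) * (1 - x)\<close>, whose only critical point in there is \<open>(p - 1) / p\<close>.\<close>

definition ell1 :: "nat \<Rightarrow> real \<Rightarrow> real \<Rightarrow> real \<Rightarrow> real" where
  "ell1 p \<beta>1 \<beta>2 x = \<beta>1 + \<beta>2 * (real p * x ^ (p - 1)) - ln x + ln (1 - x)"

definition ell2 :: "nat \<Rightarrow> real \<Rightarrow> real \<Rightarrow> real" where
  "ell2 p \<beta>2 x = (\<beta>2 * (real p * (real p - 1)) * (x ^ (p - 1) * (1 - x)) - 1) / (x * (1 - x))"

lemma DERIV_ell:
  assumes "0 < x" "x < 1"
  shows "(ell p \<beta>1 \<beta>2 has_field_derivative ell1 p \<beta>1 \<beta>2 x) (at x)"
  unfolding ell_def[abs_def] ell1_def using assms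
  by (auto intro!: derivative_eq_intros)

lemma DERIV_ell1:
  assumes "0 < x" "x < 1" "p \<ge> 2"
  shows "(ell1 p \<beta>1 \<beta>2 has_field_derivative ell2 p \<beta>2 x) (at x)"
proof -
  obtain r where r: "p = Suc (Suc r)" using assms(3) by (metis Suc_le_D numeral_2_eq_2 Suc_le_mono)
  have pow: "((\<lambda>x. x ^ Suc r) has_field_derivative real (Suc r) * x ^ r) (at x)"
    using DERIV_pow[of "Suc r" x] by simp
  have "(ell1 p \<beta>1 \<beta>2 has_field_derivative
      (\<beta>2 * (real p * (real (Suc r) * x ^ r)) - 1 / x - 1 / (1 - x))) (at x)"
    unfolding ell1_def[abs_def] r diff_Suc_1 using assms
    by (auto intro!: derivative_eq_intros pow simp del: of_nat_Suc power_Suc)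
  also have "\<beta>2 * (real p * (real (Suc r) * x ^ r)) - 1 / x - 1 / (1 - x) = ell2 p \<beta>2 x"
    using assms by (simp add: ell2_def r divide_simps) (simp add: algebra_simps)
  finally show ?thesis .
qed

lemma ell''_eq:
  assumes "0 < x" "x < 1" "p \<ge> 2"
  shows "ell'' p \<beta>1 \<beta>2 x = ell2 p \<beta>2 x"
proof -
  have "eventually (\<lambda>y. y \<in> {0<..<1}) (nhds x)"
    using assms by (intro eventually_nhds_in_open) auto
  hence "eventually (\<lambda>y. deriv (ell p \<beta>1 \<beta>2) y = ell1 p \<beta>1 \<beta>2 y) (nhds x)"
    by eventually_elim (auto intro!: DERIV_imp_deriv DERIV_ell)
  hence "deriv (deriv (ell p \<beta>1 \<beta>2)) x = deriv (ell1 p \<beta>1 \<beta>2) x"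
    by (intro deriv_cong_ev) auto
  also have "\<dots> = ell2 p \<beta>2 x"
    using assms by (intro DERIV_imp_deriv DERIV_ell1)
  finally show ?thesis by (simp add: ell''_def numeral_2_eq_2)
qed

lemma isCont_ell2: "0 < x \<Longrightarrow> x < 1 \<Longrightarrow> isCont (ell2 p \<beta>2) x"
  unfolding ell2_def by (intro continuous_intros) auto

lemma continuous_on_xlnx: "continuous_on {0..} (\<lambda>x::real. x * ln x)"
proof (rule continuous_on_eq_continuous_within[THEN iffD2], rule ballI)
  fix x :: real assume "x \<in> {0..}"
  show "continuous (at x within {0..}) (\<lambda>x. x * ln x)"
  proof (cases "x = 0")
    case True
    have "((\<lambda>x::real. x * ln x) \<longlongrightarrow> 0) (at_right 0)" by real_asymp
    thus ?thesis using True by (simp add: continuous_within at_within_Ici_at_right)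
  next
    case False
    hence "isCont (\<lambda>x. x * ln x) x" using \<open>x \<in> {0..}\<close> by (intro continuous_intros) auto
    thus ?thesis by (rule continuous_at_imp_continuous_at_within)
  qed
qed

lemma continuous_on_ell: "continuous_on {0..1} (ell p \<beta>1 \<beta>2)"
proof -
  have 1: "continuous_on {0..1} (\<lambda>x::real. x * ln x)"
    by (rule continuous_on_subset[OF continuous_on_xlnx]) auto
  have 2: "continuous_on {0..1} (\<lambda>x::real. (1 - x) * ln (1 - x))"
    by (rule continuous_on_compose2[OF continuous_on_xlnx]) (auto intro!: continuous_intros)
  show ?thesis unfolding ell_def[abs_def] by (intro continuous_intros 1 2)
qed

section \<open>The maximum of ell and its maximizers\<close>

definition ell_max :: "nat \<Rightarrow> real \<Rightarrow> real \<Rightarrow> real" where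
  "ell_max p \<beta>1 \<beta>2 = (SUP x\<in>{0..1}. ell p \<beta>1 \<beta>2 x)"

lemma maximizers_nonempty: "maximizers p \<beta>1 \<beta>2 \<noteq> {}"
  using continuous_attains_sup[OF _ _ continuous_on_ell[of p \<beta>1 \<beta>2]] by (auto simp: maximizers_def)

lemma ell_max_eq: "x \<in> maximizers p \<beta>1 \<beta>2 \<Longrightarrow> ell p \<beta>1 \<beta>2 x = ell_max p \<beta>1 \<beta>2"
  unfolding ell_max_def maximizers_def by (intro cSup_eq_maximum[symmetric]) auto

lemma ell_le_max:
  assumes "y \<in> {0..1}"
  shows "ell p \<beta>1 \<beta>2 y \<le> ell_max p \<beta>1 \<beta>2"
proof -
  obtain x where x: "x \<in> maximizers p \<beta>1 \<beta>2" using maximizers_nonempty by blast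
  have "ell p \<beta>1 \<beta>2 y \<le> ell p \<beta>1 \<beta>2 x" using x assms by (auto simp: maximizers_def)
  thus ?thesis using ell_max_eq[OF x] by simp
qed

lemma maximizersI: "x \<in> {0..1} \<Longrightarrow> ell_max p \<beta>1 \<beta>2 \<le> ell p \<beta>1 \<beta>2 x \<Longrightarrow> x \<in> maximizers p \<beta>1 \<beta>2"
  using order_trans[OF ell_le_max] by (auto simp: maximizers_def)

text \<open>The points at distance at least \<open>\<delta>\<close> from every maximizer form a
  compact set, on which the maximum of \<open>ell\<close> is attained and falls short of the global
  one. The gap gives both the exponential decay far from the maximizers and the stability of
  maximizers under a change of parameters.\<close>

lemma ell_max_gap:
  assumes "\<delta> > 0"
  obtains \<eta> where "\<eta> > 0"
    "\<And>y. y \<in> {0..1} \<Longrightarrow> (\<And>x. x \<in> maximizers p \<beta>1 \<beta>2 \<Longrightarrow> \<bar>y - x\<bar> \<ge> \<delta>) \<Longrightarrow> ell p \<beta>1 \<beta>2 y \<le> ell_max p \<beta>1 \<beta>2 - \<eta>"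
proof (cases "{y \<in> {0..1}. \<forall>x\<in>maximizers p \<beta>1 \<beta>2. \<bar>y - x\<bar> \<ge> \<delta>} = {}")
  case True
  thus ?thesis using that[of 1] by force
next
  case False
  let ?K = "{y \<in> {0..1}. \<forall>x\<in>maximizers p \<beta>1 \<beta>2. \<bar>y - x\<bar> \<ge> \<delta>}"
  have "?K = {0..1} \<inter> (\<Inter>x\<in>maximizers p \<beta>1 \<beta>2. {y. \<bar>y - x\<bar> \<ge> \<delta>})" by auto
  moreover have "closed (\<Inter>x\<in>maximizers p \<beta>1 \<beta>2. {y. \<bar>y - x\<bar> \<ge> \<delta>})"
    by (intro closed_INT ballI closed_Collect_le continuous_intros)
  ultimately have "compact ?K" by (metis compact_Icc compact_Int_closed)
  moreover have "continuous_on ?K (ell p \<beta>1 \<beta>2)"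
    by (rule continuous_on_subset[OF continuous_on_ell]) auto
  ultimately obtain z where z: "z \<in> ?K" "\<And>y. y \<in> ?K \<Longrightarrow> ell p \<beta>1 \<beta>2 y \<le> ell p \<beta>1 \<beta>2 z"
    using continuous_attains_sup[of ?K "ell p \<beta>1 \<beta>2"] False by blast
  have "z \<notin> maximizers p \<beta>1 \<beta>2" using z(1) assms by force
  hence "ell p \<beta>1 \<beta>2 z < ell_max p \<beta>1 \<beta>2"
    using z(1) maximizersI[of z p \<beta>1 \<beta>2] by (auto simp: not_less[symmetric])
  thus ?thesis using that[of "ell_max p \<beta>1 \<beta>2 - ell p \<beta>1 \<beta>2 z"] z(2) by auto
qed

lemma maximizer_deriv_zero:
  assumes "x \<in> maximizers p \<beta>1 \<beta>2" "0 < x" "x < 1"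
  shows "ell1 p \<beta>1 \<beta>2 x = 0"
proof (rule DERIV_local_max[OF DERIV_ell[OF assms(2,3)], of "min x (1 - x)"])
  show "\<forall>y. \<bar>x - y\<bar> < min x (1 - x) \<longrightarrow> ell p \<beta>1 \<beta>2 y \<le> ell p \<beta>1 \<beta>2 x"
    using assms by (auto simp: maximizers_def abs_if split: if_splits)
qed (use assms in auto)

text \<open>Two rounds of L'Hopital from \<open>ell2\<close> through \<open>ell1\<close> to
  \<open>ell\<close>. The cases k = 0, 1, 2 give the quadratic coefficient, the cubic one at a
  degenerate maximizer, and the quartic one at the critical point.\<close>

lemma ell_quotient_tendsto:
  assumes x: "0 < x" "x < 1" and p: "p \<ge> 2" and crit: "ell1 p \<beta>1 \<beta>2 x = 0"
    and lim: "((\<lambda>y. ell2 p \<beta>2 y / (y - x) ^ k) \<longlongrightarrow> c) (at x)"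
  shows "((\<lambda>y. (ell p \<beta>1 \<beta>2 y - ell p \<beta>1 \<beta>2 x) / (y - x) ^ (k + 2)) \<longlongrightarrow> c / ((real k + 1) * (real k + 2))) (at x)"
proof -
  have ev: "eventually (\<lambda>y. y \<in> {0<..<1}) (at x)"
    using x by (intro eventually_at_in_open') auto
  have "((\<lambda>y. (ell1 p \<beta>1 \<beta>2 y - ell1 p \<beta>1 \<beta>2 x) / (y - x) ^ Suc k) \<longlongrightarrow> c / real (Suc k)) (at x)"
  proof (rule quotient_power_tendsto_of_deriv[OF _ _ lim])
    show "eventually (\<lambda>y. (ell1 p \<beta>1 \<beta>2 has_field_derivative ell2 p \<beta>2 y) (at y)) (at x)"
      using ev by eventually_elim (use p in \<open>auto intro!: DERIV_ell1\<close>)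
    show "isCont (ell1 p \<beta>1 \<beta>2) x" using DERIV_ell1[OF x p] by (rule DERIV_isCont)
  qed
  hence "((\<lambda>y. (ell p \<beta>1 \<beta>2 y - ell p \<beta>1 \<beta>2 x) / (y - x) ^ Suc (Suc k)) \<longlongrightarrow> c / real (Suc k) / real (Suc (Suc k))) (at x)"
    unfolding crit diff_0_right
  proof (rule quotient_power_tendsto_of_deriv[rotated 2])
    show "eventually (\<lambda>y. (ell p \<beta>1 \<beta>2 has_field_derivative ell1 p \<beta>1 \<beta>2 y) (at y)) (at x)"
      using ev by eventually_elim (auto intro!: DERIV_ell)
    show "isCont (ell p \<beta>1 \<beta>2) x" using DERIV_ell[OF x] by (rule DERIV_isCont)
  qed
  thus ?thesis by (simp add: add.commute)
qed

section \<open>Laplace's method\<close>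

text \<open>By Stirling's formula this number is sqrt (2 * pi).\<close>

definition stirling_const :: real where
  "stirling_const = lim stirling_quotient"

lemma
  shows stirling_const_tendsto: "stirling_quotient \<longlonglongrightarrow> stirling_const"
    and stirling_const_pos: "stirling_const > 0"
    and stirling_const_le: "n \<ge> 1 \<Longrightarrow> stirling_const \<le> stirling_quotient n"
    and stirling_quotient_le: "n \<ge> 1 \<Longrightarrow> stirling_quotient n \<le> stirling_quotient 1"
  using stirling_quotient_tendsto unfolding stirling_const_def by (metis limI)+

text \<open>The Gibbs weight divided by exp (n * max ell); the factor sqrt n offsets the 1 / sqrt n
  of a central binomial coefficient, so near an interior maximizer the weights have order 1.\<close>

definition laplace_weight :: "nat \<Rightarrow> real \<Rightarrow> real \<Rightarrow> nat \<Rightarrow> nat \<Rightarrow> real" where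
  "laplace_weight p \<beta>1 \<beta>2 n k = sqrt (real n) * real (n choose k)
     * exp (real n * (\<beta>1 * (real k / real n) + \<beta>2 * (real k / real n) ^ p - ell_max p \<beta>1 \<beta>2))"

lemma laplace_weight_nonneg: "laplace_weight p \<beta>1 \<beta>2 n k \<ge> 0"
  by (simp add: laplace_weight_def)

lemma laplace_weight_le:
  assumes "k \<le> n"
  shows "laplace_weight p \<beta>1 \<beta>2 n k \<le> sqrt (real n) * exp (real n * (ell p \<beta>1 \<beta>2 (real k / real n) - ell_max p \<beta>1 \<beta>2))"
proof -
  have "laplace_weight p \<beta>1 \<beta>2 n k \<le> sqrt (real n) * exp (real n * entropy (real k / real n))
     * exp (real n * (\<beta>1 * (real k / real n) + \<beta>2 * (real k / real n) ^ p - ell_max p \<beta>1 \<beta>2))"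
    unfolding laplace_weight_def using binomial_le_exp_entropy[OF assms]
    by (intro mult_right_mono mult_left_mono) auto
  also have "\<dots> = sqrt (real n) * exp (real n * (ell p \<beta>1 \<beta>2 (real k / real n) - ell_max p \<beta>1 \<beta>2))"
    by (simp add: exp_add[symmetric] ell_eq_entropy algebra_simps)
  finally show ?thesis .
qed

lemma laplace_weight_stirling:
  assumes "0 < k" "k < n"
  shows "laplace_weight p \<beta>1 \<beta>2 n k = exp (real n * (ell p \<beta>1 \<beta>2 (real k / real n) - ell_max p \<beta>1 \<beta>2)) *
     (stirling_quotient n / (stirling_quotient k * stirling_quotient (n - k)) / sqrt (real k / real n * (1 - real k / real n)))"
  unfolding laplace_weight_def binomial_stirling[OF assms]
  by (simp add: exp_add[symmetric] ell_eq_entropy algebra_simps)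

text \<open>Brings the integrand into the dominated form asked for by
  \<open>sum_tendsto_integral\<close>. With t = 1 + y^2 one has |y|^j <= t^j and y^(2m) >= t - 2,
  while exp (b t) >= (b t)^N / N! with N = j + 1 leaves exactly one factor 1/t.\<close>

lemma power_exp_bound:
  fixes b :: real
  assumes b: "b > 0" and m: "m \<ge> 1"
  obtains K where "K \<ge> 0" "\<And>y. \<bar>y\<bar> ^ j * exp (- b * y ^ (2 * m)) \<le> K / (1 + y\<^sup>2)"
proof -
  define N where "N = Suc j"
  define K where "K = fact N * exp (2 * b) / b ^ N"
  have "\<bar>y\<bar> ^ j * exp (- b * y ^ (2 * m)) \<le> K / (1 + y\<^sup>2)" for y :: real
  proof -
    define t where "t = 1 + y\<^sup>2"
    have t: "t \<ge> 1" by (simp add: t_def)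
    have "\<bar>y\<bar> \<le> t"
    proof (cases "\<bar>y\<bar> \<le> 1")
      case False
      hence "\<bar>y\<bar> * 1 \<le> \<bar>y\<bar> * \<bar>y\<bar>" by (intro mult_left_mono) auto
      thus ?thesis by (simp add: t_def power2_eq_square)
    qed (use t in simp)
    hence 1: "\<bar>y\<bar> ^ j \<le> t ^ j" by (intro power_mono) auto
    have "t - 2 \<le> y ^ (2 * m)"
    proof (cases "\<bar>y\<bar> \<le> 1")
      case True
      hence "y\<^sup>2 \<le> 1" by (simp add: abs_square_le_1)
      thus ?thesis using zero_le_power2[of "y ^ m"] by (simp add: t_def power_mult[symmetric] mult.commute)
    next
      case False
      hence "\<bar>y\<bar> ^ 2 \<le> \<bar>y\<bar> ^ (2 * m)" using m by (intro power_increasing) auto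
      thus ?thesis by (simp add: t_def power_even_abs)
    qed
    hence "exp (- b * y ^ (2 * m)) \<le> exp (- b * (t - 2))" using b by simp
    also have "\<dots> = exp (2 * b) / exp (b * t)" by (simp add: exp_diff[symmetric] algebra_simps)
    also have "\<dots> \<le> exp (2 * b) / ((b * t) ^ N / fact N)"
    proof (rule divide_left_mono)
      show "(b * t) ^ N / fact N \<le> exp (b * t)"
        using sum_le_suminf[OF summable_exp[of "b * t"], of "{N}"] b t
        by (simp add: exp_def scaleR_conv_of_real divide_inverse_commute)
    qed (use b t in auto)
    also have "\<dots> = K / t ^ N" using b t by (simp add: K_def power_mult_distrib)
    finally have 2: "exp (- b * y ^ (2 * m)) \<le> K / t ^ N" .
    have "\<bar>y\<bar> ^ j * exp (- b * y ^ (2 * m)) \<le> t ^ j * (K / t ^ N)"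
      using t by (intro mult_mono 1 2) auto
    also have "\<dots> = K / t" using t by (simp add: N_def)
    finally show ?thesis by (simp add: t_def)
  qed
  moreover have "K \<ge> 0" using b by (simp add: K_def)
  ultimately show ?thesis using that by blast
qed

text \<open>The curvature of \<open>ell\<close> at the maximizer has order \<open>2 m\<close>, so the Gibbs measure lives on the scale
  \<open>n powr (-1 / (2 m))\<close>: \<open>m = 1\<close> off the critical point and \<open>m = 2\<close> at it.\<close>

lemma local_laplace:
  assumes x0: "0 < x0" "x0 < 1" "x0 \<in> maximizers p \<beta>1 \<beta>2" and m: "m \<ge> 1" and a: "a > 0"
    and lim: "((\<lambda>x. (ell p \<beta>1 \<beta>2 x - ell p \<beta>1 \<beta>2 x0) / (x - x0) ^ (2 * m)) \<longlongrightarrow> - a) (at x0)"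
  defines "s \<equiv> \<lambda>n. real n powr (1 / (2 * real m))"
  obtains \<delta>0 where "\<delta>0 > 0"
    "\<And>\<delta> j u. \<lbrakk>0 < \<delta>; \<delta> \<le> \<delta>0; continuous_on UNIV u\<rbrakk> \<Longrightarrow>
       (\<lambda>n. s n / real n * (\<Sum>k\<le>n. if \<bar>real k / real n - x0\<bar> < \<delta>
          then laplace_weight p \<beta>1 \<beta>2 n k * (s n * (real k / real n - x0)) ^ j * u (real k / real n) else 0))
       \<longlonglongrightarrow> u x0 / (stirling_const * sqrt (x0 * (1 - x0))) * (\<integral>y. y ^ j * exp (- a * y ^ (2 * m)) \<partial>lborel)"
proof -
  let ?M = "ell_max p \<beta>1 \<beta>2"
  \<comment> \<open>\<open>r\<close> fills the removable singularity of the quotient with its limit.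
    The exponent is then exactly \<open>r x\<close> times the (2m)-th power of the rescaled
    deviation, with no remainder to estimate.\<close>
  define r where "r = (\<lambda>x. if x = x0 then - a else (ell p \<beta>1 \<beta>2 x - ?M) / (x - x0) ^ (2 * m))"
  have r: "isCont r x0"
    unfolding isCont_def
  proof (rule Lim_transform_eventually)
    show "((\<lambda>x. (ell p \<beta>1 \<beta>2 x - ell p \<beta>1 \<beta>2 x0) / (x - x0) ^ (2 * m)) \<longlongrightarrow> r x0) (at x0)"
      using lim by (simp add: r_def)
    show "eventually (\<lambda>x. (ell p \<beta>1 \<beta>2 x - ell p \<beta>1 \<beta>2 x0) / (x - x0) ^ (2 * m) = r x) (at x0)"
      by (rule eventually_mono[OF eventually_neq_at_within[of x0]]) (simp add: r_def ell_max_eq[OF x0(3)])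
  qed
  have r_eq: "ell p \<beta>1 \<beta>2 x - ?M = r x * (x - x0) ^ (2 * m)" for x
    using m ell_max_eq[OF x0(3)] by (auto simp: r_def)
  have "eventually (\<lambda>x. r x < - a / 2) (nhds x0)"
  proof (rule order_tendstoD(2))
    show "(r \<longlongrightarrow> r x0) (nhds x0)" using r by (simp only: isCont_def tendsto_at_iff_tendsto_nhds)
  qed (use a in \<open>simp add: r_def\<close>)
  then obtain \<delta>1 where \<delta>1: "\<delta>1 > 0" "\<And>x. \<bar>x - x0\<bar> < \<delta>1 \<Longrightarrow> r x < - a / 2"
    unfolding eventually_nhds_metric dist_real_def by blast
  \<comment> \<open>Inside this radius the curvature is at least half of \<open>a\<close>, and k/n
    stays away from 0 and 1, so that Stirling's form applies to k and to n - k.\<close>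
  define \<delta>0 where "\<delta>0 = min \<delta>1 (min (x0 / 2) ((1 - x0) / 2))"
  have \<delta>0: "\<delta>0 > 0" using \<delta>1(1) x0 by (simp add: \<delta>0_def)
  have s_power: "s n ^ (2 * m) = real n" if "n \<ge> 1" for n
    using that m by (simp add: s_def powr_power)
  have s_pos: "s n > 0" if "n \<ge> 1" for n using that by (simp add: s_def)
  have s_cancel: "inverse (s n) * (s n * z) = z" if "n \<ge> 1" for n z using s_pos[OF that] by simp
  have exponent: "real n * (ell p \<beta>1 \<beta>2 x - ?M) = r x * (s n * (x - x0)) ^ (2 * m)" if "n \<ge> 1" for n x
    by (simp add: r_eq power_mult_distrib s_power[OF that])
  show thesis
  proof (rule that[OF \<delta>0])
    fix \<delta> j and u :: "real \<Rightarrow> real"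
    assume \<delta>: "0 < \<delta>" "\<delta> \<le> \<delta>0" and u: "continuous_on UNIV u"
    define G where "G = (\<lambda>n k. if \<bar>real k / real n - x0\<bar> < \<delta>
          then laplace_weight p \<beta>1 \<beta>2 n k * (s n * (real k / real n - x0)) ^ j * u (real k / real n) else 0)"
    define g where "g = (\<lambda>y. u x0 / (stirling_const * sqrt (x0 * (1 - x0))) * (y ^ j * exp (- a * y ^ (2 * m))))"
    have "bounded (u ` {0..1})"
      using u by (intro compact_imp_bounded compact_continuous_image) (auto intro: continuous_on_subset)
    then obtain B where "B > 0" and B: "\<forall>y\<in>u ` {0..1}. norm y \<le> B"
      using bounded_pos by blast
    \<comment> \<open>A lower bound for x (1 - x) on the window; together with the uniform bounds on
      \<open>stirling_quotient\<close> it makes \<open>A\<close> an upper bound for the Stirling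
      factor.\<close>
    define w where "w = x0 / 2 * ((1 - x0) / 2)"
    have w: "w > 0" using x0 by (simp add: w_def)
    define A where "A = stirling_quotient 1 / (stirling_const * stirling_const) / sqrt w"
    have A: "A \<ge> 0" using stirling_quotient_pos[of 1] stirling_const_pos w by (simp add: A_def)
    obtain K where K: "K \<ge> 0" "\<And>y. \<bar>y\<bar> ^ j * exp (- (a / 2) * y ^ (2 * m)) \<le> K / (1 + y\<^sup>2)"
      using power_exp_bound[of "a / 2" m j] a m by auto
    \<comment> \<open>With c n = s n / n the variable of \<open>sum_tendsto_integral\<close> becomes
      the deviation of k/n from x0 on the scale \<open>s n\<close>.\<close>
    have Yeq: "s n / real n * (real k - real n * x0) = s n * (real k / real n - x0)" if "n \<ge> 1" for n k
      using that by (simp add: field_simps)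
    have near: "x0 / 2 \<le> x \<and> x \<le> (1 + x0) / 2 \<and> 0 < x \<and> x < 1" if "\<bar>x - x0\<bar> < x0 / 2" "\<bar>x - x0\<bar> < (1 - x0) / 2" for x
      using that x0(1,2) by (auto simp: abs_if field_simps split: if_splits)
    have window: "0 < k \<and> k < n \<and> real k / real n \<in> {x0/2..(1 + x0)/2} \<and> r (real k / real n) < - a / 2"
      if "n \<ge> 1" "\<bar>real k / real n - x0\<bar> < \<delta>" for n k
    proof -
      have "\<bar>real k / real n - x0\<bar> < \<delta>1" "\<bar>real k / real n - x0\<bar> < x0 / 2" "\<bar>real k / real n - x0\<bar> < (1 - x0) / 2"
        using that \<delta> by (auto simp: \<delta>0_def)
      moreover from this have "real k / real n \<ge> x0 / 2" "real k / real n \<le> (1 + x0) / 2" "0 < real k / real n" "real k / real n < 1"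
        using near by blast+
      ultimately show ?thesis using that \<delta>1(2) by (auto simp: zero_less_divide_iff)
    qed
    have "(\<lambda>n. s n / real n * (\<Sum>k\<le>n. G n k)) \<longlonglongrightarrow> (\<integral>y. g y \<partial>lborel)"
    proof (rule sum_tendsto_integral[OF x0(1,2)])
      show "0 < s n / real n \<and> s n / real n \<le> 1" if "n \<ge> 1" for n
      proof -
        have "s n \<le> real n powr 1" unfolding s_def using that m by (intro powr_mono) auto
        thus ?thesis using s_pos[OF that] that by simp
      qed
      have e: "1 / (2 * real m) < 1" using m by simp
      have "(\<lambda>n. real n powr (1 / (2 * real m) - 1)) \<longlonglongrightarrow> 0"
        using e by (intro tendsto_neg_powr filterlim_real_sequentially) auto
      thus "(\<lambda>n. s n / real n) \<longlonglongrightarrow> 0"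
        by (rule Lim_transform_eventually)
           (auto intro!: eventually_sequentiallyI[of 1] simp: s_def powr_diff)
      have "filterlim s at_top sequentially"
        unfolding s_def using m by (intro filterlim_compose[OF real_powr_at_top filterlim_real_sequentially]) auto
      thus "filterlim (\<lambda>n. s n / real n * real n) at_top sequentially"
        by (rule filterlim_mono_eventually[OF _ order_refl order_refl])
           (rule eventually_mono[OF eventually_ge_at_top[of 1]], simp)
      show "g \<in> borel_measurable borel" unfolding g_def by measurable
      show "\<bar>G n k\<bar> \<le> (A * K * B) / (1 + (s n / real n * (real k - real n * x0))\<^sup>2)" if n: "n \<ge> 1" "k \<le> n" for n k
      proof (cases "\<bar>real k / real n - x0\<bar> < \<delta>")
        case False
        thus ?thesis using A K(1) \<open>B > 0\<close> by (auto simp: G_def intro!: divide_nonneg_nonneg mult_nonneg_nonneg)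
      next
        case True
        define x where "x = real k / real n"
        define Y where "Y = s n * (x - x0)"
        note W = window[OF n(1) True]
        have k: "0 < k" "k < n" and x: "x \<ge> x0 / 2" "x \<le> (1 + x0) / 2" "r x < - a / 2" using W by (auto simp: x_def)
        have "stirling_quotient n / (stirling_quotient k * stirling_quotient (n - k)) / sqrt (x * (1 - x)) \<le> A"
          unfolding A_def
        proof (intro frac_le)
          show "stirling_quotient n \<le> stirling_quotient 1" using n by (intro stirling_quotient_le) auto
          show "stirling_const * stirling_const \<le> stirling_quotient k * stirling_quotient (n - k)"
            using k stirling_const_pos by (intro mult_mono stirling_const_le less_imp_le[OF stirling_quotient_pos]) auto
          show "sqrt w \<le> sqrt (x * (1 - x))"
            unfolding w_def using x x0 by (intro real_sqrt_le_mono mult_mono) auto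
        qed (use stirling_const_pos stirling_quotient_pos n k w in \<open>auto intro: divide_nonneg_nonneg less_imp_le\<close>)
        moreover have "exp (real n * (ell p \<beta>1 \<beta>2 x - ?M)) \<le> exp (- (a / 2) * Y ^ (2 * m))"
        proof -
          have "Y ^ (2 * m) \<ge> 0" by (simp add: power_mult)
          hence "r x * Y ^ (2 * m) \<le> - (a / 2) * Y ^ (2 * m)" using x(3) by (intro mult_right_mono) auto
          thus ?thesis unfolding exponent[OF n(1)] Y_def by simp
        qed
        ultimately have wt: "laplace_weight p \<beta>1 \<beta>2 n k \<le> exp (- (a / 2) * Y ^ (2 * m)) * A"
          unfolding laplace_weight_stirling[OF k] x_def[symmetric]
          using stirling_quotient_pos n k x x0
          by (intro mult_mono) (auto intro!: divide_nonneg_nonneg mult_nonneg_nonneg less_imp_le)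
        have "x \<in> {0..1}" using x x0 by auto
        hence ux: "\<bar>u x\<bar> \<le> B" using B by auto
        have "\<bar>G n k\<bar> = laplace_weight p \<beta>1 \<beta>2 n k * \<bar>Y\<bar> ^ j * \<bar>u x\<bar>"
          using True laplace_weight_nonneg[of p \<beta>1 \<beta>2 n k] by (simp add: G_def x_def Y_def abs_mult power_abs)
        also have "\<dots> \<le> (exp (- (a / 2) * Y ^ (2 * m)) * A) * \<bar>Y\<bar> ^ j * B"
          using wt ux A by (intro mult_mono) (auto intro!: mult_nonneg_nonneg)
        also have "\<dots> = A * (\<bar>Y\<bar> ^ j * exp (- (a / 2) * Y ^ (2 * m))) * B" by simp
        also have "\<dots> \<le> A * (K / (1 + Y\<^sup>2)) * B"
          using A K(2)[of Y] \<open>B > 0\<close> by (intro mult_right_mono mult_left_mono) auto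
        finally show ?thesis unfolding Yeq[OF n(1)] by (simp add: Y_def x_def)
      qed
      \<comment> \<open>A convergent rescaled deviation forces k/n to x0. As x0 is interior, k and n
        - k then tend to infinity, and all three Stirling quotients converge.\<close>
      fix y and k :: "nat \<Rightarrow> nat"
      assume "(\<lambda>n. s n / real n * (real (k n) - real n * x0)) \<longlonglongrightarrow> y"
      hence Y: "(\<lambda>n. s n * (real (k n) / real n - x0)) \<longlonglongrightarrow> y"
        by (rule Lim_transform_eventually) (use Yeq in \<open>auto intro!: eventually_sequentiallyI[of 1]\<close>)
      have inv: "(\<lambda>n. inverse (s n)) \<longlonglongrightarrow> 0"
        using \<open>filterlim s at_top sequentially\<close> by (rule tendsto_inverse_0_at_top)
      have "(\<lambda>n. inverse (s n) * (s n * (real (k n) / real n - x0))) \<longlonglongrightarrow> 0 * y"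
        by (intro tendsto_mult inv Y)
      hence "(\<lambda>n. real (k n) / real n - x0) \<longlonglongrightarrow> 0"
        unfolding mult_zero_left
        by (rule Lim_transform_eventually)
           (rule eventually_mono[OF eventually_ge_at_top[of 1]], use s_cancel in blast)
      hence X: "(\<lambda>n. real (k n) / real n) \<longlonglongrightarrow> x0" by (rule LIM_zero_cancel)
      have ev: "eventually (\<lambda>n. n \<ge> 1 \<and> \<bar>real (k n) / real n - x0\<bar> < \<delta>) sequentially"
        using tendstoD[OF X \<delta>(1)] eventually_ge_at_top[of 1] by eventually_elim (auto simp: dist_real_def)
      have top: "filterlim (\<lambda>n. real (k n) / real n * real n) at_top sequentially"
        using X x0(1) by (rule filterlim_tendsto_pos_mult_at_top[OF _ _ filterlim_real_sequentially])
      hence "filterlim (\<lambda>n. real (k n)) at_top sequentially"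
        by (rule filterlim_mono_eventually[OF _ order_refl order_refl])
           (rule eventually_mono[OF eventually_ge_at_top[of 1]], simp)
      hence ktop: "filterlim k at_top sequentially" by (simp add: filterlim_sequentially_iff_filterlim_real)
      have X1: "(\<lambda>n. 1 - real (k n) / real n) \<longlonglongrightarrow> 1 - x0" by (intro tendsto_intros X)
      have "filterlim (\<lambda>n. (1 - real (k n) / real n) * real n) at_top sequentially"
        using x0(2) by (intro filterlim_tendsto_pos_mult_at_top[OF X1 _ filterlim_real_sequentially]) auto
      moreover have "eventually (\<lambda>n. (1 - real (k n) / real n) * real n = real (n - k n)) sequentially"
        using ev
      proof eventually_elim
        case (elim n)
        thus ?case using window[of n "k n"] by (auto simp: field_simps of_nat_diff)
      qed
      ultimately have "filterlim (\<lambda>n. real (n - k n)) at_top sequentially"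
        by (rule filterlim_mono_eventually[OF _ order_refl order_refl])
      hence nktop: "filterlim (\<lambda>n. n - k n) at_top sequentially" by (simp add: filterlim_sequentially_iff_filterlim_real)
      have "(\<lambda>n. r (real (k n) / real n)) \<longlonglongrightarrow> r x0" by (rule isCont_tendsto_compose[OF r X])
      hence r_lim: "(\<lambda>n. r (real (k n) / real n)) \<longlonglongrightarrow> - a" by (simp add: r_def)
      have u_lim: "(\<lambda>n. u (real (k n) / real n)) \<longlonglongrightarrow> u x0"
        using u by (intro isCont_tendsto_compose[OF _ X]) (simp add: continuous_on_eq_continuous_at)
      have "(\<lambda>n. exp (r (real (k n) / real n) * (s n * (real (k n) / real n - x0)) ^ (2 * m)) *
           (stirling_quotient n / (stirling_quotient (k n) * stirling_quotient (n - k n)) /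
              sqrt (real (k n) / real n * (1 - real (k n) / real n))) *
             (s n * (real (k n) / real n - x0)) ^ j * u (real (k n) / real n))
        \<longlonglongrightarrow> exp (- a * y ^ (2 * m)) * (stirling_const / (stirling_const * stirling_const) / sqrt (x0 * (1 - x0))) * y ^ j * u x0"
        using stirling_const_pos x0
        by (intro tendsto_intros r_lim u_lim Y X X1 stirling_const_tendsto
              filterlim_compose[OF stirling_const_tendsto ktop] filterlim_compose[OF stirling_const_tendsto nktop]) auto
      also have "exp (- a * y ^ (2 * m)) * (stirling_const / (stirling_const * stirling_const) / sqrt (x0 * (1 - x0))) * y ^ j * u x0 = g y"
        using stirling_const_pos by (simp add: g_def)
      finally show "(\<lambda>n. G n (k n)) \<longlonglongrightarrow> g y"
      proof (rule Lim_transform_eventually)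
        show "eventually (\<lambda>n. exp (r (real (k n) / real n) * (s n * (real (k n) / real n - x0)) ^ (2 * m)) *
           (stirling_quotient n / (stirling_quotient (k n) * stirling_quotient (n - k n)) /
              sqrt (real (k n) / real n * (1 - real (k n) / real n))) *
             (s n * (real (k n) / real n - x0)) ^ j * u (real (k n) / real n) = G n (k n)) sequentially"
          using ev
        proof eventually_elim
          case (elim n)
          hence "0 < k n" "k n < n" using window[of n "k n"] by auto
          from laplace_weight_stirling[OF this, of p \<beta>1 \<beta>2] show ?case
            using elim by (simp add: G_def exponent)
        qed
      qed
    qed
    thus "(\<lambda>n. s n / real n * (\<Sum>k\<le>n. if \<bar>real k / real n - x0\<bar> < \<delta>
          then laplace_weight p \<beta>1 \<beta>2 n k * (s n * (real k / real n - x0)) ^ j * u (real k / real n) else 0))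
       \<longlonglongrightarrow> u x0 / (stirling_const * sqrt (x0 * (1 - x0))) * (\<integral>y. y ^ j * exp (- a * y ^ (2 * m)) \<partial>lborel)"
      by (simp add: G_def g_def)
  qed
qed

lemma power_times_exp_tendsto_0:
  fixes \<eta> :: real
  assumes "\<eta> > 0"
  shows "(\<lambda>n. real n ^ N * exp (- (\<eta> * real n))) \<longlonglongrightarrow> 0"
proof -
  have "filterlim (\<lambda>n. \<eta> * real n) at_top sequentially"
    using assms by (intro filterlim_tendsto_pos_mult_at_top[OF tendsto_const _ filterlim_real_sequentially])
  hence "(\<lambda>n. (\<eta> * real n) ^ N / exp (\<eta> * real n)) \<longlonglongrightarrow> 0"
    by (rule filterlim_compose[OF tendsto_power_div_exp_0])
  hence "(\<lambda>n. inverse (\<eta> ^ N) * ((\<eta> * real n) ^ N / exp (\<eta> * real n))) \<longlonglongrightarrow> inverse (\<eta> ^ N) * 0"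
    by (intro tendsto_mult tendsto_const)
  thus ?thesis using assms by (simp add: power_mult_distrib exp_minus field_simps)
qed

text \<open>By the gap each weight is at most n exp (- n \<open>\<eta>\<close>), which beats the
  number of terms and the polynomial growth of the rescaled deviation.\<close>

lemma laplace_outside:
  assumes x0: "x0 \<in> {0..1}" and m: "m \<ge> 1" and \<delta>: "\<delta> > 0" and u: "continuous_on UNIV u"
  defines "s \<equiv> \<lambda>n. real n powr (1 / (2 * real m))"
  shows "(\<lambda>n. s n / real n * (\<Sum>k\<le>n. if \<exists>x\<in>maximizers p \<beta>1 \<beta>2. \<bar>real k / real n - x\<bar> < \<delta> then 0
          else laplace_weight p \<beta>1 \<beta>2 n k * (s n * (real k / real n - x0)) ^ j * u (real k / real n))) \<longlonglongrightarrow> 0"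
proof -
  obtain \<eta> where \<eta>: "\<eta> > 0"
    "\<And>y. y \<in> {0..1} \<Longrightarrow> (\<And>x. x \<in> maximizers p \<beta>1 \<beta>2 \<Longrightarrow> \<bar>y - x\<bar> \<ge> \<delta>) \<Longrightarrow> ell p \<beta>1 \<beta>2 y \<le> ell_max p \<beta>1 \<beta>2 - \<eta>"
    using ell_max_gap[OF \<delta>, of p \<beta>1 \<beta>2] by blast
  have "bounded (u ` {0..1})"
    using u by (intro compact_imp_bounded compact_continuous_image) (auto intro: continuous_on_subset)
  then obtain B where "B > 0" and B: "\<forall>y\<in>u ` {0..1}. norm y \<le> B"
    using bounded_pos by blast
  define T where "T = (\<lambda>n k. if \<exists>x\<in>maximizers p \<beta>1 \<beta>2. \<bar>real k / real n - x\<bar> < \<delta> then 0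
          else laplace_weight p \<beta>1 \<beta>2 n k * (s n * (real k / real n - x0)) ^ j * u (real k / real n))"
  have s: "0 < s n" "s n \<le> real n" if "n \<ge> 1" for n
  proof -
    have "s n \<le> real n powr 1" unfolding s_def using that m by (intro powr_mono) auto
    thus "s n \<le> real n" using that by simp
  qed (use that in \<open>simp add: s_def\<close>)
  have T: "\<bar>T n k\<bar> \<le> real n ^ Suc j * B * exp (- (\<eta> * real n))" if n: "n \<ge> 1" "k \<le> n" for n k
  proof (cases "\<exists>x\<in>maximizers p \<beta>1 \<beta>2. \<bar>real k / real n - x\<bar> < \<delta>")
    case True
    thus ?thesis using \<open>B > 0\<close> by (simp add: T_def)
  next
    case False
    define X where "X = real k / real n"
    have X: "X \<in> {0..1}" using n by (auto simp: X_def divide_le_eq)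
    have "ell p \<beta>1 \<beta>2 X \<le> ell_max p \<beta>1 \<beta>2 - \<eta>"
      using False by (intro \<eta>(2) X) (auto simp: X_def not_less)
    hence e: "real n * (ell p \<beta>1 \<beta>2 X - ell_max p \<beta>1 \<beta>2) \<le> real n * (- \<eta>)"
      by (intro mult_left_mono) auto
    have "sqrt (real n) \<le> sqrt (real n * real n)"
      using n by (intro real_sqrt_le_mono) auto
    hence sq: "sqrt (real n) \<le> real n" by simp
    have w: "laplace_weight p \<beta>1 \<beta>2 n k \<le> real n * exp (- (\<eta> * real n))"
    proof -
      have "laplace_weight p \<beta>1 \<beta>2 n k \<le> sqrt (real n) * exp (real n * (ell p \<beta>1 \<beta>2 X - ell_max p \<beta>1 \<beta>2))"
        unfolding X_def by (rule laplace_weight_le[OF n(2)])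
      also have "\<dots> \<le> real n * exp (- (\<eta> * real n))"
        using e sq by (intro mult_mono) (auto simp: mult.commute)
      finally show ?thesis .
    qed
    have "\<bar>X - x0\<bar> \<le> 1" using X x0 by auto
    hence "\<bar>s n * (X - x0)\<bar> \<le> real n * 1"
      unfolding abs_mult using s[OF n(1)] by (intro mult_mono) auto
    hence Y: "\<bar>s n * (X - x0)\<bar> ^ j \<le> real n ^ j" by (intro power_mono) auto
    have "\<bar>T n k\<bar> = laplace_weight p \<beta>1 \<beta>2 n k * \<bar>s n * (X - x0)\<bar> ^ j * \<bar>u X\<bar>"
      using False laplace_weight_nonneg[of p \<beta>1 \<beta>2 n k] by (simp add: T_def X_def abs_mult power_abs)
    also have "\<dots> \<le> (real n * exp (- (\<eta> * real n))) * real n ^ j * B"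
      using w Y B X by (intro mult_mono) (auto intro!: mult_nonneg_nonneg)
    finally show ?thesis by (simp add: mult_ac)
  qed
  have bound: "norm (s n / real n * (\<Sum>k\<le>n. T n k)) \<le> 2 * B * (real n ^ Suc (Suc j) * exp (- (\<eta> * real n)))" if "n \<ge> 1" for n
  proof -
    have "\<bar>\<Sum>k\<le>n. T n k\<bar> \<le> (\<Sum>k\<le>n. real n ^ Suc j * B * exp (- (\<eta> * real n)))"
      using T[OF that] by (intro order_trans[OF sum_abs] sum_mono) auto
    also have "\<dots> = (1 + real n) * (real n ^ Suc j * B * exp (- (\<eta> * real n)))" by simp
    also have "\<dots> \<le> (2 * real n) * (real n ^ Suc j * B * exp (- (\<eta> * real n)))"
      using that \<open>B > 0\<close> by (intro mult_right_mono) auto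
    finally have 1: "\<bar>\<Sum>k\<le>n. T n k\<bar> \<le> 2 * B * (real n ^ Suc (Suc j) * exp (- (\<eta> * real n)))"
      by (simp add: mult_ac)
    have "norm (s n / real n * (\<Sum>k\<le>n. T n k)) = s n / real n * \<bar>\<Sum>k\<le>n. T n k\<bar>"
      using s[OF that] by (simp add: abs_mult)
    also have "\<dots> \<le> 1 * \<bar>\<Sum>k\<le>n. T n k\<bar>" using s[OF that] that by (intro mult_right_mono) auto
    finally show ?thesis using 1 by simp
  qed
  have "(\<lambda>n. s n / real n * (\<Sum>k\<le>n. T n k)) \<longlonglongrightarrow> 0"
  proof (rule Lim_null_comparison)
    show "eventually (\<lambda>n. norm (s n / real n * (\<Sum>k\<le>n. T n k)) \<le> 2 * B * (real n ^ Suc (Suc j) * exp (- (\<eta> * real n)))) sequentially"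
      using bound by (rule eventually_sequentiallyI)
    show "(\<lambda>n. 2 * B * (real n ^ Suc (Suc j) * exp (- (\<eta> * real n)))) \<longlonglongrightarrow> 0"
      using tendsto_mult[OF tendsto_const power_times_exp_tendsto_0[OF \<eta>(1)], of "2 * B" "Suc (Suc j)"] by simp
  qed
  thus ?thesis by (simp add: T_def)
qed

lemma laplace_unique_maximizer:
  assumes max: "maximizers p \<beta>1 \<beta>2 = {x0}" and x0: "0 < x0" "x0 < 1" and m: "m \<ge> 1" and a: "a > 0"
    and lim: "((\<lambda>x. (ell p \<beta>1 \<beta>2 x - ell p \<beta>1 \<beta>2 x0) / (x - x0) ^ (2 * m)) \<longlongrightarrow> - a) (at x0)"
    and u: "continuous_on UNIV u"
  defines "s \<equiv> \<lambda>n. real n powr (1 / (2 * real m))"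
  shows "(\<lambda>n. s n / real n * (\<Sum>k\<le>n. laplace_weight p \<beta>1 \<beta>2 n k * (s n * (real k / real n - x0)) ^ j * u (real k / real n)))
       \<longlonglongrightarrow> u x0 / (stirling_const * sqrt (x0 * (1 - x0))) * (\<integral>y. y ^ j * exp (- a * y ^ (2 * m)) \<partial>lborel)"
proof -
  have x0_in: "x0 \<in> maximizers p \<beta>1 \<beta>2" "x0 \<in> {0..1}" using max x0 by auto
  show ?thesis
  proof (rule local_laplace[OF x0 x0_in(1) m a lim], goal_cases)
    case (1 \<delta>)
    define T where "T = (\<lambda>n k. laplace_weight p \<beta>1 \<beta>2 n k * (s n * (real k / real n - x0)) ^ j * u (real k / real n))"
    have split: "(\<Sum>k\<le>n. T n k) = (\<Sum>k\<le>n. if \<bar>real k / real n - x0\<bar> < \<delta> then T n k else 0)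
        + (\<Sum>k\<le>n. if \<bar>real k / real n - x0\<bar> < \<delta> then 0 else T n k)" for n
      unfolding sum.distrib[symmetric] by (intro sum.cong) auto
    have out: "(\<lambda>n. s n / real n * (\<Sum>k\<le>n. if \<bar>real k / real n - x0\<bar> < \<delta> then 0 else T n k)) \<longlonglongrightarrow> 0"
      using laplace_outside[OF x0_in(2) m 1(1) u, of p \<beta>1 \<beta>2 j] by (simp add: max s_def T_def cong: if_cong)
    have loc: "(\<lambda>n. s n / real n * (\<Sum>k\<le>n. if \<bar>real k / real n - x0\<bar> < \<delta> then T n k else 0)) \<longlonglongrightarrow>
        u x0 / (stirling_const * sqrt (x0 * (1 - x0))) * (\<integral>y. y ^ j * exp (- a * y ^ (2 * m)) \<partial>lborel)"
      using 1(2)[OF 1(1) order_refl u, of j] by (simp add: s_def T_def cong: if_cong)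
    from tendsto_add[OF loc out]
    have "(\<lambda>n. s n / real n * (\<Sum>k\<le>n. T n k)) \<longlonglongrightarrow>
        u x0 / (stirling_const * sqrt (x0 * (1 - x0))) * (\<integral>y. y ^ j * exp (- a * y ^ (2 * m)) \<partial>lborel) + 0"
      unfolding distrib_left[symmetric] split[symmetric] .
    thus ?case by (simp add: T_def)
  qed
qed

lemma laplace_two_maximizers:
  assumes max: "maximizers p \<beta>1 \<beta>2 = {x1, x2}" and x: "0 < x1" "x1 < x2" "x2 < 1" and a: "a1 > 0" "a2 > 0"
    and lim1: "((\<lambda>x. (ell p \<beta>1 \<beta>2 x - ell p \<beta>1 \<beta>2 x1) / (x - x1) ^ 2) \<longlongrightarrow> - a1) (at x1)"
    and lim2: "((\<lambda>x. (ell p \<beta>1 \<beta>2 x - ell p \<beta>1 \<beta>2 x2) / (x - x2) ^ 2) \<longlongrightarrow> - a2) (at x2)"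
    and u: "continuous_on UNIV u"
  shows "(\<lambda>n. sqrt (real n) / real n * (\<Sum>k\<le>n. laplace_weight p \<beta>1 \<beta>2 n k * u (real k / real n)))
       \<longlonglongrightarrow> u x1 / (stirling_const * sqrt (x1 * (1 - x1))) * (\<integral>y. exp (- a1 * y ^ 2) \<partial>lborel)
         + u x2 / (stirling_const * sqrt (x2 * (1 - x2))) * (\<integral>y. exp (- a2 * y ^ 2) \<partial>lborel)"
proof -
  define I where "I = (\<lambda>a x. u x / (stirling_const * sqrt (x * (1 - x))) * (\<integral>y. exp (- a * y ^ 2) \<partial>lborel))"
  define W where "W = (\<lambda>n k. laplace_weight p \<beta>1 \<beta>2 n k * u (real k / real n))"
  have loc: "\<exists>\<delta>0>0. \<forall>\<delta>. 0 < \<delta> \<and> \<delta> \<le> \<delta>0 \<longrightarrow>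
      (\<lambda>n. sqrt (real n) / real n * (\<Sum>k\<le>n. if \<bar>real k / real n - x\<bar> < \<delta> then W n k else 0)) \<longlonglongrightarrow> I a x"
    if "0 < x" "x < 1" "x \<in> maximizers p \<beta>1 \<beta>2" "a > 0"
      "((\<lambda>y. (ell p \<beta>1 \<beta>2 y - ell p \<beta>1 \<beta>2 x) / (y - x) ^ 2) \<longlongrightarrow> - a) (at x)" for x a
  proof -
    have "((\<lambda>y. (ell p \<beta>1 \<beta>2 y - ell p \<beta>1 \<beta>2 x) / (y - x) ^ (2 * 1)) \<longlongrightarrow> - a) (at x)" using that(5) by simp
    thus ?thesis
    proof (rule local_laplace[OF that(1-3) order_refl that(4)], goal_cases)
      case (1 \<delta>0)
      show ?case
        using 1(1) 1(2)[OF _ _ u, of _ 0] by (intro exI[of _ \<delta>0]) (simp add: W_def I_def powr_half_sqrt cong: if_cong)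
    qed
  qed
  obtain d1 where d1: "d1 > 0" "\<And>\<delta>. 0 < \<delta> \<Longrightarrow> \<delta> \<le> d1 \<Longrightarrow>
      (\<lambda>n. sqrt (real n) / real n * (\<Sum>k\<le>n. if \<bar>real k / real n - x1\<bar> < \<delta> then W n k else 0)) \<longlonglongrightarrow> I a1 x1"
    using loc[of x1 a1] x a lim1 max by auto
  obtain d2 where d2: "d2 > 0" "\<And>\<delta>. 0 < \<delta> \<Longrightarrow> \<delta> \<le> d2 \<Longrightarrow>
      (\<lambda>n. sqrt (real n) / real n * (\<Sum>k\<le>n. if \<bar>real k / real n - x2\<bar> < \<delta> then W n k else 0)) \<longlonglongrightarrow> I a2 x2"
    using loc[of x2 a2] x a lim2 max by auto
  \<comment> \<open>Small enough for both local expansions, and at most half the distance between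
    the maximizers, so that no k/n is counted in both windows.\<close>
  define \<delta> where "\<delta> = min (min d1 d2) ((x2 - x1) / 2)"
  have \<delta>: "\<delta> > 0" "\<delta> \<le> d1" "\<delta> \<le> d2" using d1(1) d2(1) x by (auto simp: \<delta>_def)
  have \<delta>_le: "\<delta> \<le> (x2 - x1) / 2" unfolding \<delta>_def by (rule min.cobounded2)
  have disj: "\<not> (\<bar>y - x1\<bar> < \<delta> \<and> \<bar>y - x2\<bar> < \<delta>)" for y
    using \<delta>_le by (auto simp: abs_if field_simps split: if_splits)
  have out: "(\<lambda>n. sqrt (real n) / real n * (\<Sum>k\<le>n. if \<exists>x\<in>{x1, x2}. \<bar>real k / real n - x\<bar> < \<delta> then 0 else W n k)) \<longlonglongrightarrow> 0"
    using laplace_outside[of x1 1 \<delta> u p \<beta>1 \<beta>2 0] x \<delta>(1) u by (simp add: max W_def powr_half_sqrt cong: if_cong)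
  have "W n k = (if \<bar>real k / real n - x1\<bar> < \<delta> then W n k else 0) + (if \<bar>real k / real n - x2\<bar> < \<delta> then W n k else 0)
      + (if \<exists>x\<in>{x1, x2}. \<bar>real k / real n - x\<bar> < \<delta> then 0 else W n k)" for n k
    using disj[of "real k / real n"] by auto
  hence "(\<Sum>k\<le>n. W n k) = (\<Sum>k\<le>n. if \<bar>real k / real n - x1\<bar> < \<delta> then W n k else 0)
      + (\<Sum>k\<le>n. if \<bar>real k / real n - x2\<bar> < \<delta> then W n k else 0)
      + (\<Sum>k\<le>n. if \<exists>x\<in>{x1, x2}. \<bar>real k / real n - x\<bar> < \<delta> then 0 else W n k)" for n
    by (simp only: sum.distrib[symmetric])
  with tendsto_add[OF tendsto_add[OF d1(2)[OF \<delta>(1,2)] d2(2)[OF \<delta>(1,3)]] out]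
  show ?thesis by (simp add: distrib_left W_def I_def)
qed

section \<open>Covariance under the Gibbs weights\<close>

definition gibbs_cov :: "nat \<Rightarrow> nat \<Rightarrow> real \<Rightarrow> real \<Rightarrow> real" where
  "gibbs_cov p n \<beta>1 \<beta>2 =
     (gibbs_sum p n \<beta>1 \<beta>2 (\<lambda>x. x ^ (p + 1)) * gibbs_sum p n \<beta>1 \<beta>2 (\<lambda>_. 1)
        - gibbs_sum p n \<beta>1 \<beta>2 (\<lambda>x. x) * gibbs_sum p n \<beta>1 \<beta>2 (\<lambda>x. x ^ p)) / gibbs_sum p n \<beta>1 \<beta>2 (\<lambda>_. 1) ^ 2"

lemma sum_laplace_weight:
  "(\<Sum>k\<le>n. laplace_weight p \<beta>1 \<beta>2 n k * f (real k / real n)) =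
     sqrt (real n) * exp (- (real n * ell_max p \<beta>1 \<beta>2)) * gibbs_sum p n \<beta>1 \<beta>2 f"
  unfolding gibbs_sum_def sum_distrib_left laplace_weight_def
  by (intro sum.cong refl) (simp add: exp_add[symmetric] algebra_simps)

lemma gibbs_sum_lin:
  "gibbs_sum p n \<beta>1 \<beta>2 (\<lambda>x. f x + g x) = gibbs_sum p n \<beta>1 \<beta>2 f + gibbs_sum p n \<beta>1 \<beta>2 g"
  "gibbs_sum p n \<beta>1 \<beta>2 (\<lambda>x. c * f x) = c * gibbs_sum p n \<beta>1 \<beta>2 f"
  by (simp_all add: gibbs_sum_def sum.distrib sum_distrib_left algebra_simps)

text \<open>Covariance is unchanged by additive constants and bilinear, so x and x^p may be replaced
  by s (x - x0) and s (x^p - x0^p). The exponents 0 and 1 and the factors \<open>* 1\<close> stay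
  visible so that all four sums have the shape (s (x - x0))^j * u x treated by
  \<open>laplace_unique_maximizer\<close>.\<close>

lemma gibbs_cov_shift:
  fixes p n :: nat and \<beta>1 \<beta>2 s x0 :: real and g :: "real \<Rightarrow> real"
  assumes g: "\<And>x. (x - x0) * g x = x ^ p - x0 ^ p"
  defines "G \<equiv> gibbs_sum p n \<beta>1 \<beta>2"
  shows "s\<^sup>2 * gibbs_cov p n \<beta>1 \<beta>2 =
    (G (\<lambda>x. (s * (x - x0)) ^ 2 * g x) * G (\<lambda>x. (s * (x - x0)) ^ 0 * 1)
       - G (\<lambda>x. (s * (x - x0)) ^ 1 * 1) * G (\<lambda>x. (s * (x - x0)) ^ 1 * g x)) / G (\<lambda>x. (s * (x - x0)) ^ 0 * 1) ^ 2"
proof -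
  have "(\<lambda>x. (s * (x - x0)) ^ 2 * g x) = (\<lambda>x. s\<^sup>2 * x ^ (p + 1) + ((- s\<^sup>2 * x0) * x ^ p + ((- s\<^sup>2 * x0 ^ p) * x + s\<^sup>2 * x0 ^ (p + 1) * 1)))"
  proof
    fix x
    have "(s * (x - x0)) ^ 2 * g x = s\<^sup>2 * (x - x0) * ((x - x0) * g x)" by (simp add: power2_eq_square)
    thus "(s * (x - x0)) ^ 2 * g x = s\<^sup>2 * x ^ (p + 1) + ((- s\<^sup>2 * x0) * x ^ p + ((- s\<^sup>2 * x0 ^ p) * x + s\<^sup>2 * x0 ^ (p + 1) * 1))"
      unfolding g by (simp add: algebra_simps)
  qed
  hence 1: "G (\<lambda>x. (s * (x - x0)) ^ 2 * g x) = s\<^sup>2 * G (\<lambda>x. x ^ (p + 1)) + ((- s\<^sup>2 * x0) * G (\<lambda>x. x ^ p)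
      + ((- s\<^sup>2 * x0 ^ p) * G (\<lambda>x. x) + s\<^sup>2 * x0 ^ (p + 1) * G (\<lambda>_. 1)))"
    unfolding G_def by (simp only: gibbs_sum_lin)
  have "(\<lambda>x. (s * (x - x0)) ^ 1 * g x) = (\<lambda>x. s * x ^ p + (- s * x0 ^ p) * 1)"
  proof
    fix x
    have "(s * (x - x0)) ^ 1 * g x = s * ((x - x0) * g x)" by simp
    thus "(s * (x - x0)) ^ 1 * g x = s * x ^ p + (- s * x0 ^ p) * 1"
      unfolding g by (simp add: algebra_simps)
  qed
  hence 2: "G (\<lambda>x. (s * (x - x0)) ^ 1 * g x) = s * G (\<lambda>x. x ^ p) + (- s * x0 ^ p) * G (\<lambda>_. 1)"
    unfolding G_def by (simp only: gibbs_sum_lin)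
  have "(\<lambda>x. (s * (x - x0)) ^ 1 * 1) = (\<lambda>x. s * x + (- s * x0) * 1)"
    by (simp add: algebra_simps)
  hence 3: "G (\<lambda>x. (s * (x - x0)) ^ 1 * 1) = s * G (\<lambda>x. x) + (- s * x0) * G (\<lambda>_. 1)"
    unfolding G_def by (simp only: gibbs_sum_lin)
  have 4: "G (\<lambda>x. (s * (x - x0)) ^ 0 * 1) = G (\<lambda>_. 1)" by simp
  have "s\<^sup>2 * gibbs_cov p n \<beta>1 \<beta>2 = s\<^sup>2 * (G (\<lambda>x. x ^ (p + 1)) * G (\<lambda>_. 1) - G (\<lambda>x. x) * G (\<lambda>x. x ^ p)) / G (\<lambda>_. 1) ^ 2"
    by (simp add: gibbs_cov_def G_def)
  also have "s\<^sup>2 * (G (\<lambda>x. x ^ (p + 1)) * G (\<lambda>_. 1) - G (\<lambda>x. x) * G (\<lambda>x. x ^ p)) =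
     G (\<lambda>x. (s * (x - x0)) ^ 2 * g x) * G (\<lambda>x. (s * (x - x0)) ^ 0 * 1)
       - G (\<lambda>x. (s * (x - x0)) ^ 1 * 1) * G (\<lambda>x. (s * (x - x0)) ^ 1 * g x)"
    unfolding 1 2 3 4 by (simp add: algebra_simps power2_eq_square)
  finally show ?thesis unfolding 4 .
qed

lemma gibbs_cov_unique_maximizer:
  assumes max: "maximizers p \<beta>1 \<beta>2 = {x0}" and x0: "0 < x0" "x0 < 1" and m: "m \<ge> 1" and a: "a > 0"
    and lim: "((\<lambda>x. (ell p \<beta>1 \<beta>2 x - ell p \<beta>1 \<beta>2 x0) / (x - x0) ^ (2 * m)) \<longlongrightarrow> - a) (at x0)"
  shows "(\<lambda>n. real n powr (1 / real m) * gibbs_cov p n \<beta>1 \<beta>2) \<longlonglongrightarrow>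
           real p * x0 ^ (p - 1) * (a powr (- 1 / real m) * Gamma (3 / (2 * real m)) / Gamma (1 / (2 * real m)))"
proof -
  define s where "s = (\<lambda>n. real n powr (1 / (2 * real m)))"
  define D where "D = 1 / (stirling_const * sqrt (x0 * (1 - x0)))"
  define I where "I = (\<lambda>j. \<integral>y. y ^ j * exp (- a * y ^ (2 * m)) \<partial>lborel)"
  \<comment> \<open>The common normalization under which all moments converge. Numerator and
    denominator of the covariance are both quadratic in the sums, so it cancels.\<close>
  define \<kappa> where "\<kappa> = (\<lambda>n. s n / real n * (sqrt (real n) * exp (- (real n * ell_max p \<beta>1 \<beta>2))))"
  \<comment> \<open>The polynomial (x^p - x0^p) / (x - x0), whose value at x0 is the derivative p
    x0^(p-1).\<close>
  define g where "g = (\<lambda>x. \<Sum>i<p. x0 ^ (p - Suc i) * x ^ i)"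
  have g: "(x - x0) * g x = x ^ p - x0 ^ p" for x
    unfolding g_def by (simp add: power_diff_sumr2)
  have "g x0 = (\<Sum>i<p. x0 ^ (p - 1))"
    unfolding g_def by (intro sum.cong) (auto simp: power_add[symmetric])
  hence gx0: "g x0 = real p * x0 ^ (p - 1)" by simp
  have contg: "continuous_on UNIV g" unfolding g_def by (intro continuous_intros)
  define N where "N = (\<lambda>n j u. \<kappa> n * gibbs_sum p n \<beta>1 \<beta>2 (\<lambda>x. (s n * (x - x0)) ^ j * u x))"
  have N: "(\<lambda>n. N n j u) \<longlonglongrightarrow> D * u x0 * I j" if "continuous_on UNIV u" for j u
  proof -
    have "N n j u = s n / real n * (\<Sum>k\<le>n. laplace_weight p \<beta>1 \<beta>2 n k * (s n * (real k / real n - x0)) ^ j * u (real k / real n))" for n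
      using sum_laplace_weight[of p \<beta>1 \<beta>2 n "\<lambda>x. (s n * (x - x0)) ^ j * u x"]
      by (simp add: N_def \<kappa>_def mult.assoc)
    thus ?thesis using laplace_unique_maximizer[OF max x0 m a lim that, of j] by (simp add: D_def I_def s_def)
  qed
  have D: "D > 0" using stirling_const_pos x0 by (simp add: D_def)
  have I0: "I 0 = a powr - (1 / (2 * real m)) * Gamma (1 / (2 * real m)) / real m"
    using has_bochner_integral_even_power_exp_power[OF a m, of 0] by (simp add: I_def has_bochner_integral_iff)
  have I1: "I 1 = 0"
    using has_bochner_integral_odd_power_exp_power[OF a m, of 1] by (simp add: I_def has_bochner_integral_iff)
  have I2: "I 2 = a powr - (3 / (2 * real m)) * Gamma (3 / (2 * real m)) / real m"
    using has_bochner_integral_even_power_exp_power[OF a m, of 2] by (simp add: I_def has_bochner_integral_iff)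
  have G0: "Gamma (1 / (2 * real m)) > 0" using m by (intro Gamma_real_pos) simp
  have I0pos: "I 0 > 0" using G0 a m by (simp add: I0)
  have "(\<lambda>n. (N n 2 g * N n 0 (\<lambda>_. 1) - N n 1 (\<lambda>_. 1) * N n 1 g) / N n 0 (\<lambda>_. 1) ^ 2)
      \<longlonglongrightarrow> ((D * g x0 * I 2) * (D * 1 * I 0) - (D * 1 * I 1) * (D * g x0 * I 1)) / (D * 1 * I 0) ^ 2"
    using D I0pos by (intro tendsto_intros N contg) auto
  also have "((D * g x0 * I 2) * (D * 1 * I 0) - (D * 1 * I 1) * (D * g x0 * I 1)) / (D * 1 * I 0) ^ 2 = g x0 * (I 2 / I 0)"
    using D I0pos unfolding I1 by (simp add: power2_eq_square)
  also have "I 2 / I 0 = a powr (- 1 / real m) * Gamma (3 / (2 * real m)) / Gamma (1 / (2 * real m))"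
  proof -
    have "- (3 / (2 * real m)) - (- (1 / (2 * real m))) = - 1 / real m" using m by (simp add: field_simps)
    hence "a powr - (3 / (2 * real m)) / a powr - (1 / (2 * real m)) = a powr (- 1 / real m)"
      using a by (simp only: powr_diff[symmetric])
    moreover have "(A * g3 / real m) / (B * g1 / real m) = A / B * g3 / g1" for A B g1 g3
      using m by simp
    ultimately show ?thesis by (simp only: I0 I2)
  qed
  finally have lim': "(\<lambda>n. (N n 2 g * N n 0 (\<lambda>_. 1) - N n 1 (\<lambda>_. 1) * N n 1 g) / N n 0 (\<lambda>_. 1) ^ 2)
      \<longlonglongrightarrow> real p * x0 ^ (p - 1) * (a powr (- 1 / real m) * Gamma (3 / (2 * real m)) / Gamma (1 / (2 * real m)))"
    by (simp only: gx0)
  show ?thesis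
  proof (rule Lim_transform_eventually[OF lim'], rule eventually_sequentiallyI[of 1])
    fix n :: nat assume n: "n \<ge> 1"
    have \<kappa>: "\<kappa> n \<noteq> 0" using n by (simp add: \<kappa>_def s_def)
    have "(s n)\<^sup>2 = real n powr (1 / real m)"
      using n m by (simp add: s_def powr_power)
    hence "real n powr (1 / real m) * gibbs_cov p n \<beta>1 \<beta>2 = (s n)\<^sup>2 * gibbs_cov p n \<beta>1 \<beta>2" by simp
    also have "\<dots> = (N n 2 g * N n 0 (\<lambda>_. 1) - N n 1 (\<lambda>_. 1) * N n 1 g) / N n 0 (\<lambda>_. 1) ^ 2"
    proof -
      have cancel: "((\<kappa> n * A) * (\<kappa> n * B) - (\<kappa> n * C) * (\<kappa> n * E)) / (\<kappa> n * B) ^ 2 = (A * B - C * E) / B ^ 2" for A B C E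
      proof -
        have "(\<kappa> n * A) * (\<kappa> n * B) - (\<kappa> n * C) * (\<kappa> n * E) = (\<kappa> n)\<^sup>2 * (A * B - C * E)"
          by (simp add: algebra_simps power2_eq_square)
        thus ?thesis using \<kappa> by (simp add: power_mult_distrib)
      qed
      show ?thesis unfolding gibbs_cov_shift[OF g] N_def cancel ..
    qed
    finally show "(N n 2 g * N n 0 (\<lambda>_. 1) - N n 1 (\<lambda>_. 1) * N n 1 g) / N n 0 (\<lambda>_. 1) ^ 2
        = real n powr (1 / real m) * gibbs_cov p n \<beta>1 \<beta>2" by simp
  qed
qed

text \<open>For a law on two points the covariance is the product of the two probabilities and the
  two increments. Masses proportional to 1/S1 and 1/S2 give probabilities S2 / (S1 + S2) and S1 /
  (S1 + S2).\<close>

lemma two_point_covariance: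
  fixes x1 x2 S1 S2 c :: real
  assumes "S1 > 0" "S2 > 0" "c > 0"
  defines "w1 \<equiv> c / S1" and "w2 \<equiv> c / S2"
  shows "((x1 ^ (p + 1) * w1 + x2 ^ (p + 1) * w2) * (w1 + w2) - (x1 * w1 + x2 * w2) * (x1 ^ p * w1 + x2 ^ p * w2)) / (w1 + w2)\<^sup>2
    = (x1 ^ p - x2 ^ p) * (x1 - x2) * S1 * S2 / (S1 + S2)\<^sup>2"
proof -
  have 1: "(x1 ^ (p + 1) * w1 + x2 ^ (p + 1) * w2) * (w1 + w2) - (x1 * w1 + x2 * w2) * (x1 ^ p * w1 + x2 ^ p * w2)
      = (x1 ^ p - x2 ^ p) * (x1 - x2) * (w1 * w2)"
    by (simp add: algebra_simps)
  have 2: "w1 + w2 = c * (S1 + S2) / (S1 * S2)" "w1 * w2 = c\<^sup>2 / (S1 * S2)"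
    using assms by (simp_all add: field_simps power2_eq_square)
  define K where "K = (x1 ^ p - x2 ^ p) * (x1 - x2)"
  have "K * (c\<^sup>2 / (S1 * S2)) / (c * (S1 + S2) / (S1 * S2))\<^sup>2 = K * S1 * S2 / (S1 + S2)\<^sup>2"
    using assms(1-3) by (simp add: power2_eq_square)
  thus ?thesis by (simp only: 1 2[symmetric] K_def)
qed

text \<open>The mass near a maximizer is Stirling's factor 1 / sqrt (x (1 - x)) times a Gaussian
  integral proportional to 1 / sqrt |L|. Their product is the reciprocal of the corresponding
  \<open>S1\<close> or \<open>S2\<close>, up to a common constant.\<close>

lemma gibbs_cov_two_maximizers:
  assumes max: "maximizers p \<beta>1 \<beta>2 = {x1, x2}" and x: "0 < x1" "x1 < x2" "x2 < 1" and L: "L1 < 0" "L2 < 0"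
    and lim1: "((\<lambda>x. (ell p \<beta>1 \<beta>2 x - ell p \<beta>1 \<beta>2 x1) / (x - x1) ^ 2) \<longlongrightarrow> L1 / 2) (at x1)"
    and lim2: "((\<lambda>x. (ell p \<beta>1 \<beta>2 x - ell p \<beta>1 \<beta>2 x2) / (x - x2) ^ 2) \<longlongrightarrow> L2 / 2) (at x2)"
  defines "S1 \<equiv> sqrt (x1 * (1 - x1) * \<bar>L1\<bar>)" and "S2 \<equiv> sqrt (x2 * (1 - x2) * \<bar>L2\<bar>)"
  shows "(\<lambda>n. gibbs_cov p n \<beta>1 \<beta>2) \<longlonglongrightarrow> (x1 ^ p - x2 ^ p) * (x1 - x2) * S1 * S2 / (S1 + S2)\<^sup>2"
proof -
  \<comment> \<open>What the two masses share: sqrt 2 comes from the exponent L / 2, Gamma (1/2)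
    from the Gaussian integral and \<open>stirling_const\<close> from the binomial
    coefficient.\<close>
  define c where "c = sqrt 2 * Gamma (1/2) / stirling_const"
  have c: "c > 0" using stirling_const_pos Gamma_real_pos[of "1/2"] by (simp add: c_def)
  have gauss: "(\<integral>y. exp (- a * y ^ 2) \<partial>lborel) = Gamma (1/2) / sqrt a" if "a > 0" for a :: real
  proof -
    have "has_bochner_integral lborel (\<lambda>y. exp (- a * y ^ 2)) (a powr - (1/2) * Gamma (1/2))"
      using has_bochner_integral_even_power_exp_power[OF that order_refl, of 0] by simp
    hence "(\<integral>y. exp (- a * y ^ 2) \<partial>lborel) = a powr - (1/2) * Gamma (1/2)"
      by (rule has_bochner_integral_integral_eq)
    also have "a powr - (1/2) = inverse (sqrt a)"
      using that by (simp only: powr_minus powr_half_sqrt less_imp_le)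
    finally show ?thesis by (simp only: divide_inverse[of "Gamma (1/2)"] mult.commute)
  qed
  have weight: "1 / (stirling_const * sqrt (x * (1 - x))) * (\<integral>y. exp (- (- L / 2) * y ^ 2) \<partial>lborel)
      = c / sqrt (x * (1 - x) * \<bar>L\<bar>)" if "0 < x" "x < 1" "L < 0" for x L :: real
  proof -
    have "(\<integral>y. exp (- (- L / 2) * y ^ 2) \<partial>lborel) = Gamma (1/2) / sqrt (- L / 2)"
      using that by (intro gauss) simp
    also have "sqrt (- L / 2) = sqrt \<bar>L\<bar> / sqrt 2"
      using that by (simp only: real_sqrt_divide abs_of_neg)
    finally show ?thesis
      using that stirling_const_pos by (simp only: c_def real_sqrt_mult) (simp add: field_simps)
  qed
  define w1 where "w1 = c / S1"
  define w2 where "w2 = c / S2"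
  have S: "S1 > 0" "S2 > 0" using x L by (auto simp: S1_def S2_def intro!: mult_pos_neg mult_pos_pos)
  define \<kappa> where "\<kappa> = (\<lambda>n. sqrt (real n) / real n * (sqrt (real n) * exp (- (real n * ell_max p \<beta>1 \<beta>2))))"
  define N where "N = (\<lambda>n u. \<kappa> n * gibbs_sum p n \<beta>1 \<beta>2 u)"
  have N: "(\<lambda>n. N n u) \<longlonglongrightarrow> u x1 * w1 + u x2 * w2" if "continuous_on UNIV u" for u
  proof -
    have "N n u = sqrt (real n) / real n * (\<Sum>k\<le>n. laplace_weight p \<beta>1 \<beta>2 n k * u (real k / real n))" for n
      by (simp add: N_def \<kappa>_def sum_laplace_weight)
    moreover have "(\<lambda>n. sqrt (real n) / real n * (\<Sum>k\<le>n. laplace_weight p \<beta>1 \<beta>2 n k * u (real k / real n)))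
       \<longlonglongrightarrow> u x1 / (stirling_const * sqrt (x1 * (1 - x1))) * (\<integral>y. exp (- (- L1 / 2) * y ^ 2) \<partial>lborel)
         + u x2 / (stirling_const * sqrt (x2 * (1 - x2))) * (\<integral>y. exp (- (- L2 / 2) * y ^ 2) \<partial>lborel)"
      using L lim1 lim2 by (intro laplace_two_maximizers max x that) auto
    ultimately show ?thesis
      using weight[of x1 L1] weight[of x2 L2] x L
      by (simp add: w1_def w2_def S1_def S2_def flip: times_divide_eq_right)
  qed
  have w: "w1 > 0" "w2 > 0" using c S by (auto simp: w1_def w2_def)
  have "(\<lambda>n. (N n (\<lambda>x. x ^ (p + 1)) * N n (\<lambda>_. 1) - N n (\<lambda>x. x) * N n (\<lambda>x. x ^ p)) / N n (\<lambda>_. 1) ^ 2)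
      \<longlonglongrightarrow> ((x1 ^ (p + 1) * w1 + x2 ^ (p + 1) * w2) * (1 * w1 + 1 * w2) - (x1 * w1 + x2 * w2) * (x1 ^ p * w1 + x2 ^ p * w2))
        / (1 * w1 + 1 * w2)\<^sup>2"
    using w by (intro tendsto_intros N continuous_intros) auto
  also have "((x1 ^ (p + 1) * w1 + x2 ^ (p + 1) * w2) * (1 * w1 + 1 * w2) - (x1 * w1 + x2 * w2) * (x1 ^ p * w1 + x2 ^ p * w2))
        / (1 * w1 + 1 * w2)\<^sup>2 = (x1 ^ p - x2 ^ p) * (x1 - x2) * S1 * S2 / (S1 + S2)\<^sup>2"
    unfolding w1_def w2_def mult_1_left by (rule two_point_covariance[OF S c])
  finally show ?thesis
  proof (rule Lim_transform_eventually, intro eventually_sequentiallyI[of 1])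
    fix n :: nat assume n: "n \<ge> 1"
    have \<kappa>: "\<kappa> n \<noteq> 0" using n by (simp add: \<kappa>_def)
    have cancel: "((\<kappa> n * A) * (\<kappa> n * B) - (\<kappa> n * C) * (\<kappa> n * E)) / (\<kappa> n * B) ^ 2 = (A * B - C * E) / B ^ 2" for A B C E
    proof -
      have "(\<kappa> n * A) * (\<kappa> n * B) - (\<kappa> n * C) * (\<kappa> n * E) = (\<kappa> n)\<^sup>2 * (A * B - C * E)"
        by (simp add: algebra_simps power2_eq_square)
      thus ?thesis using \<kappa> by (simp add: power_mult_distrib)
    qed
    show "(N n (\<lambda>x. x ^ (p + 1)) * N n (\<lambda>_. 1) - N n (\<lambda>x. x) * N n (\<lambda>x. x ^ p)) / N n (\<lambda>_. 1) ^ 2 = gibbs_cov p n \<beta>1 \<beta>2"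
      unfolding N_def cancel gibbs_cov_def ..
  qed
qed

section \<open>The limit of psi\<close>

lemma gibbs_sum_le:
  assumes "n \<ge> 1"
  shows "gibbs_sum p n \<beta>1 \<beta>2 (\<lambda>_. 1) \<le> (real n + 1) * exp (real n * ell_max p \<beta>1 \<beta>2)"
proof -
  have "gibbs_sum p n \<beta>1 \<beta>2 (\<lambda>_. 1) \<le> (\<Sum>k\<le>n. exp (real n * ell_max p \<beta>1 \<beta>2))"
    unfolding gibbs_sum_def
  proof (intro sum_mono)
    fix k assume k: "k \<in> {..n}"
    define X where "X = real k / real n"
    have "real (n choose k) * exp (real n * (\<beta>1 * X + \<beta>2 * X ^ p)) * 1
        \<le> exp (real n * entropy X) * exp (real n * (\<beta>1 * X + \<beta>2 * X ^ p))"
      using binomial_le_exp_entropy[of k n] k by (simp add: X_def)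
    also have "\<dots> = exp (real n * ell p \<beta>1 \<beta>2 X)"
      by (simp add: exp_add[symmetric] ell_eq_entropy algebra_simps)
    also have "\<dots> \<le> exp (real n * ell_max p \<beta>1 \<beta>2)"
      using k assms by (auto intro!: mult_left_mono ell_le_max simp: X_def divide_le_eq)
    finally show "real (n choose k) * exp (real n * (\<beta>1 * (real k / real n) + \<beta>2 * (real k / real n) ^ p)) * 1
        \<le> exp (real n * ell_max p \<beta>1 \<beta>2)" by (simp add: X_def)
  qed
  thus ?thesis by (simp add: add.commute)
qed

text \<open>Only the term k is kept. \<open>A\<close> is uniform because sqrt (x (1 - x)) <= 1 and
  \<open>stirling_quotient\<close> lies between its limit and its value at 1.\<close>

lemma gibbs_sum_ge:
  obtains A where "A > 0" "\<And>p n \<beta>1 \<beta>2 k. 0 < k \<Longrightarrow> k < n \<Longrightarrow>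
    A / sqrt (real n) * exp (real n * ell p \<beta>1 \<beta>2 (real k / real n)) \<le> gibbs_sum p n \<beta>1 \<beta>2 (\<lambda>_. 1)"
proof -
  define A where "A = stirling_const / (stirling_quotient 1 * stirling_quotient 1)"
  have A: "A > 0" using stirling_const_pos stirling_quotient_pos[of 1] by (simp add: A_def)
  have "A / sqrt (real n) * exp (real n * ell p \<beta>1 \<beta>2 (real k / real n)) \<le> gibbs_sum p n \<beta>1 \<beta>2 (\<lambda>_. 1)"
    if k: "0 < k" "k < n" for p n \<beta>1 \<beta>2 k
  proof -
    define X where "X = real k / real n"
    have X: "0 < X" "X < 1" using k by (auto simp: X_def)
    have "sqrt (X * (1 - X)) \<le> sqrt (1 * 1)"
      using X by (intro real_sqrt_le_mono mult_mono) auto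
    hence "A / 1 \<le> stirling_quotient n / (stirling_quotient k * stirling_quotient (n - k)) / sqrt (X * (1 - X))"
      unfolding A_def using X k stirling_quotient_pos stirling_const_pos
      by (intro frac_le mult_mono stirling_const_le stirling_quotient_le)
         (auto intro!: divide_nonneg_nonneg mult_nonneg_nonneg mult_pos_pos less_imp_le[OF stirling_quotient_pos])
    hence "exp (real n * entropy X) * A \<le> sqrt (real n) * real (n choose k)"
      unfolding binomial_stirling[OF k] X_def by (intro mult_left_mono) auto
    hence "A / sqrt (real n) * exp (real n * entropy X) \<le> real (n choose k)"
      using k by (simp add: field_simps)
    hence "A / sqrt (real n) * exp (real n * entropy X) * exp (real n * (\<beta>1 * X + \<beta>2 * X ^ p)) \<le>
       real (n choose k) * exp (real n * (\<beta>1 * X + \<beta>2 * X ^ p))"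
      by (rule mult_right_mono) simp
    also have "\<dots> = real (n choose k) * exp (real n * (\<beta>1 * X + \<beta>2 * X ^ p)) * 1" by simp
    also have "\<dots> \<le> gibbs_sum p n \<beta>1 \<beta>2 (\<lambda>_. 1)"
      unfolding gibbs_sum_def X_def using k
      by (intro member_le_sum[of k "{..n}" "\<lambda>k. real (n choose k) * exp (real n * (\<beta>1 * (real k / real n) + \<beta>2 * (real k / real n) ^ p)) * 1"]) auto
    finally show ?thesis
      by (simp add: X_def ell_eq_entropy exp_add[symmetric] algebra_simps)
  qed
  with A show thesis by (rule that)
qed

text \<open>The n + 1 terms exceed the largest one by at most ln (n + 1) / n on the scale of
  \<open>psi\<close>, and one term with k/n close to a maximizer loses only terms of order ln n /
  n.\<close>

lemma psi_tendsto: "(\<lambda>n. psi p n \<beta>1 \<beta>2) \<longlonglongrightarrow> ell_max p \<beta>1 \<beta>2"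
proof (rule order_tendstoI)
  fix c assume c: "ell_max p \<beta>1 \<beta>2 < c"
  have "(\<lambda>n. ell_max p \<beta>1 \<beta>2 + ln (real n + 1) / real n) \<longlonglongrightarrow> ell_max p \<beta>1 \<beta>2 + 0"
    by (intro tendsto_add tendsto_const) real_asymp
  hence "eventually (\<lambda>n. ell_max p \<beta>1 \<beta>2 + ln (real n + 1) / real n < c) sequentially"
    using c by (intro order_tendstoD) auto
  thus "eventually (\<lambda>n. psi p n \<beta>1 \<beta>2 < c) sequentially"
    using eventually_ge_at_top[of 1]
  proof eventually_elim
    case (elim n)
    have "ln (gibbs_sum p n \<beta>1 \<beta>2 (\<lambda>_. 1)) \<le> ln ((real n + 1) * exp (real n * ell_max p \<beta>1 \<beta>2))"
      using gibbs_sum_le[OF elim(2)] gibbs_sum_pos by (subst ln_le_cancel_iff) auto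
    also have "\<dots> = ln (real n + 1) + real n * ell_max p \<beta>1 \<beta>2"
      by (simp add: ln_mult)
    finally have "psi p n \<beta>1 \<beta>2 \<le> (ln (real n + 1) + real n * ell_max p \<beta>1 \<beta>2) / real n"
      unfolding psi_eq[OF elim(2)] by (intro divide_right_mono) auto
    also have "\<dots> = ell_max p \<beta>1 \<beta>2 + ln (real n + 1) / real n"
      using elim(2) by (simp add: field_simps)
    finally show ?case using elim(1) by simp
  qed
next
  fix c assume c: "c < ell_max p \<beta>1 \<beta>2"
  obtain z where z: "z \<in> maximizers p \<beta>1 \<beta>2" using maximizers_nonempty by blast
  hence z01: "z \<in> {0..1}" by (simp add: maximizers_def)
  have "((ell p \<beta>1 \<beta>2) \<longlongrightarrow> ell p \<beta>1 \<beta>2 z) (at z within {0..1})"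
    using continuous_on_ell[of p \<beta>1 \<beta>2] z01 by (simp add: continuous_on_def)
  hence ev: "eventually (\<lambda>x. c < ell p \<beta>1 \<beta>2 x) (at z within {0..1})"
    using c ell_max_eq[OF z] by (intro order_tendstoD) auto
  \<comment> \<open>The lower bound needs 0 < k < n, while z may be an endpoint for arbitrary
    parameters. By continuity z can be replaced by an interior point that still beats c.\<close>
  obtain x where x: "0 < x" "x < 1" "c < ell p \<beta>1 \<beta>2 x"
  proof -
    from ev obtain d where d: "d > 0" "\<And>x. x \<in> {0..1} \<Longrightarrow> x \<noteq> z \<Longrightarrow> dist x z < d \<Longrightarrow> c < ell p \<beta>1 \<beta>2 x"
      by (auto simp: eventually_at)
    define e where "e = min (d / 2) (1 / 4)"
    have e: "0 < e" "e < d" "e \<le> 1 / 4" using d(1) by (auto simp: e_def min_def)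
    show ?thesis
    proof (cases "z \<le> 1 / 2")
      case True
      thus ?thesis using that[of "z + e"] d(2)[of "z + e"] e z01 by (auto simp: dist_real_def)
    next
      case False
      thus ?thesis using that[of "z - e"] d(2)[of "z - e"] e z01 by (auto simp: dist_real_def)
    qed
  qed
  obtain A where A: "A > 0" "\<And>p n \<beta>1 \<beta>2 k. 0 < k \<Longrightarrow> k < n \<Longrightarrow>
    A / sqrt (real n) * exp (real n * ell p \<beta>1 \<beta>2 (real k / real n)) \<le> gibbs_sum p n \<beta>1 \<beta>2 (\<lambda>_. 1)"
    using gibbs_sum_ge by blast
  define k where "k = (\<lambda>n. nat \<lfloor>real n * x\<rfloor>)"
  have X: "(\<lambda>n. real (k n) / real n) \<longlonglongrightarrow> x"
  proof (rule tendsto_sandwich[of "\<lambda>n. x - 1 / real n" _ _ "\<lambda>_. x"])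
    have bd: "x - 1 / real n \<le> real (k n) / real n \<and> real (k n) / real n \<le> x" if "n \<ge> 1" for n
    proof -
      have "real n * x \<ge> 0" using x by simp
      hence "real (k n) = of_int \<lfloor>real n * x\<rfloor>" by (simp add: k_def)
      hence "(x * real n - 1) / real n \<le> real (k n) / real n" "real (k n) / real n \<le> (x * real n) / real n"
        by (intro divide_right_mono; simp add: mult.commute)+
      thus ?thesis using that by (simp add: diff_divide_distrib)
    qed
    show "eventually (\<lambda>n. x - 1 / real n \<le> real (k n) / real n) sequentially"
         "eventually (\<lambda>n. real (k n) / real n \<le> x) sequentially"
      using bd by (blast intro: eventually_sequentiallyI[of 1])+
    show "(\<lambda>n. x - 1 / real n) \<longlonglongrightarrow> x" by real_asymp
  qed auto
  have "isCont (ell p \<beta>1 \<beta>2) x" using DERIV_ell[OF x(1,2)] by (rule DERIV_isCont)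
  have "(\<lambda>n. ell p \<beta>1 \<beta>2 (real (k n) / real n) + (ln A / real n - ln (real n) / (2 * real n))) \<longlonglongrightarrow> ell p \<beta>1 \<beta>2 x + 0"
    by (intro tendsto_add isCont_tendsto_compose[OF \<open>isCont (ell p \<beta>1 \<beta>2) x\<close> X]) real_asymp
  hence "eventually (\<lambda>n. c < ell p \<beta>1 \<beta>2 (real (k n) / real n) + (ln A / real n - ln (real n) / (2 * real n))) sequentially"
    using x(3) by (intro order_tendstoD) auto
  moreover have "eventually (\<lambda>n. 0 < real (k n) / real n) sequentially" "eventually (\<lambda>n. real (k n) / real n < 1) sequentially"
    using X x by (auto intro: order_tendstoD)
  ultimately show "eventually (\<lambda>n. c < psi p n \<beta>1 \<beta>2) sequentially"
    using eventually_ge_at_top[of 1]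
  proof eventually_elim
    case (elim n)
    have k: "0 < k n" "k n < n" using elim by (auto simp: zero_less_divide_iff)
    have n: "real n > 0" using elim by simp
    have "ln (A / sqrt (real n) * exp (real n * ell p \<beta>1 \<beta>2 (real (k n) / real n))) \<le> ln (gibbs_sum p n \<beta>1 \<beta>2 (\<lambda>_. 1))"
      using A(2)[OF k, of p \<beta>1 \<beta>2] A(1) n gibbs_sum_pos by (subst ln_le_cancel_iff) auto
    also have "ln (A / sqrt (real n) * exp (real n * ell p \<beta>1 \<beta>2 (real (k n) / real n))) =
       ln A - ln (real n) / 2 + real n * ell p \<beta>1 \<beta>2 (real (k n) / real n)"
      using A(1) n by (simp add: ln_mult ln_div ln_sqrt)
    finally have "(ln A - ln (real n) / 2 + real n * ell p \<beta>1 \<beta>2 (real (k n) / real n)) / real n \<le> psi p n \<beta>1 \<beta>2"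
      unfolding psi_eq[OF elim(4)] by (intro divide_right_mono) auto
    moreover have "(ln A - ln (real n) / 2 + real n * ell p \<beta>1 \<beta>2 (real (k n) / real n)) / real n =
        ell p \<beta>1 \<beta>2 (real (k n) / real n) + (ln A / real n - ln (real n) / (2 * real n))"
      using n by (simp add: field_simps)
    ultimately show ?case using elim(1) by simp
  qed
qed

section \<open>Degenerate maximizers\<close>

definition crit_point :: "nat \<Rightarrow> real" where
  "crit_point p = (real p - 1) / real p"

lemma DERIV_bump:
  assumes "p \<ge> 2"
  shows "((\<lambda>y. y ^ (p - 1) * (1 - y)) has_field_derivative - real p * y ^ (p - 2) * (y - crit_point p)) (at y)"
proof -
  obtain r where r: "p = Suc (Suc r)" using assms by (metis Suc_le_D numeral_2_eq_2 Suc_le_mono)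
  have pow: "((\<lambda>y. y ^ Suc r) has_field_derivative real (Suc r) * y ^ r) (at y)"
    using DERIV_pow[of "Suc r" y] by simp
  have "((\<lambda>y. y ^ Suc r * (1 - y)) has_field_derivative real (Suc r) * y ^ r * (1 - y) + - 1 * y ^ Suc r) (at y)"
    by (rule DERIV_mult[OF pow, THEN DERIV_cong]) (auto intro!: derivative_eq_intros)
  also have "real (Suc r) * y ^ r * (1 - y) + - 1 * y ^ Suc r = - real p * y ^ (p - 2) * (y - crit_point p)"
    by (simp add: r crit_point_def field_simps)
  finally show ?thesis by (simp add: r)
qed

lemma crit_point_bounds: "p \<ge> 2 \<Longrightarrow> 0 < crit_point p" "p \<ge> 2 \<Longrightarrow> crit_point p < 1"
  by (auto simp: crit_point_def field_simps)

text \<open>This explains \<open>beta2_crit\<close>: it is the largest \<open>\<beta>2\<close> for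
  which \<open>ell2\<close> is nonpositive on the whole open interval, touching 0 where the bump
  x^(p-1) (1 - x) is largest. \<open>beta1_crit\<close> then makes that point stationary.\<close>

lemma beta2_crit_eq:
  assumes "p \<ge> 2"
  shows "beta2_crit p * (real p * (real p - 1)) * (crit_point p ^ (p - 1) * (1 - crit_point p)) = 1"
proof -
  obtain r where r: "p = Suc (Suc r)" using assms by (metis Suc_le_D numeral_2_eq_2 Suc_le_mono)
  have "1 - crit_point p = 1 / real p" using assms by (simp add: crit_point_def field_simps)
  moreover have "real p - 1 > 0" using assms by simp
  ultimately show ?thesis
    unfolding beta2_crit_def crit_point_def using assms
    by (simp add: r power_divide del: of_nat_Suc)
qed

lemma ell1_crit:
  assumes "p \<ge> 2"
  shows "ell1 p (beta1_crit p) (beta2_crit p) (crit_point p) = 0"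
proof -
  obtain r where r: "p = Suc (Suc r)" using assms by (metis Suc_le_D numeral_2_eq_2 Suc_le_mono)
  have pos: "real p > 0" "real p - 1 > 0" using assms by auto
  have "beta2_crit p * (real p * crit_point p ^ (p - 1)) = real p / (real p - 1)"
    unfolding beta2_crit_def crit_point_def using pos
    by (simp add: r power_divide del: of_nat_Suc)
  moreover have "ln (crit_point p) = ln (real p - 1) - ln (real p)"
    unfolding crit_point_def using pos by (simp add: ln_div)
  moreover have "1 - crit_point p = 1 / real p"
    using pos by (simp add: crit_point_def field_simps)
  hence "ln (1 - crit_point p) = - ln (real p)"
    using pos by (simp add: ln_div)
  ultimately show ?thesis by (simp add: ell1_def beta1_crit_def)
qed

text \<open>The two equations are triangular: the first is affine in \<open>\<beta>2\<close> alone
  with nonzero slope, and the second then fixes \<open>\<beta>1\<close>.\<close>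

lemma crit_params_of_degenerate:
  assumes p: "p \<ge> 2" and deg: "ell2 p \<beta>2 (crit_point p) = 0" "ell1 p \<beta>1 \<beta>2 (crit_point p) = 0"
  shows "\<beta>1 = beta1_crit p" and "\<beta>2 = beta2_crit p"
proof -
  have "\<beta>2 * (real p * (real p - 1)) * (crit_point p ^ (p - 1) * (1 - crit_point p)) = 1"
    using deg(1) crit_point_bounds[OF p] by (simp add: ell2_def)
  hence "(\<beta>2 - beta2_crit p) * ((real p * (real p - 1)) * (crit_point p ^ (p - 1) * (1 - crit_point p))) = 0"
    using beta2_crit_eq[OF p] by (simp add: algebra_simps)
  moreover have "(real p * (real p - 1)) * (crit_point p ^ (p - 1) * (1 - crit_point p)) \<noteq> 0"
    using p crit_point_bounds[OF p] by simp
  ultimately show "\<beta>2 = beta2_crit p" by (metis mult_eq_0_iff right_minus_eq)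
  thus "\<beta>1 = beta1_crit p" using deg(2) ell1_crit[OF p] by (simp add: ell1_def)
qed

lemma ell_quotient_nondegenerate:
  assumes "x \<in> maximizers p \<beta>1 \<beta>2" "0 < x" "x < 1" "p \<ge> 2"
  shows "((\<lambda>y. (ell p \<beta>1 \<beta>2 y - ell p \<beta>1 \<beta>2 x) / (y - x)\<^sup>2) \<longlongrightarrow> ell2 p \<beta>2 x / 2) (at x)"
proof -
  have "((\<lambda>y. ell2 p \<beta>2 y / (y - x) ^ 0) \<longlongrightarrow> ell2 p \<beta>2 x) (at x)"
    using isCont_ell2[OF assms(2,3), of p \<beta>2] by (simp add: isCont_def)
  from ell_quotient_tendsto[OF assms(2-4) maximizer_deriv_zero[OF assms(1-3)] this]
  show ?thesis by (simp add: power2_eq_square)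
qed

lemma ell2_maximizer_nonpos:
  assumes "x \<in> maximizers p \<beta>1 \<beta>2" "0 < x" "x < 1" "p \<ge> 2"
  shows "ell2 p \<beta>2 x \<le> 0"
proof -
  have ev: "eventually (\<lambda>y. y \<in> {0<..<1}) (at x)"
    using assms by (intro eventually_at_in_open') auto
  note ell_quotient_nondegenerate[OF assms]
  moreover have "eventually (\<lambda>y. (ell p \<beta>1 \<beta>2 y - ell p \<beta>1 \<beta>2 x) / (y - x)\<^sup>2 \<le> 0) (at x)"
    using ev by eventually_elim (use assms(1) in \<open>auto simp: maximizers_def divide_le_0_iff\<close>)
  ultimately have "ell2 p \<beta>2 x / 2 \<le> 0" by (rule tendsto_upperbound) simp
  thus ?thesis by simp
qed

text \<open>At a maximizer the third-order term must vanish together with the second-order one.\<close>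

lemma degenerate_maximizer_crit:
  assumes x: "x \<in> maximizers p \<beta>1 \<beta>2" "0 < x" "x < 1" and p: "p \<ge> 2" and zero: "ell2 p \<beta>2 x = 0"
  shows "(\<beta>1, \<beta>2) = (beta1_crit p, beta2_crit p)"
proof -
  define K where "K = \<beta>2 * (real p * (real p - 1))"
  define w where "w = (\<lambda>y::real. y ^ (p - 1) * (1 - y))"
  define d where "d = - real p * x ^ (p - 2) * (x - crit_point p)"
  \<comment> \<open>Degeneracy means K w(x) = 1, so \<open>ell2\<close> becomes K (w(y) - w(x)) / (y
    (1 - y)), and its slope at x is governed by the derivative of the bump w.\<close>
  have Kw: "K * w x = 1" using zero x by (simp add: ell2_def K_def w_def)
  hence K: "K \<noteq> 0" by auto
  have "((\<lambda>y. (w y - w x) / (y - x)) \<longlongrightarrow> d) (at x)"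
    using DERIV_bump[OF p, of x] by (simp add: has_field_derivative_iff w_def d_def)
  hence "((\<lambda>y. K * ((w y - w x) / (y - x)) / (y * (1 - y))) \<longlongrightarrow> K * d / (x * (1 - x))) (at x)"
    using x by (intro tendsto_intros) auto
  moreover have "K * ((w y - w x) / (y - x)) / (y * (1 - y)) = ell2 p \<beta>2 y / (y - x) ^ 1" for y
  proof -
    have "K * (w y - w x) = K * w y - 1" using Kw by (simp add: right_diff_distrib)
    moreover have "ell2 p \<beta>2 y = (K * w y - 1) / (y * (1 - y))" by (simp only: ell2_def K_def w_def)
    ultimately show ?thesis by (simp add: mult.commute)
  qed
  ultimately have "((\<lambda>y. ell2 p \<beta>2 y / (y - x) ^ 1) \<longlongrightarrow> K * d / (x * (1 - x))) (at x)"
    by simp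
  from ell_quotient_tendsto[OF x(2,3) p maximizer_deriv_zero[OF x] this]
  have lim: "((\<lambda>y. (ell p \<beta>1 \<beta>2 y - ell p \<beta>1 \<beta>2 x) / (y - x) ^ 3) \<longlongrightarrow> K * d / (x * (1 - x)) / 6) (at x)"
    by (simp add: numeral_3_eq_3)
  have max: "ell p \<beta>1 \<beta>2 y \<le> ell p \<beta>1 \<beta>2 x" if "y \<in> {0<..<1}" for y
    using x(1) that by (auto simp: maximizers_def)
  have r: "eventually (\<lambda>y. y \<in> {0<..<1} \<and> y > x) (at_right x)" "eventually (\<lambda>y. y \<in> {0<..<1} \<and> y < x) (at_left x)"
    using eventually_at_right_real[OF x(3)] eventually_at_left_real[OF x(2)] x
    by (auto elim!: eventually_mono)
  \<comment> \<open>At a maximizer the numerator is nonpositive on both sides, while (y - x)^3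
    changes sign, so the one-sided limits have opposite signs and the cubic coefficient is
    0.\<close>
  have "K * d / (x * (1 - x)) / 6 \<le> 0"
  proof (rule tendsto_upperbound)
    show "((\<lambda>y. (ell p \<beta>1 \<beta>2 y - ell p \<beta>1 \<beta>2 x) / (y - x) ^ 3) \<longlongrightarrow> K * d / (x * (1 - x)) / 6) (at_right x)"
      using lim by (simp add: filterlim_at_split)
    show "eventually (\<lambda>y. (ell p \<beta>1 \<beta>2 y - ell p \<beta>1 \<beta>2 x) / (y - x) ^ 3 \<le> 0) (at_right x)"
      using r(1) by eventually_elim (use max in \<open>auto simp: divide_le_0_iff\<close>)
  qed simp
  moreover have "K * d / (x * (1 - x)) / 6 \<ge> 0"
  proof (rule tendsto_lowerbound)
    show "((\<lambda>y. (ell p \<beta>1 \<beta>2 y - ell p \<beta>1 \<beta>2 x) / (y - x) ^ 3) \<longlongrightarrow> K * d / (x * (1 - x)) / 6) (at_left x)"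
      using lim by (simp add: filterlim_at_split)
    show "eventually (\<lambda>y. (ell p \<beta>1 \<beta>2 y - ell p \<beta>1 \<beta>2 x) / (y - x) ^ 3 \<ge> 0) (at_left x)"
      using r(2) by eventually_elim (use max in \<open>auto simp: zero_le_divide_iff power_le_zero_eq\<close>)
  qed simp
  ultimately have "K * d / (x * (1 - x)) / 6 = 0" by linarith
  hence "d = 0" using K x by simp
  hence "x = crit_point p" using x p by (simp add: d_def)
  thus ?thesis using crit_params_of_degenerate[OF p, of \<beta>2 \<beta>1] zero maximizer_deriv_zero[OF x] by simp
qed

section \<open>Global maximum and quartic coefficient at the critical point\<close>

lemma maximum_of_deriv_sign:
  fixes f f' :: "real \<Rightarrow> real"
  assumes der: "\<And>z. a < z \<Longrightarrow> z < b \<Longrightarrow> (f has_field_derivative f' z) (at z)"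
    and sign: "\<And>z. a < z \<Longrightarrow> z < b \<Longrightarrow> f' z * (z - c) \<le> 0"
    and "a < c" "c < b" "a < y" "y < b"
  shows "f y \<le> f c"
proof -
  consider "y = c" | "y < c" | "c < y" by linarith
  thus ?thesis
  proof cases
    case 2
    then obtain z where z: "y < z" "z < c" "f c - f y = (c - y) * f' z"
      using MVT2[of y c f f'] der assms by (metis le_less_trans less_le_trans)
    have "f' z * (z - c) \<le> 0" using z assms by (intro sign) auto
    hence "f' z \<ge> 0" using z by (simp add: mult_le_0_iff)
    hence "(c - y) * f' z \<ge> 0" using z by simp
    thus ?thesis using z(3) by simp
  next
    case 3
    then obtain z where z: "c < z" "z < y" "f y - f c = (y - c) * f' z"
      using MVT2[of c y f f'] der assms by (metis le_less_trans less_le_trans)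
    have "f' z * (z - c) \<le> 0" using z assms by (intro sign) auto
    hence "f' z \<le> 0" using z by (simp add: mult_le_0_iff)
    hence "(y - c) * f' z \<le> 0" using z by (simp add: mult_nonneg_nonpos)
    thus ?thesis using z(3) by simp
  qed simp
qed

lemma bump_le:
  assumes "p \<ge> 2" "0 < y" "y < 1"
  shows "y ^ (p - 1) * (1 - y) \<le> crit_point p ^ (p - 1) * (1 - crit_point p)"
proof (rule maximum_of_deriv_sign[where a = 0 and b = 1 and f = "\<lambda>y. y ^ (p - 1) * (1 - y)", OF DERIV_bump[OF assms(1)]])
  fix z :: real assume "0 < z"
  thus "- real p * z ^ (p - 2) * (z - crit_point p) * (z - crit_point p) \<le> 0"
    by (simp add: mult.assoc)
qed (use assms crit_point_bounds in auto)

lemma ell2_crit_nonpos: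
  assumes "p \<ge> 2" "0 < y" "y < 1"
  shows "ell2 p (beta2_crit p) y \<le> 0"
proof -
  have "beta2_crit p * (real p * (real p - 1)) * (y ^ (p - 1) * (1 - y)) \<le>
      beta2_crit p * (real p * (real p - 1)) * (crit_point p ^ (p - 1) * (1 - crit_point p))"
    using assms by (intro mult_left_mono bump_le) (auto simp: beta2_crit_def)
  thus ?thesis unfolding ell2_def beta2_crit_eq[OF assms(1)] using assms by (simp add: divide_le_0_iff)
qed

text \<open>At the critical parameters \<open>ell\<close> is concave and stationary at
  \<open>crit_point\<close>. The phase-curve assumption provides a unique maximizer there without
  saying where it is; this locates it.\<close>

lemma ell_crit_le:
  assumes p: "p \<ge> 2" and y: "0 < y" "y < 1"
  shows "ell p (beta1_crit p) (beta2_crit p) y \<le> ell p (beta1_crit p) (beta2_crit p) (crit_point p)"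
proof (rule maximum_of_deriv_sign[where a = 0 and b = 1 and f = "ell p (beta1_crit p) (beta2_crit p)"
      and f' = "ell1 p (beta1_crit p) (beta2_crit p)"])
  let ?c = "crit_point p"
  let ?f = "ell1 p (beta1_crit p) (beta2_crit p)"
  fix z :: real assume z: "0 < z" "z < 1"
  have D: "(?f has_field_derivative ell2 p (beta2_crit p) t) (at t)" if "0 < t" "t < 1" for t
    using DERIV_ell1[OF that p] .
  consider "z = ?c" | "z < ?c" | "?c < z" by linarith
  thus "?f z * (z - ?c) \<le> 0"
  proof cases
    case 2
    then obtain t where t: "z < t" "t < ?c" "?f ?c - ?f z = (?c - z) * ell2 p (beta2_crit p) t"
      using MVT2[of z ?c ?f "ell2 p (beta2_crit p)"] D z crit_point_bounds[OF p] by (metis le_less_trans less_le_trans)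
    have "ell2 p (beta2_crit p) t \<le> 0" using t z crit_point_bounds[OF p] by (intro ell2_crit_nonpos p) auto
    hence "(?c - z) * ell2 p (beta2_crit p) t \<le> 0" using 2 by (intro mult_nonneg_nonpos) auto
    hence "?f z \<ge> 0" using t ell1_crit[OF p] by simp
    thus ?thesis using 2 by (simp add: mult_nonneg_nonpos)
  next
    case 3
    then obtain t where t: "?c < t" "t < z" "?f z - ?f ?c = (z - ?c) * ell2 p (beta2_crit p) t"
      using MVT2[of ?c z ?f "ell2 p (beta2_crit p)"] D z crit_point_bounds[OF p] by (metis le_less_trans less_le_trans)
    have "ell2 p (beta2_crit p) t \<le> 0" using t z crit_point_bounds[OF p] by (intro ell2_crit_nonpos p) auto
    hence "?f z \<le> 0" using t ell1_crit[OF p] by (simp add: mult_nonneg_nonpos)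
    thus ?thesis using 3 by (simp add: mult_nonpos_nonneg)
  qed simp
qed (use y crit_point_bounds[OF p] in \<open>auto intro: DERIV_ell\<close>)

text \<open>The derivative of the bump w has a simple zero at c, so \<open>ell2\<close> vanishes to
  second order and \<open>ell\<close> deviates to fourth order. With K w(c) = 1 the coefficient is
  -p / (24 (c (1 - c))^2), where c (1 - c) = (p - 1) / p^2.\<close>

lemma ell_quotient_crit:
  assumes p: "p \<ge> 2"
  defines "c \<equiv> crit_point p"
  shows "((\<lambda>y. (ell p (beta1_crit p) (beta2_crit p) y - ell p (beta1_crit p) (beta2_crit p) c) / (y - c) ^ 4)
          \<longlongrightarrow> - (real p ^ 5 / (24 * (real p - 1)\<^sup>2))) (at c)"
proof -
  have c: "0 < c" "c < 1" using crit_point_bounds[OF p] by (simp_all add: c_def)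
  define K where "K = beta2_crit p * (real p * (real p - 1))"
  define w where "w = (\<lambda>y::real. y ^ (p - 1) * (1 - y))"
  define L where "L = - real p * c ^ (p - 2)"
  have Kw: "K * w c = 1" using beta2_crit_eq[OF p] by (simp add: K_def w_def c_def)
  have "((\<lambda>y. - real p * y ^ (p - 2)) \<longlongrightarrow> L) (at c)"
    unfolding L_def by (intro tendsto_intros)
  hence "((\<lambda>y. - real p * y ^ (p - 2) * (y - c) / (y - c) ^ 1) \<longlongrightarrow> L) (at c)"
    by (rule Lim_transform_eventually) (rule eventually_mono[OF eventually_neq_at_within[of c]], simp)
  from quotient_power_tendsto_of_deriv[OF _ _ this, of w] DERIV_bump[OF p]
  have lw: "((\<lambda>y. (w y - w c) / (y - c) ^ 2) \<longlongrightarrow> L / 2) (at c)"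
    by (auto simp: w_def c_def numeral_2_eq_2 intro!: always_eventually continuous_intros)
  have "((\<lambda>y. K * ((w y - w c) / (y - c) ^ 2) / (y * (1 - y))) \<longlongrightarrow> K * (L / 2) / (c * (1 - c))) (at c)"
    by (rule tendsto_divide[OF tendsto_mult[OF tendsto_const lw]]) (use c in \<open>auto intro!: tendsto_intros\<close>)
  moreover have "K * ((w y - w c) / (y - c) ^ 2) / (y * (1 - y)) = ell2 p (beta2_crit p) y / (y - c) ^ 2" for y
  proof -
    have "K * (w y - w c) = K * w y - 1" using Kw by (simp add: right_diff_distrib)
    moreover have "ell2 p (beta2_crit p) y = (K * w y - 1) / (y * (1 - y))" by (simp only: ell2_def K_def w_def)
    ultimately show ?thesis by (simp add: mult.commute)
  qed
  ultimately have "((\<lambda>y. ell2 p (beta2_crit p) y / (y - c) ^ 2) \<longlongrightarrow> K * (L / 2) / (c * (1 - c))) (at c)"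
    by simp
  from ell_quotient_tendsto[OF c p ell1_crit[OF p, folded c_def] this]
  have "((\<lambda>y. (ell p (beta1_crit p) (beta2_crit p) y - ell p (beta1_crit p) (beta2_crit p) c) / (y - c) ^ 4)
          \<longlongrightarrow> K * (L / 2) / (c * (1 - c)) / 12) (at c)"
    by simp
  also have "K * (L / 2) / (c * (1 - c)) / 12 = - (real p ^ 5 / (24 * (real p - 1)\<^sup>2))"
  proof -
    have K: "K = 1 / w c" using Kw by (metis mult_zero_right nonzero_eq_divide_eq zero_neq_one)
    have "p - 1 = Suc (p - 2)" using p by simp
    hence "c ^ (p - 1) = c ^ (p - 2) * c" by (simp only: power_Suc2)
    hence "w c = c ^ (p - 2) * (c * (1 - c))" by (simp add: w_def)
    hence "K * (L / 2) / (c * (1 - c)) / 12 = - real p / (24 * (c * (1 - c))\<^sup>2)"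
      unfolding K L_def using c by (simp add: power2_eq_square)
    also have "\<dots> = - real p / (24 * ((real p - 1) / (real p)\<^sup>2)\<^sup>2)"
    proof -
      have "c * (1 - c) = (real p - 1) / (real p)\<^sup>2"
        using p by (simp add: c_def crit_point_def field_simps power2_eq_square)
      thus ?thesis by simp
    qed
    also have "\<dots> = - (real p ^ 5 / (24 * (real p - 1)\<^sup>2))"
      using p by (simp add: power_divide power2_eq_square eval_nat_numeral)
    finally show ?thesis .
  qed
  finally show ?thesis .
qed

section \<open>Derivatives of the limit\<close>

text \<open>On [0, 1] a change of parameters moves \<open>ell\<close> by at most the l1 distance of
  the parameters. If that is below half the gap, no point far from x0 can catch up with x0.\<close>

lemma maximizers_near:
  assumes max: "maximizers p \<beta>1 \<beta>2 = {x0}" and "\<delta> > 0"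
  obtains \<epsilon> where "\<epsilon> > 0"
    "\<And>b1 b2 x. \<bar>b1 - \<beta>1\<bar> + \<bar>b2 - \<beta>2\<bar> < \<epsilon> \<Longrightarrow> x \<in> maximizers p b1 b2 \<Longrightarrow> \<bar>x - x0\<bar> < \<delta>"
proof -
  obtain \<eta> where \<eta>: "\<eta> > 0"
    "\<And>y. y \<in> {0..1} \<Longrightarrow> \<bar>y - x0\<bar> \<ge> \<delta> \<Longrightarrow> ell p \<beta>1 \<beta>2 y \<le> ell_max p \<beta>1 \<beta>2 - \<eta>"
    using ell_max_gap[OF assms(2), of p \<beta>1 \<beta>2] max by (metis singletonD)
  have x0: "x0 \<in> {0..1}" "ell p \<beta>1 \<beta>2 x0 = ell_max p \<beta>1 \<beta>2"
    using max ell_max_eq[of x0 p \<beta>1 \<beta>2] by (auto simp: maximizers_def)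
  have diff: "\<bar>ell p b1 b2 y - ell p \<beta>1 \<beta>2 y\<bar> \<le> \<bar>b1 - \<beta>1\<bar> + \<bar>b2 - \<beta>2\<bar>" if "y \<in> {0..1}" for b1 b2 y
  proof -
    have "ell p b1 b2 y - ell p \<beta>1 \<beta>2 y = (b1 - \<beta>1) * y + (b2 - \<beta>2) * y ^ p"
      by (simp add: ell_def algebra_simps)
    hence "\<bar>ell p b1 b2 y - ell p \<beta>1 \<beta>2 y\<bar> \<le> \<bar>b1 - \<beta>1\<bar> * \<bar>y\<bar> + \<bar>b2 - \<beta>2\<bar> * \<bar>y ^ p\<bar>"
      by (metis abs_mult abs_triangle_ineq)
    also have "\<dots> \<le> \<bar>b1 - \<beta>1\<bar> * 1 + \<bar>b2 - \<beta>2\<bar> * 1"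
      using that by (intro add_mono mult_left_mono) (auto simp: power_le_one)
    finally show ?thesis by simp
  qed
  show thesis
  proof (rule that[of "\<eta> / 2"])
    fix b1 b2 x assume b: "\<bar>b1 - \<beta>1\<bar> + \<bar>b2 - \<beta>2\<bar> < \<eta> / 2" and x: "x \<in> maximizers p b1 b2"
    have x01: "x \<in> {0..1}" and "ell p b1 b2 x0 \<le> ell p b1 b2 x" using x x0 by (auto simp: maximizers_def)
    hence "ell p \<beta>1 \<beta>2 x > ell_max p \<beta>1 \<beta>2 - \<eta>"
      using diff[OF x01, of b1 b2] diff[OF x0(1), of b1 b2] b x0(2) by linarith
    thus "\<bar>x - x0\<bar> < \<delta>" using \<eta>(2)[OF x01] by linarith
  qed (use \<eta> in simp)
qed

text \<open>Envelope theorem: comparing with the maximizers for the old and for the new parameter squeezes the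
  difference quotient between two values of \<open>y ^ p\<close>.\<close>

lemma DERIV_ell_max_2:
  assumes max: "maximizers p \<beta>1 \<beta>2 = {x}"
  shows "((\<lambda>b2. ell_max p \<beta>1 b2) has_field_derivative x ^ p) (at \<beta>2)"
  unfolding has_field_derivative_iff
proof (rule tendstoI)
  fix e :: real assume "e > 0"
  have x: "x \<in> {0..1}" "ell p \<beta>1 \<beta>2 x = ell_max p \<beta>1 \<beta>2"
    using max ell_max_eq[of x p \<beta>1 \<beta>2] by (auto simp: maximizers_def)
  have "isCont (\<lambda>y. y ^ p) x" by (intro continuous_intros)
  then obtain \<delta> where \<delta>: "\<delta> > 0" "\<And>y. \<bar>y - x\<bar> < \<delta> \<Longrightarrow> \<bar>y ^ p - x ^ p\<bar> < e"
    using \<open>e > 0\<close> unfolding continuous_at_eps_delta dist_real_def by blast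
  obtain \<epsilon> where \<epsilon>: "\<epsilon> > 0"
    "\<And>b1 b2 x'. \<bar>b1 - \<beta>1\<bar> + \<bar>b2 - \<beta>2\<bar> < \<epsilon> \<Longrightarrow> x' \<in> maximizers p b1 b2 \<Longrightarrow> \<bar>x' - x\<bar> < \<delta>"
    using maximizers_near[OF max \<delta>(1)] by blast
  have "dist ((ell_max p \<beta>1 b2 - ell_max p \<beta>1 \<beta>2) / (b2 - \<beta>2)) (x ^ p) < e"
    if b2: "b2 \<noteq> \<beta>2" "\<bar>b2 - \<beta>2\<bar> < \<epsilon>" for b2
  proof -
    obtain z where z: "z \<in> maximizers p \<beta>1 b2" using maximizers_nonempty by blast
    have z': "z \<in> {0..1}" "ell p \<beta>1 b2 z = ell_max p \<beta>1 b2"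
      using z ell_max_eq[OF z] by (auto simp: maximizers_def)
    have zp: "\<bar>z ^ p - x ^ p\<bar> < e" using \<epsilon>(2)[of \<beta>1 b2 z] z b2 by (intro \<delta>(2)) auto
    define t where "t = b2 - \<beta>2"
    have shift: "ell p \<beta>1 b2 y = ell p \<beta>1 \<beta>2 y + t * y ^ p" for y
      by (simp add: ell_def t_def algebra_simps)
    define Q where "Q = (ell_max p \<beta>1 b2 - ell_max p \<beta>1 \<beta>2) / t"
    have "t \<noteq> 0" using b2 by (simp add: t_def)
    hence Q: "ell_max p \<beta>1 b2 - ell_max p \<beta>1 \<beta>2 = t * Q" by (simp add: Q_def)
    \<comment> \<open>x competes at the new parameter and z at the old one. Multiplied by
      \<open>t\<close> the comparisons hold for either sign of \<open>t\<close>; dividing puts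
      \<open>Q\<close> between x^p and z^p.\<close>
    have "t * x ^ p \<le> t * Q"
      using ell_le_max[OF x(1), of p \<beta>1 b2] x(2) shift[of x] Q by linarith
    moreover have "t * Q \<le> t * z ^ p"
      using ell_le_max[OF z'(1), of p \<beta>1 \<beta>2] z'(2) shift[of z] Q by linarith
    ultimately have "\<bar>Q - x ^ p\<bar> < e"
      using zp \<open>t \<noteq> 0\<close> by (cases "t > 0") (auto simp: mult_le_cancel_left)
    thus ?thesis by (simp add: Q_def t_def dist_real_def)
  qed
  thus "eventually (\<lambda>b2. dist ((ell_max p \<beta>1 b2 - ell_max p \<beta>1 \<beta>2) / (b2 - \<beta>2)) (x ^ p) < e) (at \<beta>2)"
    using \<epsilon>(1) by (auto simp: eventually_at dist_real_def)
qed

text \<open>In \<open>ell1\<close> the parameter b1 is a mere additive constant, so interior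
  maximizers solve \<open>\<phi>\<close> x = b1 with one fixed function \<open>\<phi>\<close>, which
  is increasing near x0. As maximizers for nearby b1 stay near x0, they are unique there and X
  inverts \<open>\<phi>\<close> locally.\<close>

lemma maximizer_function:
  assumes max: "maximizers p \<beta>1 \<beta>2 = {x0}" and x0: "0 < x0" "x0 < 1" and p: "p \<ge> 2" and neg: "ell2 p \<beta>2 x0 < 0"
  obtains X where "eventually (\<lambda>b1. maximizers p b1 \<beta>2 = {X b1}) (nhds \<beta>1)" "X \<beta>1 = x0"
    "(X has_field_derivative inverse (- ell2 p \<beta>2 x0)) (at \<beta>1)"
proof -
  define \<phi> where "\<phi> = (\<lambda>y. - ell1 p 0 \<beta>2 y)"
  have ell1: "ell1 p b1 \<beta>2 y = b1 - \<phi> y" for b1 y by (simp add: ell1_def \<phi>_def)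
  have D\<phi>: "(\<phi> has_field_derivative - ell2 p \<beta>2 y) (at y)" if "0 < y" "y < 1" for y
    unfolding \<phi>_def using DERIV_ell1[OF that p] by (intro DERIV_minus)
  have "(ell2 p \<beta>2 \<longlongrightarrow> ell2 p \<beta>2 x0) (nhds x0)"
    using isCont_ell2[OF x0] by (simp only: isCont_def tendsto_at_iff_tendsto_nhds)
  hence "eventually (\<lambda>y. ell2 p \<beta>2 y < 0) (nhds x0)" using neg by (rule order_tendstoD)
  moreover have "eventually (\<lambda>y. y \<in> {0<..<1}) (nhds x0)" using x0 by (intro eventually_nhds_in_open) auto
  ultimately have "eventually (\<lambda>y. ell2 p \<beta>2 y < 0 \<and> y \<in> {0<..<1}) (nhds x0)" by (rule eventually_conj)
  then obtain \<delta> where \<delta>: "\<delta> > 0" "\<And>y. \<bar>y - x0\<bar> < \<delta> \<Longrightarrow> ell2 p \<beta>2 y < 0 \<and> 0 < y \<and> y < 1"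
    unfolding eventually_nhds_metric dist_real_def by auto
  have inj: "\<phi> y < \<phi> z" if "\<bar>y - x0\<bar> < \<delta>" "\<bar>z - x0\<bar> < \<delta>" "y < z" for y z
  proof (rule DERIV_pos_imp_increasing[OF that(3)])
    fix t assume "y \<le> t" "t \<le> z"
    hence "\<bar>t - x0\<bar> < \<delta>" using that by (auto simp: abs_less_iff)
    from \<delta>(2)[OF this] show "\<exists>d. (\<phi> has_field_derivative d) (at t) \<and> 0 < d"
      by (intro exI[of _ "- ell2 p \<beta>2 t"] conjI D\<phi>) auto
  qed
  have near: "\<exists>\<epsilon>>0. \<forall>b1 x. \<bar>b1 - \<beta>1\<bar> < \<epsilon> \<longrightarrow> x \<in> maximizers p b1 \<beta>2 \<longrightarrow> \<bar>x - x0\<bar> < d" if d: "d > 0" for d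
  proof (rule maximizers_near[OF max d], goal_cases)
    case (1 \<epsilon>)
    have "\<bar>x - x0\<bar> < d" if "\<bar>b1 - \<beta>1\<bar> < \<epsilon>" "x \<in> maximizers p b1 \<beta>2" for b1 x
      using that by (intro 1(2)[of b1 \<beta>2]) auto
    thus ?case using 1(1) by blast
  qed
  obtain \<epsilon> where \<epsilon>: "\<epsilon> > 0" "\<And>b1 x. \<bar>b1 - \<beta>1\<bar> < \<epsilon> \<Longrightarrow> x \<in> maximizers p b1 \<beta>2 \<Longrightarrow> \<bar>x - x0\<bar> < \<delta>"
    using near[OF \<delta>(1)] by blast
  have crit: "\<phi> x = b1" if "\<bar>b1 - \<beta>1\<bar> < \<epsilon>" "x \<in> maximizers p b1 \<beta>2" for b1 x
    using maximizer_deriv_zero[OF that(2)] \<delta>(2)[OF \<epsilon>(2)[OF that]] by (simp add: ell1)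
  define X where "X = (\<lambda>b1. SOME x. x \<in> maximizers p b1 \<beta>2)"
  have X: "X b1 \<in> maximizers p b1 \<beta>2" for b1
  proof -
    have "\<exists>x. x \<in> maximizers p b1 \<beta>2" using maximizers_nonempty by blast
    thus ?thesis unfolding X_def by (rule someI_ex)
  qed
  have uniq: "maximizers p b1 \<beta>2 = {X b1}" if b1: "\<bar>b1 - \<beta>1\<bar> < \<epsilon>" for b1
  proof -
    have "x = X b1" if "x \<in> maximizers p b1 \<beta>2" for x
    proof -
      have "\<not> x < X b1" using inj[OF \<epsilon>(2)[OF b1 that] \<epsilon>(2)[OF b1 X]] crit[OF b1 that] crit[OF b1 X] by linarith
      moreover have "\<not> X b1 < x" using inj[OF \<epsilon>(2)[OF b1 X] \<epsilon>(2)[OF b1 that]] crit[OF b1 that] crit[OF b1 X] by linarith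
      ultimately show ?thesis by linarith
    qed
    thus ?thesis using X[of b1] by blast
  qed
  have X0: "X \<beta>1 = x0" using X[of \<beta>1] max by simp
  \<comment> \<open>The inverse function rule wants X continuous; this uses \<open>near\<close> at
    every radius, not just the one on which \<open>\<phi>\<close> is monotone.\<close>
  have "isCont X \<beta>1"
    unfolding continuous_at_eps_delta dist_real_def X0 using near X by meson
  have "(X has_field_derivative inverse (- ell2 p \<beta>2 x0)) (at \<beta>1)"
  proof (rule DERIV_inverse_function[where f = \<phi> and a = "\<beta>1 - \<epsilon>" and b = "\<beta>1 + \<epsilon>"])
    show "(\<phi> has_field_derivative - ell2 p \<beta>2 x0) (at (X \<beta>1))" unfolding X0 by (rule D\<phi>[OF x0])
    show "\<phi> (X y) = y" if "\<beta>1 - \<epsilon> < y" "y < \<beta>1 + \<epsilon>" for y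
      using that by (intro crit X) (auto simp: abs_less_iff)
  qed (use neg \<epsilon>(1) \<open>isCont X \<beta>1\<close> in auto)
  moreover have "eventually (\<lambda>b1. maximizers p b1 \<beta>2 = {X b1}) (nhds \<beta>1)"
    unfolding eventually_nhds_metric dist_real_def using \<epsilon>(1) uniq by blast
  ultimately show thesis using that X0 by blast
qed

lemma psi_lim_eq: "psi_lim p \<beta>1 \<beta>2 = ell_max p \<beta>1 \<beta>2"
  unfolding psi_lim_def using psi_tendsto by (rule limI)

text \<open>The inner derivative is needed for all b1 near \<open>\<beta>1\<close>, hence uniqueness
  of the maximizer along that neighbourhood. It equals X(b1)^p there, and the chain rule
  finishes.\<close>

lemma
  assumes max: "maximizers p \<beta>1 \<beta>2 = {x0}" and x0: "0 < x0" "x0 < 1" and p: "p \<ge> 2" and neg: "ell2 p \<beta>2 x0 < 0"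
  shows mixed_partial_exists_psi_lim: "mixed_partial_exists (psi_lim p) \<beta>1 \<beta>2"
    and mixed_partial_psi_lim: "mixed_partial (psi_lim p) \<beta>1 \<beta>2 = real p * x0 ^ (p - 1) / \<bar>ell2 p \<beta>2 x0\<bar>"
proof -
  obtain X where X: "eventually (\<lambda>b1. maximizers p b1 \<beta>2 = {X b1}) (nhds \<beta>1)" "X \<beta>1 = x0"
    "(X has_field_derivative inverse (- ell2 p \<beta>2 x0)) (at \<beta>1)"
    using maximizer_function[OF assms] by blast
  have D2: "eventually (\<lambda>b1. ((\<lambda>b2. psi_lim p b1 b2) has_field_derivative X b1 ^ p) (at \<beta>2)) (nhds \<beta>1)"
    using X(1) by eventually_elim (simp add: psi_lim_eq DERIV_ell_max_2)
  have "((\<lambda>b1. X b1 ^ p) has_field_derivative real p * x0 ^ (p - 1) / \<bar>ell2 p \<beta>2 x0\<bar>) (at \<beta>1)"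
    using DERIV_power[OF X(3), of p] neg by (simp add: X(2) divide_inverse mult_ac)
  moreover have "eventually (\<lambda>b1. deriv (\<lambda>b2. psi_lim p b1 b2) \<beta>2 = X b1 ^ p) (nhds \<beta>1)"
    using D2 by eventually_elim (rule DERIV_imp_deriv)
  ultimately have D12: "((\<lambda>b1. deriv (\<lambda>b2. psi_lim p b1 b2) \<beta>2) has_field_derivative real p * x0 ^ (p - 1) / \<bar>ell2 p \<beta>2 x0\<bar>) (at \<beta>1)"
    by (subst DERIV_cong_ev[OF refl _ refl]) auto
  show "mixed_partial_exists (psi_lim p) \<beta>1 \<beta>2"
    unfolding mixed_partial_exists_def
  proof
    show "eventually (\<lambda>b1. (\<lambda>b2. psi_lim p b1 b2) field_differentiable (at \<beta>2)) (nhds \<beta>1)"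
      using D2 by eventually_elim (auto simp: field_differentiable_def)
    show "(\<lambda>b1. deriv (\<lambda>b2. psi_lim p b1 b2) \<beta>2) field_differentiable (at \<beta>1)"
      using D12 by (auto simp: field_differentiable_def)
  qed
  show "mixed_partial (psi_lim p) \<beta>1 \<beta>2 = real p * x0 ^ (p - 1) / \<bar>ell2 p \<beta>2 x0\<bar>"
    unfolding mixed_partial_def using D12 by (rule DERIV_imp_deriv)
qed

section \<open>Limits of the mixed partial derivatives\<close>

lemma mixed_partial_psi_cov: "n \<ge> 1 \<Longrightarrow> mixed_partial (psi p n) \<beta>1 \<beta>2 = real n * gibbs_cov p n \<beta>1 \<beta>2"
  by (simp add: mixed_partial_psi gibbs_cov_def)

text \<open>The case m = 1 with a = |ell''| / 2. Since Gamma (3/2) = Gamma (1/2) / 2, the moment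
  ratio is 1 / (2 a), the Gaussian variance 1 / |ell''|.\<close>

lemma mixed_partial_psi_tendsto_unique:
  assumes max: "maximizers p \<beta>1 \<beta>2 = {x}" and x: "0 < x" "x < 1" and p: "p \<ge> 2" and neg: "ell2 p \<beta>2 x < 0"
  shows "(\<lambda>n. mixed_partial (psi p n) \<beta>1 \<beta>2) \<longlonglongrightarrow> real p * x ^ (p - 1) / \<bar>ell2 p \<beta>2 x\<bar>"
proof -
  define a where "a = - ell2 p \<beta>2 x / 2"
  have a: "a > 0" using neg by (simp add: a_def)
  have "((\<lambda>y. (ell p \<beta>1 \<beta>2 y - ell p \<beta>1 \<beta>2 x) / (y - x) ^ (2 * 1)) \<longlongrightarrow> - a) (at x)"
    using ell_quotient_nondegenerate[of x p \<beta>1 \<beta>2] max x p by (simp add: a_def)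
  from gibbs_cov_unique_maximizer[OF max x order_refl a this]
  have "(\<lambda>n. real n powr 1 * gibbs_cov p n \<beta>1 \<beta>2) \<longlonglongrightarrow> real p * x ^ (p - 1) * (a powr - 1 * Gamma (3 / 2) / Gamma (1 / 2))"
    by simp
  also have "Gamma (3 / 2 :: real) = 1 / 2 * Gamma (1 / 2)"
  proof -
    have "(1 / 2 :: real) \<notin> \<int>\<^sub>\<le>\<^sub>0" by (auto dest: nonpos_Ints_nonpos)
    from Gamma_plus1[OF this] show ?thesis by simp
  qed
  also have "real p * x ^ (p - 1) * (a powr - 1 * (1 / 2 * Gamma (1 / 2)) / Gamma (1 / 2)) = real p * x ^ (p - 1) / \<bar>ell2 p \<beta>2 x\<bar>"
  proof -
    have "Gamma (1 / 2 :: real) \<noteq> 0" using Gamma_real_pos[of "1 / 2"] by linarith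
    thus ?thesis using a neg by (simp add: powr_minus a_def field_simps)
  qed
  finally show ?thesis
    by (rule Lim_transform_eventually)
       (auto intro!: eventually_sequentiallyI[of 1] simp: mixed_partial_psi_cov)
qed

lemma mixed_partial_psi_tendsto_two:
  assumes max: "maximizers p \<beta>1 \<beta>2 = {x1, x2}" and x: "0 < x1" "x1 < x2" "x2 < 1" and p: "p \<ge> 2"
    and neg: "ell2 p \<beta>2 x1 < 0" "ell2 p \<beta>2 x2 < 0"
  defines "S \<equiv> \<lambda>x. sqrt (x * (1 - x) * \<bar>ell2 p \<beta>2 x\<bar>)"
  shows "(\<lambda>n. 1 / real n * mixed_partial (psi p n) \<beta>1 \<beta>2) \<longlonglongrightarrow> (x1 ^ p - x2 ^ p) * (x1 - x2) * S x1 * S x2 / (S x1 + S x2)\<^sup>2"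
proof -
  have "(\<lambda>n. gibbs_cov p n \<beta>1 \<beta>2) \<longlonglongrightarrow> (x1 ^ p - x2 ^ p) * (x1 - x2) * S x1 * S x2 / (S x1 + S x2)\<^sup>2"
    unfolding S_def using max x p neg
    by (intro gibbs_cov_two_maximizers ell_quotient_nondegenerate) auto
  thus ?thesis
    by (rule Lim_transform_eventually)
       (auto intro!: eventually_sequentiallyI[of 1] simp: mixed_partial_psi_cov)
qed

text \<open>The case m = 2 with a = p^5 / (24 (p - 1)^2). Here a^(-1/2) = 2 sqrt 6 (p - 1) /
  p^(5/2), which combines with p ((p - 1) / p)^(p - 1) to the stated power of p.\<close>

lemma mixed_partial_psi_tendsto_crit:
  assumes p: "p \<ge> 2" and max: "maximizers p (beta1_crit p) (beta2_crit p) = {crit_point p}"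
  shows "(\<lambda>n. 1 / real n powr (1 / 2) * mixed_partial (psi p n) (beta1_crit p) (beta2_crit p)) \<longlonglongrightarrow>
          2 * sqrt 6 * Gamma (3 / 4) / Gamma (1 / 4) * ((real p - 1) ^ p / real p powr (real p + 1 / 2))"
proof -
  define a where "a = real p ^ 5 / (24 * (real p - 1)\<^sup>2)"
  have pos: "real p > 0" "real p - 1 > 0" using p by auto
  have a: "a > 0" using pos by (simp add: a_def)
  have "((\<lambda>y. (ell p (beta1_crit p) (beta2_crit p) y - ell p (beta1_crit p) (beta2_crit p) (crit_point p)) / (y - crit_point p) ^ (2 * 2))
          \<longlongrightarrow> - a) (at (crit_point p))"
    using ell_quotient_crit[OF p] by (simp add: a_def)
  from gibbs_cov_unique_maximizer[OF max crit_point_bounds(1)[OF p] crit_point_bounds(2)[OF p] _ a this]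
  have "(\<lambda>n. real n powr (1 / 2) * gibbs_cov p n (beta1_crit p) (beta2_crit p)) \<longlonglongrightarrow>
      real p * crit_point p ^ (p - 1) * (a powr (- 1 / 2) * Gamma (3 / 4) / Gamma (1 / 4))"
    by simp
  also have "real p * crit_point p ^ (p - 1) * (a powr (- 1 / 2) * Gamma (3 / 4) / Gamma (1 / 4)) =
      real p * crit_point p ^ (p - 1) * a powr (- 1 / 2) * (Gamma (3 / 4) / Gamma (1 / 4))" by simp
  also have "real p * crit_point p ^ (p - 1) * a powr (- 1 / 2) = 2 * sqrt 6 * ((real p - 1) ^ p / real p powr (real p + 1 / 2))"
  proof -
    have "a powr (- 1 / 2) = inverse (sqrt a)"
      using a powr_minus[of a "1 / 2"] by (simp add: powr_half_sqrt)
    also have "sqrt a = (real p)\<^sup>2 * sqrt (real p) / (2 * sqrt 6 * (real p - 1))"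
    proof (rule real_sqrt_unique)
      show "((real p)\<^sup>2 * sqrt (real p) / (2 * sqrt 6 * (real p - 1)))\<^sup>2 = a"
      proof -
        have "(sqrt (real p))\<^sup>2 = real p" "(sqrt 6)\<^sup>2 = (6::real)" by simp_all
        hence "((real p)\<^sup>2 * sqrt (real p) / (2 * sqrt 6 * (real p - 1)))\<^sup>2
            = ((real p)\<^sup>2)\<^sup>2 * real p / (2\<^sup>2 * 6 * (real p - 1)\<^sup>2)"
          by (simp only: power_divide power_mult_distrib)
        also have "((real p)\<^sup>2)\<^sup>2 * real p = real p ^ 5" by (simp add: eval_nat_numeral)
        finally show ?thesis by (simp add: a_def)
      qed
    qed (use pos in simp)
    finally have 1: "a powr (- 1 / 2) = 2 * sqrt 6 * (real p - 1) / ((real p)\<^sup>2 * sqrt (real p))"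
      by simp
    have 2: "real p powr (real p + 1 / 2) = real p ^ p * sqrt (real p)"
      using pos by (simp add: powr_add powr_realpow powr_half_sqrt)
    obtain r where r: "p = Suc r" using p by (cases p) auto
    have 3: "real p * crit_point p ^ (p - 1) = (real p - 1) ^ (p - 1) * (real p)\<^sup>2 / real p ^ p"
      using pos by (simp add: crit_point_def r power_divide power2_eq_square del: of_nat_Suc)
    have 4: "(real p - 1) ^ p = (real p - 1) ^ (p - 1) * (real p - 1)" by (simp add: r)
    show ?thesis unfolding 1 2 3 4 using pos by (simp add: power2_eq_square)
  qed
  finally have "(\<lambda>n. real n powr (1 / 2) * gibbs_cov p n (beta1_crit p) (beta2_crit p)) \<longlonglongrightarrow>
      2 * sqrt 6 * Gamma (3 / 4) / Gamma (1 / 4) * ((real p - 1) ^ p / real p powr (real p + 1 / 2))"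
    by (simp add: mult_ac)
  thus ?thesis
  proof (rule Lim_transform_eventually, intro eventually_sequentiallyI[of 1])
    fix n :: nat assume n: "n \<ge> 1"
    have "real n = real n powr (1 / 2) * real n powr (1 / 2)" using n by (simp add: powr_add[symmetric])
    thus "real n powr (1 / 2) * gibbs_cov p n (beta1_crit p) (beta2_crit p) =
        1 / real n powr (1 / 2) * mixed_partial (psi p n) (beta1_crit p) (beta2_crit p)"
      using n by (simp add: mixed_partial_psi_cov powr_half_sqrt field_simps)
  qed
qed

theorem theorem6:
  fixes p :: nat and q :: "real \<Rightarrow> real" and \<beta>1 \<beta>2 :: real
  assumes "p \<ge> 2" and "is_phase_curve p q"
  shows
    "((\<beta>1, \<beta>2) \<notin> phase_curve p q \<longrightarrow>
        (\<forall>\<^sub>F (b1, b2) in nhds (\<beta>1, \<beta>2). convergent (\<lambda>n. psi p n b1 b2)) \<and>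
        (\<forall>n\<ge>1. mixed_partial_exists (psi p n) \<beta>1 \<beta>2) \<and>
        mixed_partial_exists (psi_lim p) \<beta>1 \<beta>2 \<and>
        (\<lambda>n. mixed_partial (psi p n) \<beta>1 \<beta>2) \<longlonglongrightarrow> mixed_partial (psi_lim p) \<beta>1 \<beta>2 \<and>
        (\<forall>x. maximizers p \<beta>1 \<beta>2 = {x} \<longrightarrow>
           mixed_partial (psi_lim p) \<beta>1 \<beta>2 = real p * x ^ (p - 1) / \<bar>ell'' p \<beta>1 \<beta>2 x\<bar>)) \<and>
     ((\<beta>1, \<beta>2) \<in> phase_curve p q \<and> (\<beta>1, \<beta>2) \<noteq> (beta1_crit p, beta2_crit p) \<longrightarrow>
        (\<forall>n\<ge>1. mixed_partial_exists (psi p n) \<beta>1 \<beta>2) \<and>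
        (\<forall>x1 x2. maximizers p \<beta>1 \<beta>2 = {x1, x2} \<and>
             x1 < (real p - 1) / real p \<and> (real p - 1) / real p < x2 \<longrightarrow>
           (\<lambda>n. (1 / real n) * mixed_partial (psi p n) \<beta>1 \<beta>2) \<longlonglongrightarrow>
             (x1 ^ p - x2 ^ p) * (x1 - x2)
               * sqrt (x1 * (1 - x1) * \<bar>ell'' p \<beta>1 \<beta>2 x1\<bar>)
               * sqrt (x2 * (1 - x2) * \<bar>ell'' p \<beta>1 \<beta>2 x2\<bar>)
             / (sqrt (x1 * (1 - x1) * \<bar>ell'' p \<beta>1 \<beta>2 x1\<bar>)
                + sqrt (x2 * (1 - x2) * \<bar>ell'' p \<beta>1 \<beta>2 x2\<bar>))\<^sup>2)) \<and>
     ((\<beta>1, \<beta>2) = (beta1_crit p, beta2_crit p) \<longrightarrow>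
        (\<forall>n\<ge>1. mixed_partial_exists (psi p n) \<beta>1 \<beta>2) \<and>
        (\<lambda>n. (1 / real n powr (1 / 2)) * mixed_partial (psi p n) \<beta>1 \<beta>2) \<longlonglongrightarrow>
          2 * sqrt 6 * Gamma (3 / 4) / Gamma (1 / 4)
            * ((real p - 1) ^ p / real p powr (real p + 1 / 2)))"
proof (intro conjI impI, goal_cases)
  \<comment> \<open>Goals 1 to 5 treat parameters off the curve, 6 and 7 the curve without its
    endpoint, 8 and 9 the critical point.\<close>
  note p = assms(1)
  have ex: "\<forall>n\<ge>1. mixed_partial_exists (psi p n) \<beta>1 \<beta>2" by (simp add: mixed_partial_exists_psi)
  have neg: "ell2 p \<beta>2 x < 0"
    if "(\<beta>1, \<beta>2) \<noteq> (beta1_crit p, beta2_crit p)" "x \<in> maximizers p \<beta>1 \<beta>2" "0 < x" "x < 1" for x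
    using ell2_maximizer_nonpos[OF that(2-4) p] degenerate_maximizer_crit[OF that(2-4) p] that(1) by linarith
  {
    case 1
    show ?case using psi_tendsto by (auto intro!: always_eventually convergentI)
  next
    case 2
    show ?case by (rule ex)
  next
    case 6
    show ?case by (rule ex)
  next
    case 8
    show ?case by (rule ex)
  next
    assume off: "(\<beta>1, \<beta>2) \<notin> phase_curve p q"
    obtain x where x: "0 < x" "x < 1" "maximizers p \<beta>1 \<beta>2 = {x}"
      using assms(2) off unfolding is_phase_curve_def by force
    \<comment> \<open>The endpoint belongs to the curve, so parameters off the curve are not
      critical and the maximizer is nondegenerate.\<close>
    have "(beta1_crit p, beta2_crit p) \<in> phase_curve p q"
      using assms(2) by (simp add: phase_curve_def is_phase_curve_def)
    hence "(\<beta>1, \<beta>2) \<noteq> (beta1_crit p, beta2_crit p)" using off by metis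
    hence nx: "ell2 p \<beta>2 x < 0" using x by (intro neg) auto
    note lim = mixed_partial_psi_lim[OF x(3,1,2) p nx]
    case 3
    show ?case by (rule mixed_partial_exists_psi_lim[OF x(3,1,2) p nx])
    case 4
    show ?case unfolding lim by (rule mixed_partial_psi_tendsto_unique[OF x(3,1,2) p nx])
    case 5
    show ?case using lim x p by (auto simp: ell''_eq)
  next
    case 7
    show ?case
    proof (intro allI impI, elim conjE)
      fix x1 x2 assume max: "maximizers p \<beta>1 \<beta>2 = {x1, x2}"
        and le: "x1 < (real p - 1) / real p" "(real p - 1) / real p < x2"
      \<comment> \<open>Positivity of x1 and x2 < 1 are not among the premises; they are inherited
        from the pair in \<open>is_phase_curve\<close>, which forms the same set.\<close>
      have "\<forall>x\<in>maximizers p \<beta>1 \<beta>2. 0 < x \<and> x < 1"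
      proof -
        obtain y1 y2 where "0 < y1" "y1 < (real p - 1) / real p" "(real p - 1) / real p < y2" "y2 < 1"
          "maximizers p \<beta>1 \<beta>2 = {y1, y2}"
          using assms(2) 7 unfolding is_phase_curve_def by blast
        thus ?thesis by auto
      qed
      hence x: "0 < x1" "x1 < 1" "0 < x2" "x2 < 1" "x1 < x2" using max le by auto
      have "ell2 p \<beta>2 x1 < 0" "ell2 p \<beta>2 x2 < 0" using 7 max x by (auto intro: neg)
      from mixed_partial_psi_tendsto_two[OF max x(1,5,4) p this]
      show "(\<lambda>n. (1 / real n) * mixed_partial (psi p n) \<beta>1 \<beta>2) \<longlonglongrightarrow>
             (x1 ^ p - x2 ^ p) * (x1 - x2)
               * sqrt (x1 * (1 - x1) * \<bar>ell'' p \<beta>1 \<beta>2 x1\<bar>)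
               * sqrt (x2 * (1 - x2) * \<bar>ell'' p \<beta>1 \<beta>2 x2\<bar>)
             / (sqrt (x1 * (1 - x1) * \<bar>ell'' p \<beta>1 \<beta>2 x1\<bar>)
                + sqrt (x2 * (1 - x2) * \<bar>ell'' p \<beta>1 \<beta>2 x2\<bar>))\<^sup>2"
        using x p by (simp add: ell''_eq)
    qed
  next
    case 9
    hence b: "\<beta>1 = beta1_crit p" "\<beta>2 = beta2_crit p" by auto
    obtain x where x: "0 < x" "x < 1" "maximizers p \<beta>1 \<beta>2 = {x}"
      using assms(2) 9 unfolding is_phase_curve_def by force
    have "ell p \<beta>1 \<beta>2 x \<le> ell p \<beta>1 \<beta>2 (crit_point p)"
      unfolding b by (rule ell_crit_le[OF p x(1,2)])
    hence "crit_point p \<in> maximizers p \<beta>1 \<beta>2"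
      using ell_max_eq[of x p \<beta>1 \<beta>2] x(3) crit_point_bounds[OF p] by (intro maximizersI) auto
    hence "maximizers p \<beta>1 \<beta>2 = {crit_point p}" using x(3) by auto
    thus ?case unfolding b by (rule mixed_partial_psi_tendsto_crit[OF p])
  }
qed

end
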